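(* For every reduced word $\rho$, the weak recording tableau $\widetilde Q(\rho)$ is a standard key tableau (of shape $\mathrm{des}(\widetilde P(\rho))$).
   Context: Reduced words: a word $\rho=(\rho_\ell,\ldots,\rho_1)$ of positive integers ($\rho_\ell$ leftmost) is reduced if $s_{\rho_\ell}\cdots s_{\rho_1}$ is a permutation with exactly $\ell$ inversions ($s_i=(i\ i{+}1)$). Runs, tableaux, $\mathrm{des}$. The run decomposition writes $\rho=\rho^{(k)}\cdots\rho^{(1)}$ as maximal consecutive strictly increasing segments. An increasing Young tableau is a left-justified array of rows $R_1$ (bottom), $R_2,\dots$ with lengths weakly decreasing upward, rows strictly increasing left to right, columns strictly increasing upward; its row reading word is $\cdots R_2R_1$. Weak descent composition of a reduced word: $r_i=\min(\rho^{(i)})$, $\hat r_k=r_k$, $\hat r_i=\min(r_i,\hat r_{i+1}-1)$; if $\hat r_1\le0$ then $\mathrm{des}(\rho)=\varnothing$, else $\mathrm{des}(\rho)$ has $\hat r_i$-th part $|\rho^{(i)}|$ and other parts $0$. Key tableaux. For a weak composition $a$, its key diagram is $\{(r,c):1\le c\le a_r\}$ (row $r$ from the bottom, column $c$). A standard key tableau of shape $a$ is a bijective filling of the key diagram with $1,\dots,n$ ($n=\sum a_r$) such that rows decrease left to right and whenever $i$ lies above $k$ in the same column with $i<k$, some entry $j$ to the right of $k$ in $k$'s row satisfies $i<j$. Drop. Increasing words are written left to right, $\tau=\tau_1\cdots\tau_t$, $\sigma=\sigma_1\cdots\sigma_s$. Drop alignment of $\sigma$ below $\tau$: if $\tau_j>\sigma_j$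 for all $j\le\min(s,t)$, $\sigma_j$ goes to column $j$; otherwise with $j_1$ least such that $\tau_{j_1}\le\sigma_{j_1}$, $\sigma_1..\sigma_{j_1-1}$ go to columns $1..j_1-1$, column $j_1$ gets nothing, and $\sigma_{j_1}\cdots\sigma_s$ is aligned recursively below $\tau_{j_1+1}\cdots\tau_t$. With $x_1,\dots,x_k$ the letters of $\tau$ with nothing below, $\tau=\tau^{(0)}x_1\tau^{(1)}\cdots x_k\tau^{(k)}$, $\sigma=\sigma^{(0)}\cdots\sigma^{(k)}\sigma^{(k+1)}$ ($\sigma^{(j)}$ directly below $\tau^{(j)}$, $\sigma^{(k+1)}$ right of column $t$). For $\tau\sigma$ reduced, $\mathrm{drop}(\tau\sigma)=(\tau^{(0)}\cdots\tau^{(k)},\ \sigma^{(0)}x_1\hat\sigma^{(1)}\cdots x_k\hat\sigma^{(k)}\sigma^{(k+1)})$ (top, bottom), $\hat\sigma^{(j)}_i=\sigma^{(j)}_i+1$ for $i\le b_j$, else unchanged, $b_j=\max\{b\ge0:\tau^{(j)}_i=\sigma^{(j)}_1+i\ \forall i\le b\}$ if $x_j=\tau^{(j)}_1-1$, else $0$. $\mathrm{drop}_i$ replaces rows $(R_{i+1},R_i)$ by $\mathrm{drop}(R_{i+1}R_i)$. For reduced $\pi$, $\mathrm{drop}(\pi)$: start from the run decomposition of $\pi$ as rows; while the nonempty rows are not an increasing Young tableau, pick $k$ with $|R_{k+1}|>|R_k|$ or $R_{k+1,j}\le R_{k,j}$ for some $j\le\min(|R_k|,|R_{k+1}|)$ and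 apply $\mathrm{drop}_k$; the final increasing Young tableau is $\mathrm{drop}(\pi)$. Lift. Lift alignment of $\tau$ above $\sigma$: if $\tau_{t-i+1}\ge\sigma_{s-i+1}$ for all $i\le\min(s,t)$, right justify; else with $i_1$ least such that $\tau_{t-i_1+1}<\sigma_{s-i_1+1}$, put $\tau_{t-i_1+2..t}$ above $\sigma_{s-i_1+2..s}$, nothing above $\sigma_{s-i_1+1}$, recurse on $\tau_1\cdots\tau_{t-i_1+1}$ above $\sigma_1\cdots\sigma_{s-i_1}$. With $x_1,\dots,x_k$ the letters of $\sigma$ with nothing above: $\sigma=\sigma^{(1)}x_1\sigma^{(2)}\cdots x_k\sigma^{(k+1)}$, $\tau=\tau^{(0)}\tau^{(1)}\cdots\tau^{(k+1)}$ ($\tau^{(j)}$ above $\sigma^{(j)}$, $\tau^{(0)}$ left of $\sigma$); $\mathrm{lift}(\tau\sigma)=(\tau^{(0)}\tau^{(1)}x_1\tau^{(2)}\cdots x_k\tau^{(k+1)},\ \sigma^{(1)}\check\sigma^{(2)}\cdots\check\sigma^{(k+1)})$, $\check\sigma^{(j+1)}_i=\sigma^{(j+1)}_i-1$ for $i\le b_j$, else unchanged, $b_j=\max\{b:\tau^{(j+1)}_i=\sigma^{(j+1)}_i=x_j+i\ \forall i\le b\}$ if $x_j=\sigma^{(j+1)}_1-1$, else $0$. $\mathrm{lift}_i$ replaces $(R_{i+1},R_i)$ by $\mathrm{lift}(R_{i+1}R_i)$; faithful means it changes its input; $\mathrm{lift}_{[i,j]}=\mathrm{lift}_j\circ\cdots\circ\mathrm{lift}_i$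 is faithful on $T$ if each successive step is. For $P$ an increasing Young tableau with reduced reading word: $T_0=P$; if every $\mathrm{lift}_i$ fixes $T_{k-1}$ then $\mathrm{lift}(P)=T_{k-1}$; else $T_k=\mathrm{lift}_{[i_k,j_k]}(T_{k-1})$ with $j_k$ the largest $j$ admitting $i\le j$ such that $\mathrm{lift}_{[i,j]}$ is faithful on $T_{k-1}$, $i_k$ the least such $i$ for $j_k$. Insertion. Edelman–Greene insertion $P\leftarrow x$ into an increasing Young tableau $P$ (rows $P_1$ bottom, $P_2,\dots$): $x_0=x$; for $i\ge0$, if $x_i\ge z$ for all $z\in P_{i+1}$ (possibly empty), append $x_i$ to $P_{i+1}$ and stop; else let $x_{i+1}$ be the smallest entry of $P_{i+1}$ greater than $x_i$, replace it by $x_i$ unless $x_{i+1}=x_i+1$ and $x_i\in P_{i+1}$ (then leave the row), and insert $x_{i+1}$ into $P_{i+2}$. For $\rho=(\rho_k,\ldots,\rho_1)$, $\pi_{k+1}$ is the empty word and, for $i=k,\ldots,1$, $\pi_i$ is the row reading word of $\mathrm{lift}(\mathrm{drop}(\pi_{i+1})\leftarrow\rho_i)$; $\widetilde P(\rho)=\pi_1$. The weak recording tableau $\widetilde Q(\rho)$ is the filling of the key diagram of $\mathrm{des}(\pi_1)$ in which, for each $i=k,\ldots,1$, the cells of the key diagram of $\mathrm{des}(\pi_i)$ not in the key diagram of $\mathrm{des}(\pi_{i+1})$ receive the entry $i$ (these differences are single cells, the diagrams being nested).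
   Formalization: Lift is taken to leave its input unchanged whenever, in the lift alignment, letters of σ protrude to the left of τ (in particular below an empty row); read literally, a top row would rise forever and lift(P) would not exist. *)

theory Defs
  imports "HOL-Combinatorics.Transposition" "HOL-Library.While_Combinator"
begin

text \<open>
  Words are lists read left to right, so \<open>(\<rho>\<^sub>\<ell>, \<dots>, \<rho>\<^sub>1)\<close> is the list whose head is \<open>\<rho>\<^sub>\<ell>\<close>.
  Arrays of rows are lists of words with the bottom row first: \<open>R\<^sub>i\<close> is \<open>T ! (i - 1)\<close>,
  hence \<open>drop\<^sub>i\<close> and \<open>lift\<^sub>i\<close> are \<open>drop_at (i - 1)\<close> and \<open>lift_at (i - 1)\<close>.
\<close>

section \<open>Reduced words\<close>

definition word_perm :: "nat list \<Rightarrow> nat \<Rightarrow> nat" where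
  "word_perm \<rho> = foldr (\<lambda>i f. transpose i (Suc i) \<circ> f) \<rho> id"

definition inversions :: "(nat \<Rightarrow> nat) \<Rightarrow> (nat \<times> nat) set" where
  "inversions p = {(i, j). i < j \<and> p j < p i}"

definition reduced_word :: "nat list \<Rightarrow> bool" where
  "reduced_word \<rho> \<longleftrightarrow>
     (\<forall>i\<in>set \<rho>. 1 \<le> i) \<and> card (inversions (word_perm \<rho>)) = length \<rho>"

section \<open>Runs, tableaux and weak descent compositions\<close>

fun segments :: "nat list \<Rightarrow> nat list list" where
  "segments [] = []"
| "segments (x # w) =
     (case segments w of
        [] \<Rightarrow> [[x]]
      | R # Rs \<Rightarrow> if x < hd R then (x # R) # Rs else [x] # R # Rs)"

definition runs :: "nat list \<Rightarrow> nat list list" where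
  "runs \<rho> = rev (segments \<rho>)"

definition row_reading_word :: "nat list list \<Rightarrow> nat list" where
  "row_reading_word T = concat (rev T)"

definition increasing_tableau :: "nat list list \<Rightarrow> bool" where
  "increasing_tableau T \<longleftrightarrow>
     (\<forall>R\<in>set T. R \<noteq> [] \<and> sorted_wrt (<) R) \<and>
     (\<forall>i. Suc i < length T \<longrightarrow>
        length (T ! Suc i) \<le> length (T ! i) \<and>
        (\<forall>j<length (T ! Suc i). T ! i ! j < T ! Suc i ! j))"

text \<open>The numbers \<open>\<hat>r\<^sub>1, \<dots>, \<hat>r\<^sub>k\<close> in this order, for the runs given from the bottom up.\<close>

fun run_positions :: "nat list list \<Rightarrow> int list" where
  "run_positions [] = []"
| "run_positions [R] = [int (Min (set R))]"
| "run_positions (R # S # Rs) =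
     (let h = run_positions (S # Rs) in min (int (Min (set R))) (hd h - 1) # h)"

text \<open>
  A weak composition is a function on the positive integers (its value at \<open>0\<close> is irrelevant).
  \<open>None\<close> stands for \<open>des(\<rho>) = \<emptyset>\<close>, which differs from the zero composition \<open>des []\<close>.
\<close>

definition des :: "nat list \<Rightarrow> (nat \<Rightarrow> nat) option" where
  "des \<rho> =
     (let Rs = runs \<rho>; h = run_positions Rs in
      if Rs \<noteq> [] \<and> hd h \<le> 0 then None
      else Some (\<lambda>r. \<Sum>i<length Rs. if h ! i = int r then length (Rs ! i) else 0))"

section \<open>Key tableaux\<close>

definition key_diagram :: "(nat \<Rightarrow> nat) \<Rightarrow> (nat \<times> nat) set" where
  "key_diagram a = {(r, c). 1 \<le> r \<and> 1 \<le> c \<and> c \<le> a r}"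

definition standard_key_tableau :: "(nat \<Rightarrow> nat) \<Rightarrow> (nat \<times> nat \<Rightarrow> nat) \<Rightarrow> bool" where
  "standard_key_tableau a Q \<longleftrightarrow>
     bij_betw Q (key_diagram a) {1..\<Sum>r | 1 \<le> r \<and> a r \<noteq> 0. a r} \<and>
     (\<forall>r c c'. (r, c) \<in> key_diagram a \<and> (r, c') \<in> key_diagram a \<and> c < c' \<longrightarrow>
        Q (r, c') < Q (r, c)) \<and>
     (\<forall>r r' c. (r, c) \<in> key_diagram a \<and> (r', c) \<in> key_diagram a \<and>
        r' < r \<and> Q (r, c) < Q (r', c) \<longrightarrow>
        (\<exists>c'>c. (r', c') \<in> key_diagram a \<and> Q (r, c) < Q (r', c')))"

section \<open>Columns and blocks of an alignment\<close>

text \<open>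
  An alignment is the list of its columns: \<open>Inl x\<close> is a letter \<open>x\<close> with nothing below
  (drop) or above (lift), \<open>Inr (t, s)\<close> is the letter \<open>t\<close> of \<open>\<tau>\<close> directly above the letter \<open>s\<close>
  of \<open>\<sigma>\<close>.  The first block consists of the pairs preceding all the \<open>x\<^sub>j\<close>; \<open>later_blocks\<close>
  lists each \<open>x\<^sub>j\<close> together with the pairs following it up to the next one.
\<close>

type_synonym column = "nat + nat \<times> nat"

definition first_block :: "column list \<Rightarrow> (nat \<times> nat) list" where
  "first_block cs = map projr (takeWhile (\<lambda>c. \<not> isl c) cs)"

fun later_blocks :: "column list \<Rightarrow> (nat \<times> (nat \<times> nat) list) list" where
  "later_blocks [] = []"
| "later_blocks (Inl x # cs) = (x, first_block cs) # later_blocks cs"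
| "later_blocks (Inr p # cs) = later_blocks cs"

section \<open>Drop\<close>

text \<open>
  The first \<open>j\<close> with \<open>\<tau>\<^sub>j \<le> \<sigma>\<^sub>j\<close> is found by scanning both words from the left.  The second
  component of the result is \<open>\<sigma>\<^bsup>(k+1)\<^esup>\<close>, the part of \<open>\<sigma>\<close> to the right of \<open>\<tau>\<close>.
\<close>

fun drop_align :: "nat list \<Rightarrow> nat list \<Rightarrow> column list \<times> nat list" where
  "drop_align [] \<sigma> = ([], \<sigma>)"
| "drop_align (t # \<tau>) [] = (map Inl (t # \<tau>), [])"
| "drop_align (t # \<tau>) (s # \<sigma>) =
     (if s < t then apfst (Cons (Inr (t, s))) (drop_align \<tau> \<sigma>)
      else apfst (Cons (Inl t)) (drop_align \<tau> (s # \<sigma>)))"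

definition drop_shift :: "nat \<Rightarrow> (nat \<times> nat) list \<Rightarrow> nat" where
  "drop_shift x ps =
     (if ps \<noteq> [] \<and> fst (hd ps) = x + 1
      then Max {b \<in> {..length ps}. \<forall>i<b. fst (ps ! i) = snd (hd ps) + Suc i}
      else 0)"

definition drop_hat :: "nat \<Rightarrow> (nat \<times> nat) list \<Rightarrow> nat list" where
  "drop_hat x ps =
     (let b = drop_shift x ps; \<sigma> = map snd ps in map (\<lambda>s. s + 1) (take b \<sigma>) @ drop b \<sigma>)"

definition drop_pair :: "nat list \<Rightarrow> nat list \<Rightarrow> nat list \<times> nat list" where
  "drop_pair \<tau> \<sigma> =
     (let (cs, right) = drop_align \<tau> \<sigma>; B = first_block cs; Bs = later_blocks cs in
      (map fst B @ concat (map (\<lambda>(x, ps). map fst ps) Bs),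
       map snd B @ concat (map (\<lambda>(x, ps). x # drop_hat x ps) Bs) @ right))"

definition drop_at :: "nat \<Rightarrow> nat list list \<Rightarrow> nat list list" where
  "drop_at i T =
     (let (top, bottom) = drop_pair (T ! Suc i) (T ! i) in T[Suc i := top, i := bottom])"

definition nonempty_rows :: "nat list list \<Rightarrow> nat list list" where
  "nonempty_rows T = filter (\<lambda>R. R \<noteq> []) T"

definition drop_step :: "nat list list \<Rightarrow> nat list list \<Rightarrow> bool" where
  "drop_step T T' \<longleftrightarrow>
     \<not> increasing_tableau (nonempty_rows T) \<and>
     (\<exists>k. Suc k < length T \<and>
        (length (T ! k) < length (T ! Suc k) \<or>
         (\<exists>j<min (length (T ! k)) (length (T ! Suc k)). T ! Suc k ! j \<le> T ! k ! j)) \<and>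
        T' = drop_at k T)"

definition drop_tableau :: "nat list \<Rightarrow> nat list list" where
  "drop_tableau \<pi> =
     (THE P. increasing_tableau P \<and> (\<exists>T. drop_step\<^sup>*\<^sup>* (runs \<pi>) T \<and> P = nonempty_rows T))"

section \<open>Lift\<close>

text \<open>
  Both arguments are reversed words, and the columns are found from right to left.  The second
  component of the result is (reversed) \<open>\<tau>\<^bsup>(0)\<^esup>\<close>, the part of \<open>\<tau>\<close> to the left of \<open>\<sigma>\<close>, and the
  third one is the part of \<open>\<sigma>\<close> protruding to the left of \<open>\<tau>\<close>.
\<close>

fun lift_align_rev ::
  "nat list \<Rightarrow> nat list \<Rightarrow> column list \<times> nat list \<times> nat list" where
  "lift_align_rev \<tau> [] = ([], \<tau>, [])"
| "lift_align_rev [] (s # \<sigma>) = ([], [], s # \<sigma>)"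
| "lift_align_rev (t # \<tau>) (s # \<sigma>) =
     (if s \<le> t then apfst (Cons (Inr (t, s))) (lift_align_rev \<tau> \<sigma>)
      else apfst (Cons (Inl s)) (lift_align_rev (t # \<tau>) \<sigma>))"

definition lift_shift :: "nat \<Rightarrow> (nat \<times> nat) list \<Rightarrow> nat" where
  "lift_shift x ps =
     (if ps \<noteq> [] \<and> snd (hd ps) = x + 1
      then Max {b \<in> {..length ps}. \<forall>i<b. fst (ps ! i) = x + Suc i \<and> snd (ps ! i) = x + Suc i}
      else 0)"

definition lift_check :: "nat \<Rightarrow> (nat \<times> nat) list \<Rightarrow> nat list" where
  "lift_check x ps =
     (let b = lift_shift x ps; \<sigma> = map snd ps in map (\<lambda>s. s - 1) (take b \<sigma>) @ drop b \<sigma>)"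

text \<open>
  The decomposition \<open>\<tau> = \<tau>\<^bsup>(0)\<^esup>\<tau>\<^bsup>(1)\<^esup>\<cdots>\<close> with \<open>\<tau>\<^bsup>(0)\<^esup>\<close> to the left of \<open>\<sigma>\<close> presupposes that \<open>\<tau>\<close>
  reaches at least as far left as \<open>\<sigma>\<close>; when \<open>\<sigma>\<close> protrudes to the left of \<open>\<tau>\<close>, nothing is
  lifted.  In particular a row is never lifted into an empty row.  Lifting the protruding letters
  as well would make every top row rise forever, and it would turn the rows \<open>[3]\<close> over \<open>[2, 3]\<close>
  into \<open>[2, 3]\<close> over \<open>[2]\<close>, so that the key diagrams of the weak insertion of \<open>[3, 2, 3]\<close> would
  not be nested.
\<close>

definition lift_pair :: "nat list \<Rightarrow> nat list \<Rightarrow> nat list \<times> nat list" where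
  "lift_pair \<tau> \<sigma> =
     (case lift_align_rev (rev \<tau>) (rev \<sigma>) of (cs_rev, left_rev, protruding) \<Rightarrow>
        if protruding \<noteq> [] then (\<tau>, \<sigma>)
        else
          let cs = rev cs_rev; B = first_block cs; Bs = later_blocks cs in
          (rev left_rev @ map fst B @ concat (map (\<lambda>(x, ps). x # map fst ps) Bs),
           map snd B @ concat (map (\<lambda>(x, ps). lift_check x ps) Bs)))"

definition lift_at :: "nat \<Rightarrow> nat list list \<Rightarrow> nat list list" where
  "lift_at i T =
     (if Suc i < length T
      then let (top, bottom) = lift_pair (T ! Suc i) (T ! i) in T[Suc i := top, i := bottom]
      else T)"

text \<open>\<open>lift_range i j\<close> is the composition over the indices \<open>m\<close> with \<open>i \<le> m < j\<close>,
  and \<open>faithful i j\<close> concerns \<open>lift\<^bsub>[i,j]\<^esub>\<close>, which includes \<open>j\<close>.\<close>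

definition lift_range :: "nat \<Rightarrow> nat \<Rightarrow> nat list list \<Rightarrow> nat list list" where
  "lift_range i j T = fold lift_at [i..<j] T"

definition faithful :: "nat \<Rightarrow> nat \<Rightarrow> nat list list \<Rightarrow> bool" where
  "faithful i j T \<longleftrightarrow> (\<forall>m\<in>{i..j}. lift_at m (lift_range i m T) \<noteq> lift_range i m T)"

definition lift_step :: "nat list list \<Rightarrow> nat list list" where
  "lift_step T =
     (let j = (GREATEST j. \<exists>i\<le>j. faithful i j T);
          i = (LEAST i. i \<le> j \<and> faithful i j T)
      in lift_range i (Suc j) T)"

definition lift_tableau :: "nat list list \<Rightarrow> nat list list" where
  "lift_tableau P = while (\<lambda>T. \<exists>i. lift_at i T \<noteq> T) lift_step P"

section \<open>Weak insertion\<close>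

fun eg_insert :: "nat list list \<Rightarrow> nat \<Rightarrow> nat list list" where
  "eg_insert [] x = [[x]]"
| "eg_insert (R # Rs) x =
     (if \<forall>z\<in>set R. z \<le> x then (R @ [x]) # Rs
      else
        let y = Min {z \<in> set R. x < z} in
        (if y = x + 1 \<and> x \<in> set R then R else map (\<lambda>z. if z = y then x else z) R)
          # eg_insert Rs y)"

text \<open>The word \<open>\<pi>\<^sub>1\<close> of \<open>\<rho>\<close>; the word \<open>\<pi>\<^sub>i\<close> of \<open>\<rho> = (\<rho>\<^sub>k, \<dots>, \<rho>\<^sub>1)\<close> is that of the prefix
  \<open>(\<rho>\<^sub>k, \<dots>, \<rho>\<^sub>i)\<close>.\<close>

definition weak_P :: "nat list \<Rightarrow> nat list" where
  "weak_P \<rho> =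
     foldl (\<lambda>\<pi> x. row_reading_word (lift_tableau (eg_insert (drop_tableau \<pi>) x))) [] \<rho>"

definition weak_insertion_word :: "nat list \<Rightarrow> nat \<Rightarrow> nat list" where
  "weak_insertion_word \<rho> i = weak_P (take (length \<rho> + 1 - i) \<rho>)"

definition des_diagram :: "nat list \<Rightarrow> (nat \<times> nat) set" where
  "des_diagram \<pi> = (case des \<pi> of None \<Rightarrow> {} | Some a \<Rightarrow> key_diagram a)"

text \<open>Only the values on \<open>des_diagram (weak_P \<rho>)\<close> matter.\<close>

definition weak_Q :: "nat list \<Rightarrow> nat \<times> nat \<Rightarrow> nat" where
  "weak_Q \<rho> cell =
     (THE i. 1 \<le> i \<and> i \<le> length \<rho> \<and>
        cell \<in> des_diagram (weak_insertion_word \<rho> i)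
              - des_diagram (weak_insertion_word \<rho> (i + 1)))"

end

theory Submission
  imports Defs "HOL-Library.Multiset"
begin

text \<open>
  To an increasing tableau \<open>P\<close> are attached decreasing sets \<open>K 0 P\<close>, \<open>K 1 P\<close>, \<open>\<dots>\<close>, the columns of
  its key: \<open>K 0 P\<close> is the first column, and \<open>K (c + 1) P\<close> consists of the elements of the first
  column that are matched, as opening brackets, with the elements of \<open>K c\<close> of the remaining columns.
  A step of Edelman--Greene insertion changes exactly one of these sets, \<open>K c\<close> say, by adding one
  element that lies below all elements of \<open>K c P - K (c + 1) P\<close>.  Hence it suffices that the diagram
  of the descent composition of the lifted tableau has the columns \<open>K 0 P\<close>, \<open>K 1 P\<close>, \<open>\<dots>\<close>: it then
  grows by one cell \<open>(r, c)\<close> at a time, and any row below \<open>r\<close> that reaches column \<open>c\<close> already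
  reaches column \<open>c + 1\<close>, which is the condition on key tableaux.

  For this, consider the arrays of increasing rows whose reading word is Coxeter--Knuth equivalent to
  that of \<open>P\<close> and whose row lengths are a permutation of those of \<open>P\<close>.  Such an array is determined
  by its row lengths.  If moreover its first column is that of \<open>P\<close>, inserting its rows one after the
  other bounds the lengths of its upper rows by the key of \<open>P\<close>, and exactly one array has row
  lengths given by the key.  Drop is row insertion, and lift inverts it as long as the first column
  is preserved, so the lifts end at that array; dropping it gives back \<open>P\<close>, since insertion is
  invariant under Coxeter--Knuth equivalence.
\<close>

section \<open>Length-minimal words\<close>

text \<open>The recursion for \<open>K\<close> peels off the first column, and this creates the main
  obstacle: seen from the remaining columns, an insertion path may stop where it enters the first
  column, with a letter left over, so it is no longer an insertion. The induction therefore runs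
  over partial paths \<open>bump\<close>. For these the sets \<open>K c\<close> need not be
  invariant; invariant is their matching with any column that fits to the left
  (\<open>mu_partial\<close>). Reducedness is used mainly in one form: a letter inserted into a row
  that contains it finds its successor there too. This makes the exceptional rule of insertion a
  braid relation and makes it reversible. The sum of squares singles out permuted row lengths
  because inserting one increasing row into another can only spread their two lengths apart; if the
  sum is already maximal, the lengths are at most exchanged. Strictly increasing first letters have
  two effects: the rows are exactly the runs of the reading word, and no run is shifted in the
  descent composition. The lengths of the canonical array can therefore be read off from
  \<open>des\<close>.\<close>

lemma word_perm_Nil [simp]: "word_perm [] = id"
  and word_perm_Cons [simp]: "word_perm (i # w) = transpose i (Suc i) \<circ> word_perm w"
  by (simp_all add: word_perm_def)

lemma word_perm_append [simp]: "word_perm (u @ v) = word_perm u \<circ> word_perm v"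
  by (induction u) (auto simp: comp_assoc)

lemma inj_word_perm: "inj (word_perm w)"
  by (induction w) (auto simp: inj_def transpose_eq_iff)

text \<open>Minimal length takes the place of the inversion count because it passes by definition to
  factors and to words of equal length with the same permutation.\<close>

definition red :: "nat list \<Rightarrow> bool" where
  "red w \<longleftrightarrow> (\<forall>w'. word_perm w' = word_perm w \<longrightarrow> length w \<le> length w')"

text \<open>Composing on the left exchanges the values \<open>i\<close> and \<open>Suc i\<close>.
  This affects the relative order at one pair of positions only, the preimages of these two
  values.\<close>

lemma inversions_transpose_subset:
  assumes "inj p"
  shows "inversions (transpose i (Suc i) \<circ> p) \<subseteq>
    insert (min (inv p i) (inv p (Suc i)), max (inv p i) (inv p (Suc i))) (inversions p)"
proof
  fix ab assume "ab \<in> inversions (transpose i (Suc i) \<circ> p)"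
  then obtain a b where ab: "ab = (a, b)" "a < b"
    "transpose i (Suc i) (p b) < transpose i (Suc i) (p a)"
    by (auto simp: inversions_def)
  have inv: "inv p (p x) = x" for x using assms by simp
  consider "p b < p a" | "p a = i" "p b = Suc i" | "p b = p a" | "p a < p b" "\<not> (p a = i \<and> p b = Suc i)"
    by linarith
  then show "ab \<in> insert (min (inv p i) (inv p (Suc i)), max (inv p i) (inv p (Suc i))) (inversions p)"
  proof cases
    case 1 then show ?thesis using ab by (auto simp: inversions_def)
  next
    case 2 then have "inv p i = a" "inv p (Suc i) = b" using inv by metis+
    then show ?thesis using ab by auto
  next
    case 3 then show ?thesis using ab by auto
  next
    case 4 then show ?thesis using ab(3) by (auto simp: transpose_def split: if_splits)
  qed
qed

lemma inversions_word_perm: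
  "finite (inversions (word_perm w)) \<and> card (inversions (word_perm w)) \<le> length w"
proof (induction w)
  case Nil
  have "inversions id = {}" by (auto simp: inversions_def)
  then show ?case by (simp only: word_perm_Nil finite.emptyI card.empty) simp
next
  case (Cons i w)
  let ?e = "(min (inv (word_perm w) i) (inv (word_perm w) (Suc i)), max (inv (word_perm w) i) (inv (word_perm w) (Suc i)))"
  have sub: "inversions (word_perm (i # w)) \<subseteq> insert ?e (inversions (word_perm w))"
    using inversions_transpose_subset[OF inj_word_perm] by simp
  moreover have "finite (insert ?e (inversions (word_perm w)))" using Cons by simp
  ultimately have "finite (inversions (word_perm (i # w)))"
    "card (inversions (word_perm (i # w))) \<le> card (insert ?e (inversions (word_perm w)))"
    using finite_subset card_mono by blast+
  moreover have "card (insert ?e (inversions (word_perm w))) \<le> Suc (length w)"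
    using Cons by (simp add: card_insert_if)
  ultimately show ?case by (metis le_trans length_Cons)
qed

text \<open>The number of inversions is a lower bound for the length of every word of the
  permutation, and a reduced word attains it.\<close>

lemma red_if_reduced: "reduced_word w \<Longrightarrow> red w"
  unfolding red_def reduced_word_def using inversions_word_perm by metis

lemma red_peq: "red w \<Longrightarrow> word_perm w' = word_perm w \<Longrightarrow> length w' = length w \<Longrightarrow> red w'"
  by (simp add: red_def)

lemma red_middle: assumes "red (u @ t @ v)" shows "red t"
  unfolding red_def
proof (intro allI impI)
  fix t' assume "word_perm t' = word_perm t"
  then have "word_perm (u @ t' @ v) = word_perm (u @ t @ v)" by simp
  then have "length (u @ t @ v) \<le> length (u @ t' @ v)" using assms unfolding red_def by blast
  then show "length t \<le> length t'" by simp
qed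

lemma red_appendD1: "red (u @ v) \<Longrightarrow> red u" using red_middle[of "[]" u v] by simp
lemma red_appendD2: "red (u @ v) \<Longrightarrow> red v" using red_middle[of u v "[]"] by simp
lemma red_ConsD: "red (x # v) \<Longrightarrow> red v" using red_appendD2[of "[x]" v] by simp

lemma not_red_square: "\<not> red (x # x # v)"
proof
  assume "red (x # x # v)"
  moreover have "word_perm v = word_perm (x # x # v)" by (auto simp: fun_eq_iff)
  ultimately have "length (x # x # v) \<le> length v" unfolding red_def by blast
  then show False by simp
qed

lemma transpose_comm: "Suc a < b \<Longrightarrow>
  transpose a (Suc a) \<circ> transpose b (Suc b) = transpose b (Suc b) \<circ> transpose a (Suc a)"
  by (auto simp: fun_eq_iff transpose_def)

lemma transpose_braid:
  "transpose a (Suc a) \<circ> (transpose (Suc a) (Suc (Suc a)) \<circ> transpose a (Suc a)) =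
   transpose (Suc a) (Suc (Suc a)) \<circ> (transpose a (Suc a) \<circ> transpose (Suc a) (Suc (Suc a)))"
  by (auto simp: fun_eq_iff transpose_def)

section \<open>Coxeter-Knuth equivalence\<close>

text \<open>\<open>k1\<close> and \<open>k2\<close> are the Knuth relations with strict
  inequalities, so the exchanged letters \<open>a\<close> and \<open>c\<close> differ by at least 2
  and commute as transpositions; \<open>k3\<close> is the braid relation.\<close>

inductive kb :: "nat list \<Rightarrow> nat list \<Rightarrow> bool" where
  k1: "a < b \<Longrightarrow> b < c \<Longrightarrow> kb [b, a, c] [b, c, a]"
| k2: "a < b \<Longrightarrow> b < c \<Longrightarrow> kb [a, c, b] [c, a, b]"
| k3: "kb [a, Suc a, a] [Suc a, a, Suc a]"

inductive ckeq :: "nat list \<Rightarrow> nat list \<Rightarrow> bool" where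
  ck_base: "kb t t' \<Longrightarrow> ckeq (u @ t @ v) (u @ t' @ v)"
| ck_refl [simp, intro]: "ckeq t t"
| ck_sym: "ckeq t t' \<Longrightarrow> ckeq t' t"
| ck_trans [trans]: "ckeq t t' \<Longrightarrow> ckeq t' t'' \<Longrightarrow> ckeq t t''"

lemma ck_ctx: "ckeq t t' \<Longrightarrow> ckeq (u @ t @ v) (u @ t' @ v)"
proof (induction rule: ckeq.induct)
  case (ck_base t t' u' v')
  then show ?case using ckeq.ck_base[of t t' "u @ u'" "v' @ v"] by simp
qed (auto intro: ckeq.intros)

lemma ck_app: "ckeq t t' \<Longrightarrow> ckeq u u' \<Longrightarrow> ckeq (t @ u) (t' @ u')"
  using ck_ctx[of t t' "[]" u] ck_ctx[of u u' t' "[]"] ck_trans by auto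

lemma ck_Cons: "ckeq t t' \<Longrightarrow> ckeq (x # t) (x # t')"
  using ck_ctx[of t t' "[x]" "[]"] by simp

lemma ck1: "a < b \<Longrightarrow> b < c \<Longrightarrow> ckeq (b # a # c # v) (b # c # a # v)"
  using ck_base[OF k1, of a b c "[]" v] by simp
lemma ck2: "a < b \<Longrightarrow> b < c \<Longrightarrow> ckeq (a # c # b # v) (c # a # b # v)"
  using ck_base[OF k2, of a b c "[]" v] by simp
lemma ck3: "ckeq (a # Suc a # a # v) (Suc a # a # Suc a # v)"
  using ck_base[OF k3, of "[]" a v] by simp

lemma kb_perm: "kb t t' \<Longrightarrow> word_perm t = word_perm t' \<and> length t = length t'"
proof (induction rule: kb.induct)
  case (k1 a b c)
  then have "transpose a (Suc a) \<circ> transpose c (Suc c) = transpose c (Suc c) \<circ> transpose a (Suc a)"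
    by (intro transpose_comm) simp
  then show ?case by simp
next
  case (k2 a b c)
  then have "transpose a (Suc a) \<circ> transpose c (Suc c) = transpose c (Suc c) \<circ> transpose a (Suc a)"
    by (intro transpose_comm) simp
  then show ?case by (simp flip: comp_assoc)
next
  case (k3 a) show ?case using transpose_braid by simp
qed

lemma ck_perm: "ckeq t t' \<Longrightarrow> word_perm t = word_perm t' \<and> length t = length t'"
  by (induction rule: ckeq.induct) (auto dest: kb_perm)

lemma ck_red: "ckeq t t' \<Longrightarrow> red t \<longleftrightarrow> red t'"
  using ck_perm red_peq by metis

lemma red_comm: "red (b # a # v) \<Longrightarrow> Suc a < b \<or> Suc b < a \<Longrightarrow> red (a # b # v)"
  by (rule red_peq) (auto simp: transpose_comm[of a b] transpose_comm[of b a] simp flip: comp_assoc)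

section \<open>Row insertion\<close>

abbreviation srt :: "nat list \<Rightarrow> bool" where "srt \<equiv> sorted_wrt (<)"

text \<open>If \<open>x\<close> occurs in the row, \<open>Suc x\<close> is passed on without testing
  that it occurs as well; for reduced words it does (\<open>red_insert_mem\<close>). The output is a
  list of at most one letter, so that the outputs of a whole word can be concatenated.\<close>

fun ins :: "nat list \<Rightarrow> nat \<Rightarrow> nat list \<times> nat list" where
  "ins [] x = ([x], [])"
| "ins (r # R) x =
    (if x < r then (x # R, [r]) else if x = r then (r # R, [Suc x]) else apfst (Cons r) (ins R x))"

fun insw :: "nat list \<Rightarrow> nat list \<Rightarrow> nat list \<times> nat list" where
  "insw R [] = (R, [])"
| "insw R (x # w) = (case ins R x of (R1, o1) \<Rightarrow> apsnd ((@) o1) (insw R1 w))"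

fun tins :: "nat list list \<Rightarrow> nat \<Rightarrow> nat list list" where
  "tins [] x = [[x]]"
| "tins (R # Rs) x = (case ins R x of (R', []) \<Rightarrow> R' # Rs | (R', y # _) \<Rightarrow> R' # tins Rs y)"

definition tinsw :: "nat list list \<Rightarrow> nat list \<Rightarrow> nat list list" where
  "tinsw T w = foldl tins T w"

lemma tinsw_simps [simp]: "tinsw T [] = T" "tinsw T (x # w) = tinsw (tins T x) w"
  "tinsw T (u @ v) = tinsw (tinsw T u) v"
  by (simp_all add: tinsw_def)

lemma ins_fst_set: "set (fst (ins R x)) \<subseteq> insert x (set R)"
  by (induction R) auto

lemma ins_mem: "x \<in> set (fst (ins R x))"
  by (induction R) auto

lemma ins_snd: "snd (ins R x) = [] \<or> (\<exists>y. snd (ins R x) = [y] \<and> x < y \<and> (y \<in> set R \<or> y = Suc x \<and> x \<in> set R))"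
  by (induction R) auto

lemma ins_cases:
  obtains (app) R' where "ins R x = (R', [])"
  | (bump) R' y where "ins R x = (R', [y])" "x < y" "y \<in> set R \<or> y = Suc x \<and> x \<in> set R"
  using ins_snd[of R x] by (cases "ins R x") auto

lemma ins_app: "snd (ins R x) = [] \<longleftrightarrow> (\<forall>r\<in>set R. r < x)"
  by (induction R) auto

lemma ins_app_eq: "\<forall>r\<in>set R. r < x \<Longrightarrow> ins R x = (R @ [x], [])"
  by (induction R) auto

lemma ins_srt: "srt R \<Longrightarrow> srt (fst (ins R x))"
proof (induction R)
  case (Cons r R)
  have "\<forall>z\<in>set (fst (ins R x)). r < z" if "r < x" using Cons.prems that ins_fst_set[of R x] by fastforce
  with Cons show ?case by auto
qed simp

lemma insw_append: "insw R (u @ v) = (case insw R u of (R1, o1) \<Rightarrow> apsnd ((@) o1) (insw R1 v))"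
  by (induction u arbitrary: R) (auto split: prod.splits simp: apsnd_def map_prod_def)

text \<open>Inductions on a row use this to strip an initial entry that none of the inserted letters
  can affect.\<close>

lemma insw_Cons_gt: "\<forall>x\<in>set w. r < x \<Longrightarrow> insw (r # R) w = apfst (Cons r) (insw R w)"
  by (induction w arbitrary: R) (auto split: prod.splits simp: apfst_def apsnd_def map_prod_def)

lemma insw_srt: "srt R \<Longrightarrow> srt (fst (insw R w))"
proof (induction w arbitrary: R)
  case (Cons x w)
  then show ?case using ins_srt[of R x] by (auto split: prod.splits)
qed simp

lemma tinsw_Cons_row: "tinsw (R # Rs) w = (case insw R w of (R', w') \<Rightarrow> R' # tinsw Rs w')"
proof (induction w arbitrary: R Rs)
  case (Cons x w)
  show ?case
    by (cases R x rule: ins_cases) (auto simp: Cons split: prod.splits)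
qed simp

text \<open>A letter already present in a reduced row is followed there by its successor.\<close>

lemma red_special:
  assumes "red (r # R @ r # v)" "srt (r # R)"
  obtains R' where "R = Suc r # R'"
proof -
  have "\<exists>R'. R = Suc r # R'" if "red (r # R @ r # v)" "\<forall>x\<in>set R. r < x" "srt R" for R
  proof (rule ccontr)
    assume n: "\<not> (\<exists>R'. R = Suc r # R')"
    then have gt: "\<forall>x\<in>set R. Suc r < x"
      using that(2,3) by (cases R) (fastforce simp: Suc_le_eq le_less)+
    \<comment> \<open>Without \<open>Suc r\<close> at its head, \<open>R\<close> commutes with
      \<open>r\<close>, so the second \<open>r\<close> could be moved next to the first.\<close>
    have "word_perm (R @ [r]) = word_perm (r # R)"
      using gt
    proof (induction R)
      case (Cons x R)
      have "word_perm (R @ [r]) = word_perm (r # R)" by (rule Cons.IH) (use Cons.prems in auto)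
      then have "word_perm ((x # R) @ [r]) = transpose x (Suc x) \<circ> word_perm (r # R)"
        by (simp only: append_Cons word_perm_Cons)
      also have "\<dots> = (transpose x (Suc x) \<circ> transpose r (Suc r)) \<circ> word_perm R" by (simp add: comp_assoc)
      also have "transpose x (Suc x) \<circ> transpose r (Suc r) = transpose r (Suc r) \<circ> transpose x (Suc x)"
        by (rule transpose_comm[symmetric]) (use Cons.prems in simp)
      finally show ?case by (simp add: comp_assoc)
    qed simp
    then have "word_perm ([r] @ (R @ [r]) @ v) = word_perm ([r] @ (r # R) @ v)"
      unfolding word_perm_append by simp
    then have "word_perm (r # R @ r # v) = word_perm (r # r # R @ v)" by simp
    then show False using that(1) not_red_square[of r "R @ v"] red_peq[of "r # R @ r # v" "r # r # R @ v"] by simp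
  qed
  then show ?thesis using assms that by fastforce
qed

lemma red_insert_mem:
  assumes "red (R @ x # v)" "srt R" "x \<in> set R"
  shows "Suc x \<in> set R"
proof -
  obtain A B where R: "R = A @ x # B" using assms(3) split_list by metis
  then have "red (x # B @ x # v)" using assms(1) red_appendD2[of A] by simp
  moreover have "srt (x # B)" using R assms(2) by (simp add: sorted_wrt_append)
  ultimately obtain B' where "B = Suc x # B'" by (rule red_special)
  then show ?thesis using R by simp
qed

text \<open>The letter \<open>x\<close> passes the letters of \<open>R\<close> one by one through
  \<open>k1\<close>. The middle value is always the letter standing before it: first
  \<open>b\<close>, then the letter just passed.\<close>

lemma ck_move: "\<forall>r\<in>set R. r > x \<and> r > b \<Longrightarrow> srt R \<Longrightarrow> x < b \<Longrightarrow> ckeq (b # x # R) (b # R @ [x])"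
proof (induction R arbitrary: b)
  case (Cons r R)
  have "ckeq (b # x # r # R) (b # r # x # R)" using Cons.prems by (intro ck1) auto
  also have "ckeq \<dots> (b # r # R @ [x])" using Cons by (intro ck_Cons[of "r # x # R"]) auto
  finally show ?case by simp
qed simp

text \<open>The inserted letter travels left by \<open>k1\<close> up to the entry it replaces, the
  replaced letter then leaves the row by \<open>k2\<close>, and the exceptional rule is the braid
  relation.\<close>

lemma ins_ckeq:
  "srt R \<Longrightarrow> red (R @ [x]) \<Longrightarrow> ckeq (R @ [x]) (snd (ins R x) @ fst (ins R x))"
proof (induction R)
  case (Cons r R)
  consider "x < r" | "x = r" | "x > r" by linarith
  then show ?case
  proof cases
    case 1
    then have "ckeq (r # x # R) (r # R @ [x])" using Cons by (intro ck_move) auto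
    then show ?thesis using 1 by (auto intro: ck_sym)
  next
    case 2
    then obtain R' where R': "R = Suc r # R'" using Cons red_special[of r R "[]"] by auto
    have "ckeq (r # (Suc r # R' @ [r])) (r # (Suc r # r # R'))"
      using Cons.prems R' ck_move[of R' r "Suc r"] by (intro ck_Cons[of "Suc r # R' @ [r]"]) (auto intro: ck_sym)
    also have "ckeq \<dots> (Suc r # r # Suc r # R')" by (rule ck3)
    finally show ?thesis using 2 R' by simp
  next
    case 3
    have IH: "ckeq (R @ [x]) (snd (ins R x) @ fst (ins R x))"
      using Cons red_ConsD[of r "R @ [x]"] by simp
    show ?thesis
    proof (cases R x rule: ins_cases)
      case (app R') then show ?thesis using IH 3 by (auto intro: ck_Cons)
    next
      case (bump R' y)
      have "set R' \<subseteq> insert x (set R)" "x \<in> set R'" "srt R'"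
        using ins_fst_set[of R x] ins_mem[of x R] ins_srt[of R x] Cons.prems bump by auto
      \<comment> \<open>The head \<open>h\<close> of the new rest of the row satisfies
        \<open>r < h < y\<close>: it is the middle value that lets \<open>y\<close> pass
        \<open>r\<close> by \<open>k2\<close>.\<close>
      then obtain h H where R': "R' = h # H" "r < h" "h \<le> x"
        using 3 Cons.prems by (cases R') auto
      have "ckeq (r # y # h # H) (y # r # h # H)" using R' bump(2) by (intro ck2) auto
      then show ?thesis using IH 3 bump R' ck_trans ck_Cons by fastforce
    qed
  qed
qed simp

lemma ins_red: "srt R \<Longrightarrow> red (u @ R @ [x] @ v) \<Longrightarrow> red (u @ snd (ins R x) @ fst (ins R x) @ v)"
  using ck_red ck_ctx[OF ins_ckeq, of R x u v] red_middle[of u "R @ [x]" v] by auto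

lemma insw_ckeq: "srt R \<Longrightarrow> red (R @ w) \<Longrightarrow> ckeq (R @ w) (snd (insw R w) @ fst (insw R w))"
proof (induction w arbitrary: R)
  case (Cons x w)
  obtain R1 o1 where i: "ins R x = (R1, o1)" by (cases "ins R x")
  have r: "red (R @ [x])" using Cons.prems red_appendD1[of "R @ [x]" w] by simp
  have 1: "ckeq (R @ x # w) (o1 @ R1 @ w)"
    using ck_ctx[OF ins_ckeq[OF _ r], of "[]" w] Cons.prems i by simp
  then have "red (R1 @ w)" using Cons.prems ck_red red_appendD2 by blast
  then have "ckeq (R1 @ w) (snd (insw R1 w) @ fst (insw R1 w))"
    using Cons.IH[of R1] ins_srt[OF Cons.prems(1), of x] i by simp
  then have "ckeq (o1 @ R1 @ w) (o1 @ snd (insw R1 w) @ fst (insw R1 w))"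
    using ck_app by blast
  with 1 show ?case using i ck_trans by (auto split: prod.splits)
qed simp

section \<open>Coxeter-Knuth moves pass through a row\<close>

lemma ins_bump:
  "srt R \<Longrightarrow> ins R x = (R', [y]) \<Longrightarrow>
    x \<in> set R \<and> y = Suc x \<and> R' = R \<or>
    x \<notin> set R \<and> y \<in> set R \<and> x < y \<and> (\<forall>r\<in>set R. x < r \<longrightarrow> y \<le> r) \<and> set R' = insert x (set R - {y})"
proof (induction R arbitrary: R')
  case (Cons r R)
  consider "x < r" | "x = r" | "x > r" by linarith
  then show ?case
  proof cases
    case 1 then show ?thesis using Cons.prems by fastforce
  next
    case 2 then show ?thesis using Cons.prems by auto
  next
    case 3
    then obtain R1 where R1: "ins R x = (R1, [y])" "R' = r # R1"
      using Cons.prems(2) by (cases "ins R x") auto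
    have "r < y" using R1 3 ins_snd[of R x] by auto
    then show ?thesis using Cons.IH[OF _ R1(1)] Cons.prems(1) R1(2) 3 by auto
  qed
qed simp

text \<open>Row bumping lemma: the path of a larger letter inserted later runs strictly to the
  right. Its counterpart \<open>insw_two_gt\<close> says that a smaller letter inserted later always
  bumps, and bumps something smaller than its predecessor did.\<close>

lemma insw_two_lt:
  assumes "srt R" "b < c" "ins R b = (R1, ob)" "ins R1 c = (R2, oc)"
  shows "ob = [] \<and> oc = [] \<or> oc = [] \<or> (\<exists>p q. ob = [p] \<and> oc = [q] \<and> b < p \<and> p < q)"
proof (cases R b rule: ins_cases)
  case (app R')
  then have "R1 = R @ [b]" "\<forall>r\<in>set R. r < b" using assms ins_app[of R b] ins_app_eq[of R b] by auto
  then have "oc = []" using ins_app[of R1 c] assms by force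
  then show ?thesis by simp
next
  case (bump R' p)
  show ?thesis
  proof (cases R1 c rule: ins_cases)
    case app then show ?thesis using assms by simp
  next
    case b2: (bump R'' q)
    have "p < q" using ins_bump[OF assms(1), of b R1 p] bump b2 assms by auto (metis Suc_lessI le_neq_implies_less less_trans)+
    then show ?thesis using bump b2 assms by auto
  qed
qed

lemma insw_two_gt:
  assumes "srt R" "b < c" "ins R c = (R1, oc)" "ins R1 b = (R2, ob)"
  shows "\<exists>p. ob = [p] \<and> b < p \<and> p \<le> c \<and> (\<forall>q\<in>set oc. c < q)"
proof -
  have c: "c \<in> set R1" "srt R1" using ins_mem[of c R] ins_srt[of R c] assms by auto
  then have "ob \<noteq> []" using ins_app[of R1 b] assms(2,4) by force
  then obtain p where p: "ob = [p]" "b < p" using ins_snd[of R1 b] assms(4) by auto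
  then have "p \<le> c" using ins_bump[OF c(2), of b R2 p] assms(2,4) c by auto
  then show ?thesis using p ins_snd[of R c] assms(3) by auto
qed

text \<open>Entries below \<open>a\<close> affect none of the three letters, so the first entry
  \<open>r\<close> with \<open>a \<le> r\<close> decides. That the outputs coincide or are again one
  move apart lets the move climb from row to row.\<close>

lemma row_k1:
  assumes "a < b" "b < c" "srt R"
  shows "fst (insw R [b, a, c]) = fst (insw R [b, c, a]) \<and>
    (snd (insw R [b, a, c]) = snd (insw R [b, c, a]) \<or>
     kb (snd (insw R [b, a, c])) (snd (insw R [b, c, a])))"
  using assms(3)
proof (induction R)
  case Nil then show ?case using assms by simp
next
  case (Cons r R)
  have R: "srt R" "\<forall>x\<in>set R. r < x" using Cons.prems by auto
  obtain R1 ob where b: "ins R b = (R1, ob)" by fastforce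
  obtain R2 oc where c: "ins R1 c = (R2, oc)" by fastforce
  obtain R3 oc' where c': "ins R c = (R3, oc')" by fastforce
  note two = insw_two_lt[OF R(1) assms(2) b c]
  consider "r < a" | "a = r" | "a < r" "b < r" | "a < r" "b = r" | "a < r" "r < b" by linarith
  then show ?case
  proof cases
    case 1
    then have "insw (r # R) [b, a, c] = apfst (Cons r) (insw R [b, a, c])"
      "insw (r # R) [b, c, a] = apfst (Cons r) (insw R [b, c, a])"
      using assms by (intro insw_Cons_gt; auto)+
    then show ?thesis using Cons R by simp
  next
    case 2
    have "kb [p, Suc r, q] [p, q, Suc r]" if "b < p" "p < q" for p q using 2 assms that by (intro k1) auto
    then show ?thesis using 2 assms b c two by auto
  next
    case 3
    have "oc' = [] \<or> (\<exists>q. oc' = [q] \<and> r < q)" using ins_snd[of R c] c' R(2) assms by auto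
    moreover have "kb [r, b, q] [r, q, b]" if "r < q" for q using 3 that by (intro k1) auto
    ultimately show ?thesis using 3 assms c' by auto
  next
    case 4
    have "oc' = [] \<or> (\<exists>q. oc' = [q] \<and> c < q)" using ins_snd[of R c] c' by auto
    moreover have "kb [Suc r, r, q] [Suc r, q, r]" if "c < q" for q using 4 assms that by (intro k1) auto
    ultimately show ?thesis using 4 assms c' by auto
  next
    case 5
    have "kb [p, r, q] [p, q, r]" if "b < p" "p < q" for p q using 5 assms that by (intro k1) auto
    then show ?thesis using 5 assms b c two by auto
  qed
qed

text \<open>Here the kind of the move can change on its way through the row: if \<open>c < r\<close>
  it may leave as \<open>k1\<close>, and if \<open>c = r\<close> as \<open>k3\<close>. In the latter
  case reducedness supplies the entry \<open>Suc r\<close>.\<close>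

lemma row_k2:
  assumes "a < b" "b < c" "srt R" "red (R @ [a, c, b])"
  shows "fst (insw R [a, c, b]) = fst (insw R [c, a, b]) \<and>
    (snd (insw R [a, c, b]) = snd (insw R [c, a, b]) \<or>
     kb (snd (insw R [a, c, b])) (snd (insw R [c, a, b])) \<or>
     kb (snd (insw R [c, a, b])) (snd (insw R [a, c, b])))"
  using assms(3,4)
proof (induction R)
  case Nil then show ?case using assms by simp
next
  case (Cons r R)
  have R: "srt R" "\<forall>x\<in>set R. r < x" using Cons.prems by auto
  obtain R1 oc where c: "ins R c = (R1, oc)" by fastforce
  obtain R2 ob where b: "ins R1 b = (R2, ob)" by fastforce
  note two = insw_two_gt[OF R(1) assms(2) c b]
  have oc: "oc = [] \<or> (\<exists>q. oc = [q] \<and> c < q)" using ins_snd[of R c] c by auto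
  consider "r < a" | "a = r" | "a < r" "c < r" | "a < r" "c = r" | "a < r" "r < c" by linarith
  then show ?case
  proof cases
    case 1
    then have "insw (r # R) [a, c, b] = apfst (Cons r) (insw R [a, c, b])"
      "insw (r # R) [c, a, b] = apfst (Cons r) (insw R [c, a, b])"
      using assms by (intro insw_Cons_gt; auto)+
    then show ?thesis using Cons R by (auto dest: red_ConsD)
  next
    case 2
    have "kb [Suc r, q, p] [q, Suc r, p]" if "b < p" "p \<le> c" "c < q" for p q using 2 assms that by (intro k2) auto
    then show ?thesis using 2 assms b c two oc by auto
  next
    case 3
    show ?thesis
    proof (cases R)
      case Nil then show ?thesis using 3 assms by simp
    next
      case (Cons h H)
      have "kb [r, c, h] [r, h, c]" using 3 R Cons by (intro k1) auto
      then show ?thesis using 3 assms R Cons by auto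
    qed
  next
    case 4
    have "red ((r # R) @ [c, a, b])"
      using Cons.prems(2) ck_red[OF ck_ctx[OF ck2[OF assms(1,2), of "[]"], of "r # R" "[]"]] by simp
    then obtain H where H: "R = Suc r # H" using red_special[of r R "[a, b]"] Cons.prems 4 by auto
    show ?thesis using 4 assms H k3[of r] by simp
  next
    case 5
    have "set R1 \<subseteq> insert c (set R)" using ins_fst_set[of R c] c by simp
    then have "\<exists>p. ob = [p] \<and> r < p \<and> p \<le> c \<and> (\<forall>q\<in>set oc. c < q)"
      using two ins_snd[of R1 b] b R(2) 5 by fastforce
    moreover have "kb [r, q, p] [q, r, p]" if "r < p" "p \<le> c" "c < q" for p q using that by (intro k2) auto
    ultimately show ?thesis using 5 assms b c oc by auto
  qed
qed

lemma row_k3: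
  assumes "srt R" "red (R @ [a, Suc a, a])"
  shows "fst (insw R [a, Suc a, a]) = fst (insw R [Suc a, a, Suc a]) \<and>
    (snd (insw R [a, Suc a, a]) = snd (insw R [Suc a, a, Suc a]) \<or>
     kb (snd (insw R [a, Suc a, a])) (snd (insw R [Suc a, a, Suc a])) \<or>
     kb (snd (insw R [Suc a, a, Suc a])) (snd (insw R [a, Suc a, a])))"
  using assms
proof (induction R)
  case Nil then show ?case by simp
next
  case (Cons r R)
  have R: "srt R" "\<forall>x\<in>set R. r < x" using Cons.prems by auto
  have r2: "red ((r # R) @ [Suc a, a, Suc a])"
    using Cons.prems(2) ck_red[OF ck_ctx[OF ck3[of a "[]"], of "r # R" "[]"]] by simp
  consider "r < a" | "a = r" | "Suc a < r" | "Suc a = r" by linarith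
  then show ?case
  proof cases
    case 1
    then have "insw (r # R) [a, Suc a, a] = apfst (Cons r) (insw R [a, Suc a, a])"
      "insw (r # R) [Suc a, a, Suc a] = apfst (Cons r) (insw R [Suc a, a, Suc a])"
      by (intro insw_Cons_gt; auto)+
    then show ?thesis using Cons R by (auto dest: red_ConsD)
  next
    case 2
    then obtain H where H: "R = Suc r # H" using red_special[of r R "[Suc a, a]"] Cons.prems by auto
    show ?thesis using 2 H k3[of "Suc r"] by simp
  next
    case 3
    show ?thesis
    proof (cases R)
      case Nil then show ?thesis using 3 by simp
    next
      case (Cons h H)
      have "kb [r, Suc a, h] [r, h, Suc a]" "Suc a < h" using 3 R Cons by (auto intro: k1)
      moreover from this have "kb [r, Suc a, h] [r, h, Suc a]" by simp
      ultimately show ?thesis using 3 R Cons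
        by auto
    qed
  next
    case 4
    then obtain H where H: "R = Suc r # H" using red_special[of r R "[a, Suc a]"] r2 Cons.prems by auto
    show ?thesis using 4 H k3[of r] by auto
  qed
qed

lemma row_kb:
  assumes "kb t t'" "srt R" "red (R @ t)"
  shows "fst (insw R t) = fst (insw R t') \<and>
    (snd (insw R t) = snd (insw R t') \<or> kb (snd (insw R t)) (snd (insw R t')) \<or> kb (snd (insw R t')) (snd (insw R t)))"
  using assms(1)
proof cases
  case (k1 a b c) then show ?thesis using row_k1[OF k1(3,4) assms(2)] by blast
next
  case (k2 a b c) then show ?thesis using row_k2[OF k2(3,4) assms(2)] assms(3) by blast
next
  case (k3 a) then show ?thesis using row_k3[OF assms(2)] assms(3) by blast
qed

definition rows_ok :: "nat list list \<Rightarrow> bool" where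
  "rows_ok T \<longleftrightarrow> (\<forall>R\<in>set T. srt R)"

lemma rows_ok_simps [simp]: "rows_ok []" "rows_ok (R # T) \<longleftrightarrow> srt R \<and> rows_ok T"
  "rows_ok (T @ T') \<longleftrightarrow> rows_ok T \<and> rows_ok T'"
  by (auto simp: rows_ok_def)

abbreviation rrw where "rrw \<equiv> row_reading_word"

lemma rrw_simps [simp]: "rrw [] = []" "rrw (R # T) = rrw T @ R" "rrw (T @ T') = rrw T' @ rrw T"
  by (simp_all add: row_reading_word_def)

text \<open>The bottom row ends up the same for both words and hands on words that are equal or one
  move apart, so the induction is on the rows; reducedness is handed on by
  \<open>insw_ckeq\<close>.\<close>

lemma tinsw_kb:
  assumes "kb t t'" "rows_ok T" "red (rrw T @ t)"
  shows "tinsw T t = tinsw T t'"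
  using assms
proof (induction T arbitrary: t t')
  case Nil
  then show ?case by (cases rule: kb.cases) auto
next
  case (Cons R T)
  obtain R1 w1 where 1: "insw R t = (R1, w1)" by fastforce
  obtain R2 w2 where 2: "insw R t' = (R2, w2)" by fastforce
  have red: "red (rrw T @ R @ t)" "red (rrw T @ R @ t')"
    using Cons.prems ck_red[OF ck_base[OF Cons.prems(1), of "rrw T @ R" "[]"]] by auto
  have "red (rrw T @ snd (insw R s))" if "red (rrw T @ R @ s)" for s
  proof -
    have "ckeq (rrw T @ R @ s) (rrw T @ snd (insw R s) @ fst (insw R s))"
      using that Cons.prems red_appendD2 by (intro ck_app ck_refl insw_ckeq) auto
    then show ?thesis using that ck_red red_appendD1[of "rrw T @ snd (insw R s)" "fst (insw R s)"] by simp
  qed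
  then have "red (rrw T @ w1)" "red (rrw T @ w2)" using red 1 2 by fastforce+
  moreover have "R1 = R2 \<and> (w1 = w2 \<or> kb w1 w2 \<or> kb w2 w1)"
    using row_kb[OF Cons.prems(1), of R] Cons.prems red_appendD2[OF red(1)] 1 2 by simp
  ultimately have "R1 = R2 \<and> tinsw T w1 = tinsw T w2"
    using Cons.IH Cons.prems(2) by (metis rows_ok_simps(2))
  then show ?case using 1 2 by (simp add: tinsw_Cons_row)
qed

lemma tins_ok: "rows_ok T \<Longrightarrow> rows_ok (tins T x)"
proof (induction T arbitrary: x)
  case (Cons R T)
  then show ?case using ins_srt[of R x] by (auto split: prod.splits list.splits)
qed simp

lemma tinsw_ok: "rows_ok T \<Longrightarrow> rows_ok (tinsw T w)"
  by (induction w arbitrary: T) (auto simp: tins_ok)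

lemma tins_ckeq:
  "rows_ok T \<Longrightarrow> red (rrw T @ [x]) \<Longrightarrow> ckeq (rrw T @ [x]) (rrw (tins T x))"
proof (induction T arbitrary: x)
  case (Cons R T)
  have r: "red (R @ [x])" using Cons.prems red_appendD2 by auto
  have 1: "ckeq (rrw T @ R @ [x]) (rrw T @ snd (ins R x) @ fst (ins R x))"
    using ck_app[OF ck_refl ins_ckeq[OF _ r]] Cons.prems by simp
  show ?case
  proof (cases R x rule: ins_cases)
    case (app R') then show ?thesis using 1 by simp
  next
    case (bump R' y)
    then have "red ((rrw T @ [y]) @ R')" using 1 Cons.prems ck_red by fastforce
    then have "ckeq ((rrw T @ [y]) @ R') (rrw (tins T y) @ R')"
      using Cons.IH[of y] Cons.prems red_appendD1 by (intro ck_app) auto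
    then show ?thesis using 1 bump ck_trans by fastforce
  qed
qed simp

lemma tinsw_ckeq:
  "rows_ok T \<Longrightarrow> red (rrw T @ w) \<Longrightarrow> ckeq (rrw T @ w) (rrw (tinsw T w))"
proof (induction w arbitrary: T)
  case (Cons x w)
  have "ckeq ((rrw T @ [x]) @ w) (rrw (tins T x) @ w)"
    using Cons.prems tins_ckeq[of T x] red_appendD1[of "rrw T @ [x]" w] by (intro ck_app) auto
  then show ?case using Cons.IH[of "tins T x"] Cons.prems tins_ok ck_red ck_trans by simp
qed simp

lemma tinsw_ckeq_eq:
  "ckeq t t' \<Longrightarrow> rows_ok T \<Longrightarrow> red (rrw T @ t) \<Longrightarrow> tinsw T t = tinsw T t'"
proof (induction arbitrary: T rule: ckeq.induct)
  case (ck_base t t' u v)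
  have "red ((rrw T @ u) @ t)" using ck_base red_appendD1[of "rrw T @ u @ t" v] by simp
  then have "red (rrw (tinsw T u) @ t)"
    using ck_base.prems tinsw_ckeq[of T u] red_appendD1 ck_red[OF ck_app[OF _ ck_refl]] by blast
  then show ?case using tinsw_kb ck_base tinsw_ok by simp
next
  case (ck_sym t t') then show ?case using ck_red ck_app ckeq.ck_refl by metis
next
  case (ck_trans t t' t'') then show ?case using ck_red ck_app ckeq.ck_refl by metis
qed simp

definition eg :: "nat list \<Rightarrow> nat list list" where "eg w = tinsw [] w"

lemma eg_ckeq_eq: "ckeq t t' \<Longrightarrow> red t \<Longrightarrow> eg t = eg t'"
  unfolding eg_def by (rule tinsw_ckeq_eq) auto

lemma eg_ckeq: "red w \<Longrightarrow> ckeq w (rrw (eg w))"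
  unfolding eg_def using tinsw_ckeq[of "[]" w] by simp

lemma eg_append: "eg (u @ v) = tinsw (eg u) v" by (simp add: eg_def)

lemma eg_ok: "rows_ok (eg w)" unfolding eg_def by (rule tinsw_ok) simp

section \<open>Increasing tableaux\<close>

fun below :: "nat list \<Rightarrow> nat list \<Rightarrow> bool" where
  "below R [] = True"
| "below [] (s # S) = False"
| "below (r # R) (s # S) \<longleftrightarrow> r < s \<and> below R S"

lemma below_nth: "below R S \<longleftrightarrow> length S \<le> length R \<and> (\<forall>j<length S. R ! j < S ! j)"
  by (induction R S rule: below.induct) (auto simp: less_Suc_eq_0_disj)

fun tab :: "nat list list \<Rightarrow> bool" where
  "tab [] = True"
| "tab (R # P) \<longleftrightarrow> R \<noteq> [] \<and> srt R \<and> (P \<noteq> [] \<longrightarrow> below R (hd P)) \<and> tab P"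

lemma increasing_tableau_tab: "increasing_tableau P \<longleftrightarrow> tab P"
proof (induction P)
  case (Cons R P)
  have "increasing_tableau (R # P) \<longleftrightarrow> R \<noteq> [] \<and> srt R \<and> (P \<noteq> [] \<longrightarrow> below R (hd P)) \<and> increasing_tableau P"
    unfolding increasing_tableau_def below_nth
    by (cases P) (auto simp: All_less_Suc2 nth_Cons' less_Suc_eq_0_disj)
  then show ?case using Cons by simp
qed (simp add: increasing_tableau_def)

lemma tab_ok: "tab P \<Longrightarrow> rows_ok P" by (induction P) auto

lemma tab_nonempty: "tab P \<Longrightarrow> R \<in> set P \<Longrightarrow> R \<noteq> []" by (induction P) auto

lemma ins_below: "below R S \<Longrightarrow> below (fst (ins R x)) S"
proof (induction R S rule: below.induct)
  case (3 r R s S) then show ?case by auto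
qed auto

text \<open>In an ordinary bump, \<open>S\<close> has a larger entry or none above the place that
  \<open>y\<close> leaves, so \<open>y\<close> enters \<open>S\<close> weakly further left, above
  entries that are at most \<open>x\<close>.\<close>

lemma ins_below2:
  "below R S \<Longrightarrow> srt R \<Longrightarrow> ins R x = (R', [y]) \<Longrightarrow> below R' (fst (ins S y))"
proof (induction R arbitrary: S R')
  case (Cons r R)
  consider "x < r" | "x = r" | "x > r" by linarith
  then show ?case
  proof cases
    case 1 then show ?thesis using Cons.prems by (cases S) auto
  next
    case 2 then show ?thesis using Cons.prems by (cases S) auto
  next
    case 3
    then obtain R1 where R1: "ins R x = (R1, [y])" "R' = r # R1"
      using Cons.prems(3) by (cases "ins R x") auto
    have y: "x < y" using ins_snd[of R x] R1 by auto
    show ?thesis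
    proof (cases S)
      case Nil then show ?thesis using R1 3 y by simp
    next
      case S: (Cons s S')
      have "below R1 S'" using ins_below[of R S' x] R1 S Cons.prems by simp
      then show ?thesis using Cons.IH[of S' R1] Cons.prems S R1 3 y by (cases "ins S' y") auto
    qed
  qed
qed simp

lemma ins_nonempty: "fst (ins R x) \<noteq> []" using ins_mem[of x R] by auto

lemma hd_tins: "hd (tins P x) = fst (ins (if P = [] then [] else hd P) x)" "tins P x \<noteq> []"
  by (cases P; auto split: prod.splits list.splits)+

lemma tab_tins: "tab P \<Longrightarrow> tab (tins P x)"
proof (induction P arbitrary: x)
  case (Cons R P)
  have R': "srt (fst (ins R x))" "fst (ins R x) \<noteq> []" using Cons.prems ins_srt ins_nonempty by auto
  show ?case
  proof (cases R x rule: ins_cases)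
    case (app R')
    then show ?thesis using Cons.prems R' ins_below[of R "hd P" x] by auto
  next
    case (bump R' y)
    have "below R' (hd (tins P y))"
    proof (cases P)
      case Nil
      then show ?thesis using ins_below2[of R "[]" x R' y] Cons.prems bump by simp
    next
      case C: (Cons S P')
      then show ?thesis using ins_below2[of R S x R' y] Cons.prems bump hd_tins[of P y] by simp
    qed
    then show ?thesis using Cons bump R' by simp
  qed
qed simp

lemma tab_tinsw: "tab P \<Longrightarrow> tab (tinsw P w)"
  by (induction w arbitrary: P) (auto simp: tab_tins)

lemma tab_eg: "tab (eg w)" by (simp add: eg_def tab_tinsw)

lemma apsnd_append_Nil [simp]: "apsnd ((@) []) p = p" by (cases p) simp

text \<open>A row inserted into the row above it replaces that row and pushes it out whole. This is
  why inserting the reading word of a tableau rebuilds the tableau.\<close>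

lemma insw_under: "srt R \<Longrightarrow> below R S \<Longrightarrow> insw S R = (R, S)"
proof (induction R arbitrary: S)
  case Nil then show ?case by (cases S) auto
next
  case (Cons r R)
  show ?case
  proof (cases S)
    case Nil
    have "insw [] R = (R, [])" using Cons.IH[of "[]"] Cons.prems by simp
    then show ?thesis using Cons.prems Nil insw_Cons_gt[of R r "[]"] by simp
  next
    case S: (Cons s S')
    then have "insw S' R = (R, S')" using Cons by simp
    then show ?thesis using Cons.prems S insw_Cons_gt[of R r S'] by simp
  qed
qed

lemma tinsw_under: "tab (R # P) \<Longrightarrow> tinsw P R = R # P"
proof (induction P arbitrary: R)
  case Nil
  then obtain r R' where R: "R = r # R'" by (cases R) auto
  then have "insw [r] R' = (R, [])" using insw_under[of R "[]"] Nil by simp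
  then show ?case using R by (simp add: tinsw_Cons_row)
next
  case (Cons S P)
  then show ?case using insw_under[of R S] by (simp add: tinsw_Cons_row)
qed

lemma eg_rrw: "tab P \<Longrightarrow> eg (rrw P) = P"
  by (induction P) (simp_all add: eg_append tinsw_under, simp add: eg_def)

text \<open>The two versions of row insertion can differ only if \<open>x\<close> occurs in the row
  without its successor, which \<open>red_insert_mem\<close> excludes.\<close>

lemma eg_insert_row:
  assumes "srt R" "red (R @ [x])"
  shows "eg_insert (R # Rs) x = (case ins R x of (R', []) \<Rightarrow> R' # Rs | (R', y # _) \<Rightarrow> R' # eg_insert Rs y)"
proof (cases R x rule: ins_cases)
  case (app R')
  then show ?thesis using ins_app[of R x] ins_app_eq[of R x] by (auto simp: less_imp_le)
next
  case (bump R' y)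
  have *: "srt R \<Longrightarrow> ins R x = (R', [y]) \<Longrightarrow> x \<notin> set R \<Longrightarrow> R' = map (\<lambda>z. if z = y then x else z) R" for R R'
  proof (induction R arbitrary: R')
    case (Cons r R)
    consider "x < r" | "x > r" using Cons.prems by fastforce
    then show ?case
    proof cases
      case 1 then show ?thesis using Cons.prems by (auto intro!: map_idI[symmetric])
    next
      case 2
      then obtain R1 where R1: "ins R x = (R1, [y])" "R' = r # R1"
        using Cons.prems(2) by (cases "ins R x") auto
      have "r < y" using R1 2 ins_snd[of R x] by auto
      then show ?thesis using Cons R1 by auto
    qed
  qed simp
  have mem: "x \<in> set R \<Longrightarrow> Suc x \<in> set R" using red_insert_mem[of R x "[]"] assms by simp
  note b = ins_bump[OF assms(1) bump(1)]
  have "Min {z \<in> set R. x < z} = y"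
    using b mem bump(2) by (intro Min_eqI) auto
  moreover have "\<not> (\<forall>z\<in>set R. z \<le> x)" using b mem bump(2) by (meson less_imp_not_less not_le lessI)
  moreover have "(if y = x + 1 \<and> x \<in> set R then R else map (\<lambda>z. if z = y then x else z) R) = R'"
    using b *[OF assms(1) bump(1)] by auto
  ultimately show ?thesis using bump by (simp add: Let_def) blast
qed

lemma eg_insert_tins: "rows_ok P \<Longrightarrow> red (rrw P @ [x]) \<Longrightarrow> eg_insert P x = tins P x"
proof (induction P arbitrary: x)
  case (Cons R P)
  have r: "red (R @ [x])" using Cons.prems red_appendD2 by auto
  show ?case
  proof (cases R x rule: ins_cases)
    case (app R')
    then show ?thesis using eg_insert_row[OF _ r, of P] Cons.prems by simp
  next
    case (bump R' y)
    have "red (rrw P @ [y] @ R')" using ins_red[of R "rrw P" x "[]"] Cons.prems bump by simp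
    then have "red (rrw P @ [y])" using red_appendD1[of "rrw P @ [y]" R'] by simp
    then show ?thesis using eg_insert_row[OF _ r, of P] Cons bump by simp
  qed
qed simp

section \<open>Greedy matching of finite sets\<close>

definition cnt :: "nat set \<Rightarrow> nat \<Rightarrow> nat" where "cnt D x = card {d \<in> D. d < x}"

lemma cnt_0 [simp]: "cnt D 0 = 0" by (simp add: cnt_def)

lemma cnt_Suc: "cnt D (Suc x) = cnt D x + (if x \<in> D then 1 else 0)"
proof -
  have "{d \<in> D. d < Suc x} = {d \<in> D. d < x} \<union> (if x \<in> D then {x} else {})" by (auto simp: less_Suc_eq)
  then show ?thesis by (simp add: cnt_def)
qed

lemma cnt_between: "x \<le> y \<Longrightarrow> cnt D y = cnt D x + card {d \<in> D. x \<le> d \<and> d < y}"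
proof -
  assume "x \<le> y"
  then have "{d \<in> D. d < y} = {d \<in> D. d < x} \<union> {d \<in> D. x \<le> d \<and> d < y}" by auto
  then show ?thesis unfolding cnt_def by (simp add: card_Un_disjoint disjoint_iff)
qed

lemma cnt_mono: "x \<le> y \<Longrightarrow> cnt D x \<le> cnt D y" using cnt_between by simp

lemma cnt_insert: "z \<notin> D \<Longrightarrow> cnt (insert z D) x = cnt D x + (if z < x then 1 else 0)"
proof -
  assume "z \<notin> D"
  moreover have "{d \<in> insert z D. d < x} = (if z < x then insert z {d \<in> D. d < x} else {d \<in> D. d < x})" by auto
  ultimately show ?thesis by (simp add: cnt_def)
qed

lemma cnt_remove: "z \<in> D \<Longrightarrow> cnt D x = cnt (D - {z}) x + (if z < x then 1 else 0)"
  using cnt_insert[of z "D - {z}" x] by (simp add: insert_absorb)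

lemma cnt_subset_diff: "D \<subseteq> E \<Longrightarrow> x \<le> y \<Longrightarrow> cnt D y + cnt E x \<le> cnt E y + cnt D x"
  by (simp add: cnt_between[of x y]) (auto intro!: card_mono)

lemma cnt_eqI: "x \<le> y \<Longrightarrow> (\<And>d. d \<in> D \<Longrightarrow> x \<le> d \<Longrightarrow> d < y \<Longrightarrow> False) \<Longrightarrow> cnt D x = cnt D y"
  using cnt_between[of x y D] by (metis (mono_tags, lifting) Collect_empty_eq add.right_neutral card.empty)

text \<open>A position can be moved to the next opening bracket, because no element of
  \<open>F\<close> is counted in between.\<close>

lemma cnt_next:
  assumes "z \<in> F" "t \<le> z" obtains u where "u \<in> F" "t \<le> u" "u \<le> z" "cnt F u = cnt F t"
proof -
  define u where "u = (LEAST u. u \<in> F \<and> t \<le> u)"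
  have "u \<in> F \<and> t \<le> u" unfolding u_def by (rule LeastI[of _ z]) (use assms in auto)
  moreover have "u \<le> z" unfolding u_def by (rule Least_le) (use assms in auto)
  moreover have "cnt F t = cnt F u"
    by (rule cnt_eqI) (use calculation not_less_Least in \<open>auto simp: u_def\<close>)
  ultimately show ?thesis using that by auto
qed

text \<open>
  Reading the elements of \<open>f\<close> as opening and those of \<open>D\<close> as closing brackets, where at equal
  values the closing bracket comes first, \<open>mu f D\<close> consists of the matched elements of \<open>f\<close>.
\<close>

definition mt :: "nat set \<Rightarrow> nat set \<Rightarrow> nat \<Rightarrow> bool" where
  "mt f D v \<longleftrightarrow> (\<exists>w>v. cnt f w + cnt D (Suc v) < cnt D (Suc w) + cnt f (Suc v))"

definition mu :: "nat set \<Rightarrow> nat set \<Rightarrow> nat set" where "mu f D = {v \<in> f. mt f D v}"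

text \<open>The inequality avoids subtraction. It says that there is a surplus: more elements of
  \<open>D\<close> in \<open>(v, w]\<close> than elements of \<open>f\<close> in
  \<open>(v, w)\<close>, so the bracket opened at \<open>v\<close> is closed at \<open>w\<close> or
  earlier.\<close>

lemma mtI: "v < w \<Longrightarrow> cnt f w + cnt D (Suc v) < cnt D (Suc w) + cnt f (Suc v) \<Longrightarrow> mt f D v"
  by (auto simp: mt_def)

lemma mtE:
  assumes "mt f D v" obtains w where "v < w" "cnt f w + cnt D (Suc v) < cnt D (Suc w) + cnt f (Suc v)"
  using assms by (auto simp: mt_def)

lemma not_mtD: "\<not> mt f D v \<Longrightarrow> v < w \<Longrightarrow> cnt D (Suc w) + cnt f (Suc v) \<le> cnt f w + cnt D (Suc v)"
  by (meson mtI not_le)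

lemma mu_subset: "mu f D \<subseteq> f" by (auto simp: mu_def)

lemma mt_mono: "D \<subseteq> E \<Longrightarrow> mt f D v \<Longrightarrow> mt f E v"
proof -
  assume D: "D \<subseteq> E" and "mt f D v"
  then obtain w where w: "v < w" "cnt f w + cnt D (Suc v) < cnt D (Suc w) + cnt f (Suc v)" by (rule_tac mtE)
  then show ?thesis using cnt_subset_diff[OF D, of "Suc v" "Suc w"] by (intro mtI[of v w]) auto
qed

lemma mu_mono: "D \<subseteq> E \<Longrightarrow> mu f D \<subseteq> mu f E"
  using mt_mono by (auto simp: mu_def)

text \<open>A new bracket at \<open>z\<close> could only hurt some \<open>v < z\<close> whose
  surplus is found at \<open>w > z\<close>. As \<open>z\<close> is unmatched there is no surplus
  from \<open>z\<close> to \<open>w\<close>, so the surplus of \<open>v\<close> is already present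
  at \<open>z\<close> itself.\<close>

lemma mu_insert_unmatched:
  assumes "z \<notin> F" "\<not> mt F D z"
  shows "mu (insert z F) D = mu F D"
proof -
  note ci = cnt_insert[OF assms(1)]
  note nz = not_mtD[OF assms(2)]
  have z: "cnt F (Suc z) = cnt F z" using assms(1) by (simp add: cnt_Suc)
  have "\<not> mt (insert z F) D z"
  proof
    assume "mt (insert z F) D z"
    then obtain w where "z < w" "cnt (insert z F) w + cnt D (Suc z) < cnt D (Suc w) + cnt (insert z F) (Suc z)" by (rule mtE)
    then show False using nz[of w] by (simp add: ci)
  qed
  moreover have "mt (insert z F) D v \<longleftrightarrow> mt F D v" if "v \<noteq> z" for v
  proof
    assume "mt (insert z F) D v"
    then obtain w where "v < w" "cnt (insert z F) w + cnt D (Suc v) < cnt D (Suc w) + cnt (insert z F) (Suc v)" by (rule mtE)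
    then show "mt F D v" by (intro mtI[of v w]) (auto simp: ci split: if_splits)
  next
    assume "mt F D v"
    then obtain w where w: "v < w" "cnt F w + cnt D (Suc v) < cnt D (Suc w) + cnt F (Suc v)" by (rule mtE)
    show "mt (insert z F) D v"
    proof (cases "v < z \<and> z < w")
      case True
      then show ?thesis using w nz[of w] z by (intro mtI[of v z]) (auto simp: ci)
    next
      case False
      then show ?thesis using w that by (intro mtI[of v w]) (auto simp: ci)
    qed
  qed
  ultimately show ?thesis using assms(1) by (auto simp: mu_def; metis)
qed

lemma mu_remove_unmatched: "z \<in> F \<Longrightarrow> z \<notin> mu F D \<Longrightarrow> mu (F - {z}) D = mu F D"
proof -
  assume z: "z \<in> F" "z \<notin> mu F D"
  note ci = cnt_remove[OF z(1)]
  have "\<not> mt (F - {z}) D z"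
  proof
    assume "mt (F - {z}) D z"
    then obtain w where "z < w" "cnt (F - {z}) w + cnt D (Suc z) < cnt D (Suc w) + cnt (F - {z}) (Suc z)" by (rule mtE)
    then have "mt F D z" by (intro mtI[of z w]) (auto simp: ci)
    then show False using z by (simp add: mu_def)
  qed
  then show ?thesis using mu_insert_unmatched[of z "F - {z}" D] z by (simp add: insert_absorb)
qed

text \<open>Freeing the partner of a matched \<open>z\<close> rematches it with the next unmatched element below.\<close>

lemma mu_remove_matched:
  assumes z: "z \<in> mu F D" and w: "w \<in> F - mu F D" "w < z"
    and max: "\<And>v. v \<in> F - mu F D \<Longrightarrow> v < z \<Longrightarrow> v \<le> w"
  shows "mu (F - {z}) D = insert w (mu F D - {z})"
proof -
  have zF: "z \<in> F" using z by (simp add: mu_def)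
  note ci = cnt_remove[OF zF]
  \<comment> \<open>Descending from \<open>z\<close>: if the witness \<open>t\<close> of
    \<open>v\<close> does not lie beyond \<open>z\<close>, then the next element of \<open>F\<close>
    from \<open>t\<close> on has a witness beyond \<open>z\<close>, and the two surpluses add
    up.\<close>
  have A: "\<exists>t>z. cnt F t + cnt D (Suc v) < cnt D (Suc t) + cnt F (Suc v)" if "v \<in> F" "w < v" "v \<le> z" for v
    using that
  proof (induction "z - v" arbitrary: v rule: less_induct)
    case less
    have "v \<in> mu F D" using less.prems max[of v] z by (cases "v = z") force+
    then obtain t where t: "v < t" "cnt F t + cnt D (Suc v) < cnt D (Suc t) + cnt F (Suc v)"
      by (auto simp: mu_def elim: mtE)
    show ?case
    proof (cases "t > z")
      case False
      then obtain u where u: "u \<in> F" "t \<le> u" "u \<le> z" "cnt F u = cnt F t" using cnt_next[OF zF, of t] by auto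
      then obtain t2 where t2: "t2 > z" "cnt F t2 + cnt D (Suc u) < cnt D (Suc t2) + cnt F (Suc u)"
        using less.hyps[OF _ u(1)] less.prems t by (meson diff_less_mono2 less_le_trans order.strict_trans)
      then show ?thesis using t u cnt_Suc[of F u] cnt_mono[of "Suc t" "Suc u" D] by (intro exI[of _ t2]) auto
    qed (use t in blast)
  qed
  have eq: "v \<in> mu (F - {z}) D \<longleftrightarrow> v \<in> insert w (mu F D - {z})" if v: "v \<in> F" "v \<noteq> z" for v
  proof -
    consider "v > z" | "w < v" "v < z" | "v = w" | "v < w" using v by linarith
    then show ?thesis
    proof cases
      case 1
      then have "mt (F - {z}) D v \<longleftrightarrow> mt F D v"
        unfolding mt_def by (intro ex_cong1 conj_cong refl) (auto simp: ci)
      then show ?thesis using v 1 w by (auto simp: mu_def)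
    next
      case 2
      then have m: "v \<in> mu F D" using max[of v] v by force
      then obtain t where "v < t" "cnt F t + cnt D (Suc v) < cnt D (Suc t) + cnt F (Suc v)"
        by (auto simp: mu_def elim: mtE)
      then have "mt (F - {z}) D v" using 2 by (intro mtI[of v t]) (auto simp: ci split: if_splits)
      then show ?thesis using m v by (auto simp: mu_def)
    next
      case 3
      obtain u where u: "u \<in> F" "Suc w \<le> u" "u \<le> z" "cnt F u = cnt F (Suc w)"
        using cnt_next[OF zF, of "Suc w"] w by auto
      then obtain t where t: "t > z" "cnt F t + cnt D (Suc u) < cnt D (Suc t) + cnt F (Suc u)" using A[of u] by auto
      then have "mt (F - {z}) D w"
        using u w cnt_Suc[of F u] cnt_mono[of "Suc w" "Suc u" D] by (intro mtI[of w t]) (auto simp: ci)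
      then show ?thesis using 3 w v by (auto simp: mu_def)
    next
      case 4
      have "mt (F - {z}) D v \<longleftrightarrow> mt F D v"
      proof
        assume "mt (F - {z}) D v"
        then obtain t where t: "v < t" "cnt (F - {z}) t + cnt D (Suc v) < cnt D (Suc t) + cnt (F - {z}) (Suc v)" by (rule mtE)
        show "mt F D v"
        proof (cases "t > z")
          case True
          have "\<not> mt F D w" using w by (auto simp: mu_def)
          then have "cnt D (Suc t) + cnt F (Suc w) \<le> cnt F t + cnt D (Suc w)" using not_mtD[of F D w t] True w by auto
          then show ?thesis using t True 4 w cnt_Suc[of F w] by (intro mtI[of v w]) (auto simp: ci)
        next
          case False
          then show ?thesis using t 4 w by (intro mtI[of v t]) (auto simp: ci)
        qed
      next
        assume "mt F D v"
        then obtain t where "v < t" "cnt F t + cnt D (Suc v) < cnt D (Suc t) + cnt F (Suc v)" by (rule mtE)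
        then show "mt (F - {z}) D v" using 4 w by (intro mtI[of v t]) (auto simp: ci split: if_splits)
      qed
      then show ?thesis using v 4 by (auto simp: mu_def)
    qed
  qed
  show ?thesis
  proof (intro set_eqI iffI)
    fix v assume v: "v \<in> mu (F - {z}) D"
    then have "v \<in> F" "v \<noteq> z" by (auto simp: mu_def)
    then show "v \<in> insert w (mu F D - {z})" using eq v by blast
  next
    fix v assume v: "v \<in> insert w (mu F D - {z})"
    then have "v \<in> F" "v \<noteq> z" using w by (auto simp: mu_def)
    then show "v \<in> mu (F - {z}) D" using eq v by blast
  qed
qed

text \<open>By \<open>H\<close>, every bracket of \<open>e\<close> opened in \<open>[w, z)\<close>
  is closed before \<open>z\<close>. Hence \<open>z\<close> can only serve a bracket opened before
  \<open>w\<close>, and for such a bracket \<open>w\<close> does as well.\<close>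

lemma mu_exchange:
  assumes z: "z \<in> X" and w: "w \<notin> X" "w < z"
    and H: "\<And>u. u \<in> e \<Longrightarrow> w \<le> u \<Longrightarrow> u < z \<Longrightarrow> cnt e z + cnt X (Suc u) < cnt X z + cnt e (Suc u)"
  shows "mu e (insert w (X - {z})) = mu e X"
proof -
  let ?X = "insert w (X - {z})"
  have c: "cnt ?X x + (if z < x then 1 else 0) = cnt X x + (if w < x then 1 else 0)" for x
    using cnt_remove[OF z, of x] cnt_insert[of w "X - {z}" x] w by auto
  have "mt e ?X v \<longleftrightarrow> mt e X v" if "v \<in> e" for v
  proof -
    consider "v \<ge> z" | "w \<le> v" "v < z" | "v < w" using w by linarith
    then show ?thesis
    proof cases
      case 1
      have "cnt ?X (Suc x) = cnt X (Suc x)" if "v \<le> x" for x using c[of "Suc x"] that w 1 by simp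
      then show ?thesis by (simp add: mt_def cong: conj_cong)
    next
      case 2
      \<comment> \<open>\<open>H\<close> counts the closing brackets below \<open>z\<close>, that
        is, up to and including \<open>z - 1\<close>, which becomes the witness.\<close>
      have "v < z - 1" using H[OF that 2] 2 by (cases "z = Suc v") auto
      then have "mt e ?X v"
        using H[OF that 2] 2 c[of "Suc v"] c[of z] cnt_mono[of "z - 1" z e] w
        by (intro mtI[of v "z - 1"]) auto
      moreover have "mt e X v" if m: "mt e ?X v"
      proof -
        obtain t where "v < t" "cnt e t + cnt ?X (Suc v) < cnt ?X (Suc t) + cnt e (Suc v)" using m by (rule mtE)
        then show ?thesis using 2 c[of "Suc v"] c[of "Suc t"] by (intro mtI[of v t]) (auto split: if_splits)
      qed
      ultimately show ?thesis by blast
    next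
      case 3
      show ?thesis
      proof
        assume "mt e X v"
        then obtain t where "v < t" "cnt e t + cnt X (Suc v) < cnt X (Suc t) + cnt e (Suc v)" by (rule mtE)
        then show "mt e ?X v" using 3 w c[of "Suc v"] c[of "Suc t"] by (intro mtI[of v t]) (auto split: if_splits)
      next
        assume "mt e ?X v"
        then obtain t where t: "v < t" "cnt e t + cnt ?X (Suc v) < cnt ?X (Suc t) + cnt e (Suc v)" by (rule mtE)
        show "mt e X v"
        proof (cases "w \<le> t \<and> t < z")
          case False
          then show ?thesis using t 3 w c[of "Suc v"] c[of "Suc t"] by (intro mtI[of v t]) (auto split: if_splits)
        next
          case True
          have t': "cnt e t + cnt X (Suc v) \<le> cnt X (Suc t) + cnt e (Suc v)"
            using t True 3 w c[of "Suc v"] c[of "Suc t"] by auto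
          \<comment> \<open>The witness is moved from \<open>t\<close> to \<open>z\<close>: by
            \<open>H\<close> at the next element of \<open>e\<close> nothing is lost on the way, and
            \<open>z \<in> X\<close> makes up for the bracket \<open>w\<close> missing in
            \<open>X\<close>.\<close>
          have "cnt e z + cnt X (Suc t) \<le> cnt X z + cnt e t"
          proof (cases "\<exists>u\<in>e. t \<le> u \<and> u < z")
            case True
            then obtain u0 where "u0 \<in> e" "t \<le> u0" "u0 < z" by blast
            then obtain u where u: "u \<in> e" "t \<le> u" "u \<le> u0" "cnt e u = cnt e t" "u < z" using cnt_next[of u0 e t] by auto
            then show ?thesis using H[of u] \<open>w \<le> t \<and> t < z\<close> cnt_Suc[of e u] cnt_mono[of "Suc t" "Suc u" X] by auto
          next
            case False
            then have "cnt e t = cnt e z" using \<open>w \<le> t \<and> t < z\<close> by (intro cnt_eqI) auto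
            then show ?thesis using cnt_mono[of "Suc t" z X] \<open>w \<le> t \<and> t < z\<close> by auto
          qed
          then show ?thesis using t' 3 w z cnt_Suc[of X z] by (intro mtI[of v z]) auto
        qed
      qed
    qed
  qed
  then show ?thesis by (auto simp: mu_def)
qed

text \<open>A closing bracket in front of all others frees at most one opening bracket from being
  unmatched, the nearest unmatched one below \<open>d\<close>, although the pairs may be regrouped.
  Adding the closing brackets in decreasing order gives the two cardinality lemmas that
  follow.\<close>

lemma mu_insert_min:
  assumes d: "\<forall>x\<in>D. d < x"
  shows "(\<exists>w\<in>f - mu f D. w < d \<and> mu f (insert d D) = insert w (mu f D)) \<or>
    (\<forall>v\<in>f. v < d \<longrightarrow> v \<in> mu f D) \<and> mu f (insert d D) = mu f D"
proof -
  have dD: "d \<notin> D" using d by auto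
  note ci = cnt_insert[OF dD]
  have c0: "cnt D x = 0" if "x \<le> Suc d" for x
    using d that by (auto simp: cnt_def)
  have big: "mt f (insert d D) v \<longleftrightarrow> mt f D v" if "v \<ge> d" for v
    using that by (auto simp: mt_def ci)
  have mono: "mu f D \<subseteq> mu f (insert d D)" by (rule mu_mono) auto
  show ?thesis
  proof (cases "\<exists>v\<in>f - mu f D. v < d")
    case False
    then have "mu f (insert d D) = mu f D" using big mono by (auto simp: mu_def not_less)
    then show ?thesis using False by auto
  next
    case True
    define W where "W = {v \<in> f - mu f D. v < d}"
    define w where "w = Max W"
    have W: "finite W" "W \<noteq> {}" using True by (auto simp: W_def)
    have w: "w \<in> f" "w \<notin> mu f D" "w < d" using Max_in[OF W] by (auto simp: w_def W_def)
    have max: "v \<in> mu f D" if "v \<in> f" "w < v" "v < d" for v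
    proof (rule ccontr)
      assume "v \<notin> mu f D"
      then have "v \<in> W" using that by (simp add: W_def)
      then show False using Max_ge[OF W(1), of v] that by (simp add: w_def)
    qed
    have nw: "\<not> mt f D w" using w by (auto simp: mu_def)
    have "mt f (insert d D) w"
    proof (cases "\<exists>u\<in>f. w < u \<and> u < d")
      case True
      then obtain u0 where "u0 \<in> f" "Suc w \<le> u0" "u0 < d" by auto
      then obtain u where u: "u \<in> f" "Suc w \<le> u" "u \<le> u0" "cnt f u = cnt f (Suc w)" "u < d" using cnt_next[of u0 f "Suc w"] by auto
      then have "mt f D u" using max[of u] by (auto simp: mu_def)
      then obtain t where t: "u < t" "cnt f t + cnt D (Suc u) < cnt D (Suc t) + cnt f (Suc u)" by (rule mtE)
      have "d \<le> t"
      proof (rule ccontr)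
        assume "\<not> d \<le> t"
        then show False using t c0[of "Suc t"] cnt_mono[of "Suc u" t f] by auto
      qed
      then show ?thesis using t u c0[of "Suc u"] c0[of "Suc w"] cnt_Suc[of f u] by (intro mtI[of w t]) (auto simp: ci)
    next
      case False
      then have "cnt f (Suc w) = cnt f d" using w by (intro cnt_eqI) auto
      then show ?thesis using w c0[of "Suc w"] by (intro mtI[of w d]) (auto simp: ci)
    qed
    moreover have "mt f D v" if v: "v \<in> f" "v < w" "mt f (insert d D) v" for v
    proof -
      obtain t where t: "v < t" "cnt f t + cnt (insert d D) (Suc v) < cnt (insert d D) (Suc t) + cnt f (Suc v)"
        using v(3) by (rule mtE)
      show ?thesis
      proof (cases "d \<le> t")
        case False then show ?thesis using t v w by (intro mtI[of v t]) (auto simp: ci)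
      next
        case True
        then have "cnt D (Suc t) + cnt f (Suc w) \<le> cnt f t" using not_mtD[OF nw, of t] w c0[of "Suc w"] by simp
        then have "cnt f (Suc w) \<le> cnt f (Suc v)" using t True v w c0[of "Suc v"] by (auto simp: ci)
        then show ?thesis using w(1) v cnt_Suc[of f w] cnt_mono[of "Suc v" w f] by auto
      qed
    qed
    ultimately have "mu f (insert d D) = insert w (mu f D)"
      using w big mono max by (auto simp: mu_def) (metis linorder_neqE_nat not_less)
    then show ?thesis using w by auto
  qed
qed

lemma card_mu_le: "finite D \<Longrightarrow> finite (mu f D) \<and> card (mu f D) \<le> card D"
proof (induction rule: finite_linorder_min_induct)
  case empty
  have "\<not> mt f {} v" for v
  proof
    assume "mt f {} v"
    then obtain w where "v < w" "cnt f w < cnt f (Suc v)" by (auto simp: cnt_def[of "{}"] elim: mtE)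
    then show False using cnt_mono[of "Suc v" w f] by simp
  qed
  then have "mu f {} = {}" by (auto simp: mu_def)
  then show ?case by simp
next
  case (insert d D)
  then have "d \<notin> D" by auto
  then show ?case using mu_insert_min[of D d f] insert by (auto simp: card_insert_if)
qed

text \<open>The hypothesis is Hall's condition: the closing brackets up to \<open>x\<close> never
  outnumber the brackets opened before \<open>x\<close>, so each of them finds a partner.\<close>

lemma card_mu: "finite D \<Longrightarrow> (\<And>x. cnt D (Suc x) \<le> cnt f x) \<Longrightarrow> card (mu f D) = card D"
proof (induction rule: finite_linorder_min_induct)
  case empty
  then show ?case using card_mu_le[of "{}" f] by simp
next
  case (insert d D)
  have dD: "d \<notin> D" using insert by auto
  note ci = cnt_insert[OF dD]
  have hall: "cnt D (Suc x) + (if d < Suc x then 1 else 0) \<le> cnt f x" for x using insert.prems[of x] ci[of "Suc x"] by simp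
  have IH: "card (mu f D) = card D" using insert.IH hall by (meson le_add1 le_trans)
  have "\<exists>v\<in>f. v < d \<and> v \<notin> mu f D"
  proof (rule ccontr)
    assume n: "\<not> (\<exists>v\<in>f. v < d \<and> v \<notin> mu f D)"
    have c0: "cnt D x = 0" if "x \<le> Suc d" for x using insert.hyps that by (auto simp: cnt_def)
    have "cnt f d \<ge> 1" using hall[of d] by simp
    then obtain u0 where u0: "u0 \<in> f" "u0 < d" by (auto simp: cnt_def card_gt_0_iff Suc_le_eq)
    \<comment> \<open>\<open>u\<close> is the least element of \<open>f\<close>. If it were matched
      already without \<open>d\<close>, then its surplus at \<open>t\<close> together with
      \<open>d\<close> would violate Hall's condition at \<open>t\<close>.\<close>
    obtain u where u: "u \<in> f" "u \<le> u0" "cnt f u = cnt f 0" using cnt_next[OF u0(1), of 0] by auto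
    then have "mt f D u" using n u0 by (auto simp: mu_def)
    then obtain t where t: "u < t" "cnt f t + cnt D (Suc u) < cnt D (Suc t) + cnt f (Suc u)" by (rule mtE)
    have "cnt f (Suc u) = 1" using u by (simp add: cnt_Suc)
    moreover have "1 \<le> cnt f t" using cnt_mono[of "Suc u" t f] t calculation by simp
    moreover have "d < Suc t" using t c0[of "Suc t"] calculation by (cases "Suc t \<le> Suc d") auto
    ultimately show False using hall[of t] t by simp
  qed
  then show ?case using mu_insert_min[of D d f] insert IH dD card_mu_le[of D f] by (auto simp: card_insert_if)
qed

lemma cnt_gt: "v < x \<Longrightarrow> cnt {d \<in> D. v < d} x + cnt D (Suc v) = cnt D x"
proof -
  assume "v < x"
  then have "{d \<in> D. d < x} = {d \<in> {d \<in> D. v < d}. d < x} \<union> {d \<in> D. d < Suc v}" by auto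
  then show ?thesis unfolding cnt_def by (simp add: card_Un_disjoint disjoint_iff)
qed

lemma cnt_gt_0: "x \<le> Suc v \<Longrightarrow> cnt {d \<in> D. v < d} x = 0"
  by (auto simp: cnt_def)

text \<open>Opening brackets are served from right to left: \<open>v\<close> finds a partner exactly
  if the matched brackets above it leave a closing bracket over. If \<open>v\<close> is unmatched,
  Hall's condition holds above \<open>v\<close> and everything there is used up.\<close>

lemma mem_mu_iff:
  assumes "finite D" "v \<in> f"
  shows "v \<in> mu f D \<longleftrightarrow> card {u \<in> mu f D. v < u} < card {d \<in> D. v < d}"
proof -
  let ?f = "{u \<in> f. v < u}" and ?D = "{d \<in> D. v < d}"
  have mt: "mt ?f ?D u \<longleftrightarrow> mt f D u" if "v < u" for u
  proof -
    have "cnt ?f w + cnt ?D (Suc u) < cnt ?D (Suc w) + cnt ?f (Suc u) \<longleftrightarrow>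
      cnt f w + cnt D (Suc u) < cnt D (Suc w) + cnt f (Suc u)" if "u < w" for w
      using cnt_gt[of v w f] cnt_gt[of v "Suc u" f] cnt_gt[of v "Suc u" D] cnt_gt[of v "Suc w" D] that \<open>v < u\<close> by auto
    then show ?thesis unfolding mt_def by (intro ex_cong1 conj_cong refl)
  qed
  then have eq: "mu ?f ?D = {u \<in> mu f D. v < u}" by (auto simp: mu_def)
  have fD: "finite ?D" using assms by simp
  show ?thesis
  proof
    assume v: "v \<in> mu f D"
    let ?g = "insert v ?f"
    have ci: "cnt ?g x = cnt ?f x + (if v < x then 1 else 0)" for x by (rule cnt_insert) simp
    have "mt ?g ?D u \<longleftrightarrow> mt ?f ?D u" if "v < u" for u
      using that unfolding mt_def ci by (intro ex_cong1 conj_cong refl) auto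
    moreover have "mt ?g ?D v"
    proof -
      obtain w where w: "v < w" "cnt f w + cnt D (Suc v) < cnt D (Suc w) + cnt f (Suc v)" using v by (auto simp: mu_def elim: mtE)
      then show ?thesis using cnt_gt[of v w f] cnt_gt[of v "Suc w" D] cnt_gt_0[of "Suc v" v]
        by (intro mtI[of v w]) (auto simp: ci)
    qed
    ultimately have "mu ?g ?D = insert v (mu ?f ?D)" by (auto simp: mu_def)
    then have "card (insert v (mu ?f ?D)) \<le> card ?D" using card_mu_le[OF fD, of ?g] by simp
    moreover have "v \<notin> mu ?f ?D" by (auto simp: mu_def)
    ultimately show "card {u \<in> mu f D. v < u} < card ?D" using card_mu_le[OF fD, of ?f] eq by simp
  next
    assume c: "card {u \<in> mu f D. v < u} < card ?D"
    show "v \<in> mu f D"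
    proof (rule ccontr)
      assume "v \<notin> mu f D"
      then have n: "\<not> mt f D v" using assms by (simp add: mu_def)
      have "cnt ?D (Suc x) \<le> cnt ?f x" for x
      proof (cases "v < x")
        case True
        then show ?thesis using not_mtD[OF n True] cnt_gt[of v x f] cnt_gt[of v "Suc x" D] by auto
      next
        case False then show ?thesis using cnt_gt_0[of "Suc x" v D] by simp
      qed
      then show False using card_mu[OF fD, of ?f] eq c by simp
    qed
  qed
qed

text \<open>Carries the bound on the new element from the remaining columns to the whole tableau.
  Here \<open>z < z'\<close>, and up to \<open>z'\<close> the sets \<open>A\<close> and
  \<open>B\<close> agree. Some \<open>s < z\<close> matched with \<open>B\<close> would have its
  surplus at \<open>z\<close> at the latest, since \<open>z\<close> is unmatched there, and would
  then be matched with \<open>A\<close>.\<close>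

lemma mu_insert_below:
  assumes "A \<subseteq> B" "z' \<notin> B" "\<forall>s\<in>B - A. z' < s" "z \<notin> mu f B" "mu f (insert z' B) = insert z (mu f B)" "s \<in> mu f B - mu f A"
  shows "z < s"
proof (rule ccontr)
  assume "\<not> z < s"
  moreover have "s \<noteq> z" using assms by auto
  ultimately have sz: "s < z" by simp
  have zf: "z \<in> f" "mt f (insert z' B) z" "\<not> mt f B z" using assms(4,5) by (auto simp: mu_def)
  then obtain w where w: "z < w" "cnt f w + cnt (insert z' B) (Suc z) < cnt (insert z' B) (Suc w) + cnt f (Suc z)" by (auto elim: mtE)
  have "z < z'"
  proof (rule ccontr)
    assume "\<not> z < z'"
    then show False using w not_mtD[OF zf(3) w(1)] cnt_insert[OF assms(2)] by auto
  qed
  have AB: "cnt A x = cnt B x" if "x \<le> z'" for x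
  proof -
    have "{d \<in> A. d < x} = {d \<in> B. d < x}" using assms(1,3) that by (intro Collect_cong) (metis DiffI not_less_iff_gr_or_eq order_less_le_trans subsetD)
    then show ?thesis by (simp add: cnt_def)
  qed
  have s: "s \<in> f" "mt f B s" "\<not> mt f A s" using assms(6) by (auto simp: mu_def)
  then obtain t where t: "s < t" "cnt f t + cnt B (Suc s) < cnt B (Suc t) + cnt f (Suc s)" by (auto elim: mtE)
  show False
  proof (cases "z < t")
    case True
    have "cnt B (Suc t) + cnt f (Suc z) \<le> cnt f t + cnt B (Suc z)" by (rule not_mtD[OF zf(3) True])
    then have "cnt f z + cnt B (Suc s) < cnt B (Suc z) + cnt f (Suc s)" using t zf(1) cnt_Suc[of f z] by simp
    then show False using AB[of "Suc s"] AB[of "Suc z"] sz \<open>z < z'\<close> not_mtD[OF s(3) sz] by simp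
  next
    case False
    then show False using t AB[of "Suc s"] AB[of "Suc t"] sz \<open>z < z'\<close> not_mtD[OF s(3) t(1)] by simp
  qed
qed

lemma below_cnt: "srt f \<Longrightarrow> srt g \<Longrightarrow> below f g \<Longrightarrow> cnt (set g) (Suc x) \<le> cnt (set f) x"
proof (induction f g rule: below.induct)
  case (3 r R s S)
  have "r \<notin> set R" "s \<notin> set S" using 3 by auto
  then have "cnt (set (r # R)) x = cnt (set R) x + (if r < x then 1 else 0)"
    "cnt (set (s # S)) (Suc x) = cnt (set S) (Suc x) + (if s < Suc x then 1 else 0)" by (simp_all add: cnt_insert)
  then show ?case using 3 by auto
qed (auto simp: cnt_def)

text \<open>In the situation of \<open>below\<close>, the matching property is strict at the elements of the lower list.\<close>

lemma below_cnt_strict: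
  assumes "srt g" "srt h" "below g h" "length g = length h" "u \<in> set g" "\<forall>x\<in>set h. x < z" "\<forall>x\<in>set g. x < z"
  shows "cnt (set g) z + cnt (set h) (Suc u) < cnt (set h) z + cnt (set g) (Suc u)"
proof -
  have d: "distinct g" "distinct h" using assms strict_sorted_iff by blast+
  have "cnt (set g) z = length g" "cnt (set h) z = length h"
    using assms(6,7) d by (auto simp: cnt_def distinct_card[symmetric] intro!: arg_cong[of _ _ card])
  then show ?thesis using below_cnt[OF assms(1-3), of u] cnt_Suc[of "set g" u] assms(4,5) by simp
qed

section \<open>Key columns of a tableau\<close>

definition tails :: "nat list list \<Rightarrow> nat list list" where
  "tails P = filter (\<lambda>R. R \<noteq> []) (map tl P)"

abbreviation heads :: "nat list list \<Rightarrow> nat list" where "heads P \<equiv> map hd P"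

text \<open>\<open>K c P\<close> is the column number \<open>c + 1\<close> of the (left) key of \<open>P\<close>.\<close>

fun K :: "nat \<Rightarrow> nat list list \<Rightarrow> nat set" where
  "K 0 P = set (heads P)"
| "K (Suc c) P = mu (set (heads P)) (K c (tails P))"

lemma tails_simps [simp]: "tails [] = []" "tails (R # P) = (if tl R = [] then tails P else tl R # tails P)"
  "tails (L @ U) = tails L @ tails U"
  by (simp_all add: tails_def)

lemma tab_append: "tab (L @ U) \<Longrightarrow> tab L \<and> tab U"
proof (induction L)
  case (Cons R L) then show ?case by (cases L) auto
qed simp

lemma below_hd: "below R S \<Longrightarrow> S \<noteq> [] \<Longrightarrow> R \<noteq> [] \<and> hd R < hd S" by (cases R; cases S) auto
lemma below_tl: "below R S \<Longrightarrow> below (tl R) (tl S)" by (cases R; cases S) auto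
lemma srt_heads: "tab P \<Longrightarrow> srt (heads P)"
proof (induction P)
  case (Cons R P)
  show ?case
  proof (cases P)
    case (Cons S Q)
    then have "hd R < hd S" using Cons.prems below_hd[of R S] by simp
    then show ?thesis using Cons.IH Cons.prems Cons by (auto intro: less_trans)
  qed simp
qed simp

lemma heads_ge: "tab (R # P) \<Longrightarrow> h \<in> set (heads P) \<Longrightarrow> hd R < h"
  using srt_heads[of "R # P"] by fastforce

lemma tails_short: "tab (R # U) \<Longrightarrow> tl R = [] \<Longrightarrow> tails (R # U) = []"
proof (induction U arbitrary: R)
  case (Cons S U)
  then have "tl S = []" using below_tl[of R S] by (cases "tl S") auto
  then show ?case using Cons by auto
qed simp

lemma hd_tails: "tab P \<Longrightarrow> tails P \<noteq> [] \<Longrightarrow> hd (tails P) = tl (hd P) \<and> tl (hd P) \<noteq> []"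
  using tails_short[of "hd P" "tl P"] by (cases P) fastforce+

lemma srt_tl: "srt R \<Longrightarrow> srt (tl R)" by (cases R) auto

lemma tab_tails: "tab P \<Longrightarrow> tab (tails P)"
proof (induction P)
  case (Cons R P)
  have "below (tl R) (hd (tails P))" if "tails P \<noteq> []"
    using hd_tails[of P] that Cons.prems below_tl[of R "hd P"] by (cases "P = []") auto
  then show ?case using Cons srt_tl by auto
qed simp

lemma below_heads: "tab P \<Longrightarrow> below (heads P) (heads (tails P))"
proof (induction P)
  case (Cons R P)
  show ?case
  proof (cases "tl R = []")
    case True then show ?thesis using tails_short[OF Cons.prems] by simp
  next
    case False
    then have "hd R < hd (tl R)" using Cons.prems by (cases R; cases "tl R") auto
    then show ?thesis using False Cons by simp
  qed
qed simp

lemma K_subset: "K c P \<subseteq> set (heads P)"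
  by (cases c) (auto simp: mu_def)

lemma finite_K: "finite (K c P)" using K_subset finite_subset by blast

lemma K_anti_Suc: "K (Suc c) P \<subseteq> K c P"
proof (induction c arbitrary: P)
  case (Suc c) then show ?case by (simp only: K.simps(2)[of _ P]) (rule mu_mono)
qed (auto simp: mu_def)

lemma K_anti: "c \<le> c' \<Longrightarrow> K c' P \<subseteq> K c P"
  by (induction rule: dec_induct) (use K_anti_Suc in blast)+

lemma cnt_subset: "D \<subseteq> E \<Longrightarrow> cnt D x \<le> cnt E x"
  using cnt_subset_diff[of D E 0 x] by simp

lemma hall: "tab P \<Longrightarrow> D \<subseteq> set (heads (tails P)) \<Longrightarrow> cnt D (Suc x) \<le> cnt (set (heads P)) x"
  using below_cnt[OF srt_heads srt_heads[OF tab_tails] below_heads, of P x] cnt_subset[of D "set (heads (tails P))" "Suc x"]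
  by simp

lemma card_mu_K: "tab P \<Longrightarrow> D \<subseteq> set (heads (tails P)) \<Longrightarrow> card (mu (set (heads P)) D) = card D"
  by (rule card_mu, meson finite_set finite_subset, rule hall)

text \<open>Hall's condition holds between neighbouring columns, so no element is lost in a matching
  and the key has the shape of \<open>P\<close>.\<close>

lemma card_K: "tab P \<Longrightarrow> card (K c P) = length (filter (\<lambda>R. c < length R) P)"
proof (induction c arbitrary: P)
  case 0
  have "distinct (heads P)" using srt_heads[OF 0] strict_sorted_iff by blast
  moreover have "filter (\<lambda>R. R \<noteq> []) P = P" using tab_nonempty[OF 0] by (simp add: filter_id_conv)
  ultimately show ?case by (simp add: distinct_card del: set_map)
next
  case (Suc c)
  have "length (filter (\<lambda>R. c < length R) (tails P)) = length (filter (\<lambda>R. Suc c < length R) P)" for P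
  proof (induction P)
    case (Cons R P) then show ?case by (cases R) auto
  qed simp
  then show ?case using card_mu_K[OF Suc.prems K_subset[of c "tails P"]] Suc.IH[OF tab_tails[OF Suc.prems]] by simp
qed

text \<open>Each closing bracket beyond \<open>z\<close> is the second entry of a row whose first
  entry also lies beyond \<open>z\<close>. By Hall's condition these first entries absorb all of
  them, and nothing is left for \<open>z\<close>.\<close>

lemma unmatched_rows:
  assumes "tab P" "set (heads P) \<subseteq> F"
    and D: "\<And>d. d \<in> D \<Longrightarrow> z < d \<Longrightarrow> \<exists>R\<in>set P. z < hd R \<and> tl R \<noteq> [] \<and> d = hd (tl R)"
  shows "\<not> mt F D z"
proof
  assume "mt F D z"
  then obtain w where w: "z < w" "cnt F w + cnt D (Suc z) < cnt D (Suc w) + cnt F (Suc z)" by (rule mtE)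
  define Q where "Q = dropWhile (\<lambda>R. hd R \<le> z) P"
  have PQ: "P = takeWhile (\<lambda>R. hd R \<le> z) P @ Q" by (simp add: Q_def)
  then have tQ: "tab Q" using tab_append assms(1) by metis
  have "srt (heads P) \<Longrightarrow> \<forall>R\<in>set (dropWhile (\<lambda>R. hd R \<le> z) P). z < hd R" by (induction P) auto
  then have gt: "\<forall>R\<in>set Q. z < hd R" using srt_heads[OF assms(1)] by (simp add: Q_def)
  have sub: "D \<inter> {z<..} \<subseteq> set (heads (tails Q))"
  proof
    fix d assume "d \<in> D \<inter> {z<..}"
    then obtain R where R: "R \<in> set P" "z < hd R" "tl R \<noteq> []" "d = hd (tl R)" using D by auto
    then have "R \<in> set Q" using PQ by (metis Un_iff leD set_append set_takeWhileD)
    then show "d \<in> set (heads (tails Q))" using R by (auto simp: tails_def)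
  qed
  have "card {d \<in> D. Suc z \<le> d \<and> d < Suc w} \<le> cnt (set (heads (tails Q))) (Suc w)"
    unfolding cnt_def by (rule card_mono) (use sub in auto)
  also have "\<dots> \<le> cnt (set (heads Q)) w" using hall[OF tQ order_refl] .
  also have "\<dots> \<le> card {u \<in> F. Suc z \<le> u \<and> u < w}"
    unfolding cnt_def by (rule card_mono) (use gt assms(2) PQ in auto, metis Un_iff image_eqI set_append subsetD)
  finally show False using w cnt_between[of "Suc z" "Suc w" D] cnt_between[of "Suc z" w F] by simp
qed

section \<open>Insertion and key columns\<close>

text \<open>
  \<open>bump es L x L' z\<close>: inserting \<open>x\<close> into the rows \<open>L\<close> turns them into \<open>L'\<close> and bumps a letter out
  of every row, finally \<open>z\<close>, such that the path stays to the right of the column \<open>es\<close> put to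
  the left of \<open>L\<close>.
\<close>

inductive bump :: "nat list \<Rightarrow> nat list list \<Rightarrow> nat \<Rightarrow> nat list list \<Rightarrow> nat \<Rightarrow> bool" where
  bump_Nil: "bump [] [] x [] x"
| bump_Cons: "e < x \<Longrightarrow> ins R x = (R', [y]) \<Longrightarrow> (x \<in> set R \<Longrightarrow> Suc x \<in> set R) \<Longrightarrow>
    bump es L y L' z \<Longrightarrow> bump (e # es) (R # L) x (R' # L') z"

lemma bump_basic:
  "bump es L x L' z \<Longrightarrow> x \<le> z \<and> length es = length L \<and> length L' = length L \<and>
    (\<forall>e\<in>set es. e < z) \<and> (\<forall>R\<in>set L. R \<noteq> []) \<and> (\<forall>R\<in>set L'. R \<noteq> [])"
proof (induction rule: bump.induct)
  case (bump_Cons e x R R' y es L L' z)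
  moreover have "R \<noteq> []" using bump_Cons by auto
  ultimately show ?case using ins_snd[of R x] ins_mem[of x R] by auto
qed simp

lemma srt_hd_le: "srt R \<Longrightarrow> x \<in> set R \<Longrightarrow> hd R \<le> x" by (cases R) auto

lemma srt_hd_less: "srt R \<Longrightarrow> r \<in> set (tl R) \<Longrightarrow> hd R < r" by (cases R) auto

lemma bump_heads: "bump es L x L' z \<Longrightarrow> rows_ok L \<Longrightarrow> \<forall>R\<in>set L'. hd R < z"
proof (induction rule: bump.induct)
  case (bump_Cons e x R R' y es L L' z)
  have "hd R' \<le> x" using ins_mem[of x R] ins_srt[of R x] bump_Cons srt_hd_le[of R' x] by auto
  moreover have "x < y" "y \<le> z" using ins_snd[of R x] bump_Cons bump_basic by fastforce+
  ultimately show ?case using bump_Cons by auto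
qed simp

lemma bump_below:
  "bump es L x L' z \<Longrightarrow> list_all2 (\<lambda>e R. \<forall>r\<in>set R. e < r) es L \<Longrightarrow> below es (heads L')"
proof (induction rule: bump.induct)
  case (bump_Cons e x R R' y es L L' z)
  have "R' \<noteq> []" "set R' \<subseteq> insert x (set R)" using ins_fst_set[of R x] ins_mem[of x R] bump_Cons by auto
  then have "e < hd R'" using bump_Cons.prems \<open>e < x\<close> by (cases R') auto
  then show ?case using bump_Cons by simp
qed simp

text \<open>The path meets the first column in the first row whose head is not smaller than the
  travelling letter. Before that, in \<open>L1\<close>, it is a path of the same kind through the
  tails, with the heads as the column to its left.\<close>

lemma bump_split:
  "bump es L x L' z \<Longrightarrow> tab L \<Longrightarrow> \<exists>L1 L2 T1 y L2' es1 es3. L = L1 @ L2 \<and> es = es1 @ es3 \<and>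
    length es1 = length L1 \<and> x \<le> y \<and> (\<forall>e\<in>set es1. e < y) \<and> bump (heads L1) (map tl L1) x T1 y \<and>
    bump es3 L2 y L2' z \<and> L' = map2 (#) (heads L1) T1 @ L2' \<and> (L2 \<noteq> [] \<longrightarrow> y \<le> hd (hd L2))"
proof (induction rule: bump.induct)
  case (bump_Nil x)
  show ?case by (rule exI[of _ "[]"], rule exI[of _ "[]"], rule exI[of _ "[]"], rule exI[of _ x]) (auto intro: bump.intros)
next
  case (bump_Cons e x R R' y es L L' z)
  obtain r R0 where R: "R = r # R0" using bump_Cons.prems by (cases R) auto
  show ?case
  proof (cases "x \<le> r")
    case True
    show ?thesis
      by (rule exI[of _ "[]"], rule exI[of _ "R # L"], rule exI[of _ "[]"], rule exI[of _ x],
          rule exI[of _ "R' # L'"], rule exI[of _ "[]"], rule exI[of _ "e # es"])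
        (use True R bump_Cons.hyps in \<open>auto intro: bump.intros\<close>)
  next
    case False
    then obtain R0' where R0': "ins R0 x = (R0', [y])" "R' = r # R0'"
      using bump_Cons.hyps(2) R by (cases "ins R0 x") auto
    have xy: "x < y" using ins_snd[of R0 x] R0' by auto
    have "tab L" using bump_Cons.prems by simp
    then obtain L1 L2 T1 y1 L2' es1 es3 where IH: "L = L1 @ L2" "es = es1 @ es3"
      "length es1 = length L1" "y \<le> y1" "\<forall>e\<in>set es1. e < y1" "bump (heads L1) (map tl L1) y T1 y1"
      "bump es3 L2 y1 L2' z" "L' = map2 (#) (heads L1) T1 @ L2'" "L2 \<noteq> [] \<longrightarrow> y1 \<le> hd (hd L2)"
      using bump_Cons.IH by blast
    have "bump (r # heads L1) (R0 # map tl L1) x (R0' # T1) y1"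
      by (rule bump.bump_Cons[OF _ R0'(1) _ IH(6)]) (use R False bump_Cons.hyps(3) in auto)
    note b = this
    show ?thesis
      by (rule exI[of _ "R # L1"], rule exI[of _ L2], rule exI[of _ "R0' # T1"], rule exI[of _ y1],
          rule exI[of _ L2'], rule exI[of _ "e # es1"], rule exI[of _ es3]) (use b IH R R0' xy bump_Cons.hyps(1) in auto)
  qed
qed

text \<open>
  Once the path meets the first column it stays there: a run of rows \<open>s - b, \<dots>, s - 1\<close> left
  unchanged by the exceptional rule, after which \<open>s\<close> enters the column.
\<close>

definition column_path where
  "column_path es L x L' z s gs hs \<longleftrightarrow> map tl L' = map tl L \<and> x \<le> s \<and> s \<le> z \<and> s \<notin> set (heads L) \<and>
    (x < hd (hd L) \<longrightarrow> s = x \<and> gs = tl es) \<and> (s = z \<longrightarrow> s = Suc (hd (last L))) \<and>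
    set (heads L') = insert s (set (heads L)) - {z} \<and> z \<in> insert s (set (heads L)) \<and>
    (\<forall>h\<in>set (heads L). h \<le> z) \<and>
    (\<forall>R\<in>set L. hd R < s \<longrightarrow> tl R \<noteq> [] \<and> hd (tl R) = Suc (hd R)) \<and>
    below gs hs \<and> length gs = length hs \<and> srt hs \<and> (srt es \<longrightarrow> srt gs) \<and> set gs \<subseteq> set es \<and>
    (\<forall>h\<in>set hs. h \<in> set (heads L) \<and> s < h \<and> h < z) \<and> {e \<in> set es. s \<le> e \<and> e < z} \<subseteq> set gs"

text \<open>The lists \<open>gs\<close> and \<open>hs\<close> record heads between \<open>s\<close>
  and \<open>z\<close>: each member of \<open>hs\<close> is bumped into the next row, beside its
  partner in \<open>gs\<close>, and is therefore larger. These pairs will verify the hypothesis of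
  \<open>mu_exchange\<close>.\<close>

lemma bump_column:
  "bump es L x L' z \<Longrightarrow> tab L \<Longrightarrow> L \<noteq> [] \<Longrightarrow> x \<le> hd (hd L) \<Longrightarrow> \<exists>s gs hs. column_path es L x L' z s gs hs"
proof (induction rule: bump.induct)
  case (bump_Cons e x R R' y es L L' z)
  obtain r R0 where R: "R = r # R0" "srt R0" "\<forall>a\<in>set R0. r < a" using bump_Cons.prems by (cases R) auto
  have tL: "tab L" using bump_Cons.prems by simp
  have hdL: "r < hd (hd L)" if "L \<noteq> []" using bump_Cons.prems below_hd[of R "hd L"] tab_nonempty[of L "hd L"] that R by auto
  have es_z: "\<forall>e'\<in>set (e # es). e' < z" and yz: "y \<le> z"
    using bump_basic[OF bump.bump_Cons[OF bump_Cons.hyps]] bump_basic[OF bump_Cons.hyps(4)] by auto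
  have Lnil: "L' = [] \<and> z = y \<and> es = []" if "L = []"
    using bump_Cons.hyps(4) that by (auto elim: bump.cases)
  consider "x = r" | "x < r" using bump_Cons.prems R by fastforce
  then show ?case
  proof cases
    case 1
    then have R': "R' = R" "y = Suc r" using bump_Cons.hyps(2) R by auto
    have R0: "R0 \<noteq> [] \<and> hd R0 = Suc r"
      using bump_Cons.hyps(3) 1 R by (cases R0) (auto simp: Suc_le_eq dest: Suc_lessI)
    show ?thesis
    proof (cases "L = []")
      case True
      have "column_path (e # es) (R # L) x (R' # L') z (Suc r) [] []"
        using Lnil True R R' R0 1 bump_Cons.hyps(1) by (auto simp: column_path_def)
      then show ?thesis by blast
    next
      case False
      then have "y \<le> hd (hd L)" using hdL R' by simp
      then obtain s gs hs where IH: "column_path es L y L' z s gs hs"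
        using bump_Cons.IH[OF tL False] by blast
      have "column_path (e # es) (R # L) x (R' # L') z s gs hs"
        unfolding column_path_def
      proof (intro conjI)
        note I = IH[unfolded column_path_def]
        have s: "r < s" "s \<noteq> r" "z \<noteq> r" using I R' by auto
        show "map tl (R' # L') = map tl (R # L)" "s \<le> z" "below gs hs" "length gs = length hs" "srt hs"
          using I R' by auto
        show "x \<le> s" using s 1 by simp
        show "s = z \<longrightarrow> s = Suc (hd (last (R # L)))" using I False by simp
        show "x < hd (hd (R # L)) \<longrightarrow> s = x \<and> gs = tl (e # es)" using 1 R by simp
        show "s \<notin> set (heads (R # L))" "z \<in> insert s (set (heads (R # L)))" using I s R by auto
        have "set (heads L') = insert s (set (heads L)) - {z}" using I by blast
        then show "set (heads (R' # L')) = insert s (set (heads (R # L))) - {z}" using s R R' by auto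
        show "\<forall>h\<in>set (heads (R # L)). h \<le> z" using I R s by auto
        show "\<forall>R\<in>set (R # L). hd R < s \<longrightarrow> tl R \<noteq> [] \<and> hd (tl R) = Suc (hd R)" using I R R0 by auto
        show "srt (e # es) \<longrightarrow> srt gs" "set gs \<subseteq> set (e # es)" using I by auto
        show "\<forall>h\<in>set hs. h \<in> set (heads (R # L)) \<and> s < h \<and> h < z" using I by auto
        have "e < s" using s 1 bump_Cons.hyps(1) by simp
        moreover have "{e' \<in> set es. s \<le> e' \<and> e' < z} \<subseteq> set gs" using I by blast
        ultimately show "{e' \<in> set (e # es). s \<le> e' \<and> e' < z} \<subseteq> set gs" by auto
      qed
      then show ?thesis by blast
    qed
  next
    case 2
    then have R': "R' = x # R0" "y = r" using bump_Cons.hyps(2) R by auto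
    show ?thesis
    proof (cases "L = []")
      case True
      have "column_path (e # es) (R # L) x (R' # L') z x [] []"
        using Lnil True R R' 2 bump_Cons.hyps(1) by (auto simp: column_path_def)
      then show ?thesis by blast
    next
      case False
      then have y: "y < hd (hd L)" using hdL R' by simp
      then obtain s gs hs where IH0: "column_path es L y L' z s gs hs"
        using bump_Cons.IH[OF tL False] by auto
      then have "s = y" "gs = tl es" using y unfolding column_path_def by auto
      then have IH: "column_path es L y L' z y (tl es) hs" using IH0 by simp
      obtain e1 es' where es: "es = e1 # es'" "e1 < y" "y < z"
        using bump_Cons.hyps(4) False
      proof cases
        case (bump_Cons e1 R2 R2' y2 es2 L2 L2')
        then show ?thesis using that ins_snd[of R2 y] bump_basic[OF bump_Cons(7)] by auto
      qed auto
      have gt: "\<forall>h\<in>set (heads L). r < h" using heads_ge[of R L] bump_Cons.prems R by auto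
      have "column_path (e # es) (R # L) x (R' # L') z x es (r # hs)"
        unfolding column_path_def
      proof (intro conjI)
        note I = IH[unfolded column_path_def]
        have s: "x < r" "r < z" using 2 es R' by auto
        show "map tl (R' # L') = map tl (R # L)" "x \<le> x" "x \<le> z" using I R R' s by auto
        show "below es (r # hs)" "length es = length (r # hs)" using I es R' by auto
        show "srt (r # hs)" using I R' by auto
        show "x < hd (hd (R # L)) \<longrightarrow> x = x \<and> es = tl (e # es)" by simp
        show "x = z \<longrightarrow> x = Suc (hd (last (R # L)))" using s by simp
        show "x \<notin> set (heads (R # L))" using s gt R by auto
        have z: "z \<in> set (heads L)" using I R' s by auto
        then show "z \<in> insert x (set (heads (R # L)))" by auto
        have "set (heads L') = insert y (set (heads L)) - {z}" using I by blast
        then show "set (heads (R' # L')) = insert x (set (heads (R # L))) - {z}" using s R R' by auto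
        show "\<forall>h\<in>set (heads (R # L)). h \<le> z" using I R s by auto
        show "\<forall>R\<in>set (R # L). hd R < x \<longrightarrow> tl R \<noteq> [] \<and> hd (tl R) = Suc (hd R)" using gt R s by fastforce
        show "srt (e # es) \<longrightarrow> srt es" "set es \<subseteq> set (e # es)" by auto
        show "\<forall>h\<in>set (r # hs). h \<in> set (heads (R # L)) \<and> x < h \<and> h < z" using I s R R' by auto
        show "{e' \<in> set (e # es). x \<le> e' \<and> e' < z} \<subseteq> set es" using bump_Cons.hyps(1) by auto
      qed
      then show ?thesis by blast
    qed
  qed
qed simp

lemma below_append: "length a = length b \<Longrightarrow> below (a @ c) (b @ d) \<longleftrightarrow> below a b \<and> below c d"
  by (induction a b rule: list_induct2) auto

lemma map2_Cons: "length a = length b \<Longrightarrow> heads (map2 (#) a b) = a \<and> map tl (map2 (#) a b) = b"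
  by (induction a b rule: list_induct2) auto

lemma tails_nonempty: "\<forall>R\<in>set (map tl L). R \<noteq> [] \<Longrightarrow> tails L = map tl L"
  by (auto simp: tails_def filter_id_conv)

lemma mu_insert_column:
  assumes "tab P" "set (heads P) = f" "s \<notin> f"
    and "\<And>d. d \<in> D \<Longrightarrow> s < d \<Longrightarrow> \<exists>R\<in>set P. s < hd R \<and> tl R \<noteq> [] \<and> d = hd (tl R)"
  shows "mu (insert s f) D = mu f D"
  using mu_insert_unmatched[OF assms(3)] unmatched_rows[OF assms(1), of f D s] assms by blast

text \<open>While \<open>z\<close> is still travelling, \<open>L' @ U\<close> lacks a letter and its
  sets \<open>K c\<close> may differ from the old ones, but a column \<open>es @ es2\<close> fitting
  to the left does not notice. In the induction the first column plays this role for the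
  tails.\<close>

lemma mu_partial:
  "tab (L @ U) \<Longrightarrow> bump es L x L' z \<Longrightarrow> srt (es @ es2) \<Longrightarrow> below (es @ es2) (heads (L @ U)) \<Longrightarrow>
    (es2 \<noteq> [] \<longrightarrow> z \<le> hd es2) \<Longrightarrow> mu (set (es @ es2)) (K c (L' @ U)) = mu (set (es @ es2)) (K c (L @ U))"
proof (induction "length (concat (L @ U))" arbitrary: L U es x L' z es2 c rule: less_induct)
  case less
  note tabLU = less.prems(1) and bump = less.prems(2)
  have tL: "tab L" and tU: "tab U" using tab_append[OF tabLU] by blast+
  obtain L1 L2 T1 y L2' es1 es3 where L: "L = L1 @ L2" and es: "es = es1 @ es3" "length es1 = length L1"
    "\<forall>e\<in>set es1. e < y" and b1: "bump (heads L1) (map tl L1) x T1 y" and b2: "bump es3 L2 y L2' z"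
    and L': "L' = map2 (#) (heads L1) T1 @ L2'" and y: "L2 \<noteq> [] \<longrightarrow> y \<le> hd (hd L2)"
    using bump_split[OF bump tL] by blast
  let ?f = "set (heads (L @ U))" and ?e = "set (es @ es2)"
  have lT: "length T1 = length L1" and ne: "\<forall>R\<in>set (map tl L1). R \<noteq> []" "\<forall>R\<in>set T1. R \<noteq> []"
    and f1y: "\<forall>h\<in>set (heads L1). h < y" using bump_basic[OF b1] by auto
  have mp: "heads (map2 (#) (heads L1) T1) = heads L1" "map tl (map2 (#) (heads L1) T1) = T1"
    using map2_Cons[of "heads L1" T1] lT by auto
  have tails1: "tails L1 = map tl L1" "tails (map2 (#) (heads L1) T1) = T1"
    using tails_nonempty ne mp by metis+
  have Uz: "z < h" if hU: "h \<in> set (heads U)" for h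
  proof -
    have "below es2 (heads U)"
      using less.prems(4) bump_basic[OF bump] below_append[of es "heads L" es2 "heads U"] by auto
    moreover obtain u U' where U: "U = u # U'" using hU by (cases U) auto
    ultimately have "es2 \<noteq> [] \<and> hd es2 < hd u" by (cases es2) auto
    moreover have "hd u \<le> h" using hU tU U heads_ge[of u U' h] by auto
    ultimately show ?thesis using less.prems(5) by auto
  qed
  show ?case
  proof (cases "concat (L @ U) = []")
    case True
    then have "L = []" using bump_basic[OF bump] by (cases L) auto
    then show ?thesis using bump_basic[OF bump] by simp
  next
    case nonempty: False
    have dec: "length (concat (tails (L @ U))) < length (concat (L @ U))"
    proof -
      have le: "length (concat (tails Q)) \<le> length (concat Q)" for Q
        by (induction Q) (auto simp: le_diff_conv)
      obtain R Q where "L @ U = R # Q" using nonempty by (cases "L @ U") auto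
      moreover have "R \<noteq> []" using calculation tabLU by auto
      ultimately show ?thesis using le[of Q] by (cases R) (auto simp: less_Suc_eq_le le_diff_conv)
    qed
    have tt: "tab (tails (L @ U))" using tab_tails tabLU by blast
    have srtf: "srt (heads (L @ U))" using srt_heads tabLU by blast
    show ?thesis
    proof (cases "L2 = []")
      case True
      then have [simp]: "L = L1" "L' = map2 (#) (heads L1) T1" "L2' = []" "z = y"
        using L L' b2 by (auto elim: bump.cases)
      have tLU: "tails (L @ U) = map tl L1 @ tails U" "tails (L' @ U) = T1 @ tails U" using tails1 by auto
      \<comment> \<open>The path avoids the first column, so the induction hypothesis for the tails,
        with the first column to their left, gives every key column.\<close>
      have "mu ?f (K c (T1 @ tails U)) = mu ?f (K c (map tl L1 @ tails U))" for c
        using less.hyps[of "map tl L1" "tails U" "heads L1" x T1 y "heads U" c] dec tt b1 srtf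
          below_heads[OF tabLU] Uz tLU by (cases U) (auto simp: less_imp_le)
      then have "K c (L' @ U) = K c (L @ U)" using tLU mp by (cases c) auto
      then show ?thesis by simp
    next
      case False
      have tL2U: "tab (L2 @ U)" using tab_append[of L1 "L2 @ U"] tabLU L by simp
      then have tL2: "tab L2" using tab_append[OF tL2U] by blast
      obtain s gs hs where cp: "column_path es3 L2 y L2' z s gs hs"
        using bump_column[OF b2 tL2 False] y False by blast
      note cp = cp[unfolded column_path_def]
      have ys: "y \<le> s" "s \<le> z" "s \<notin> set (heads L2)" using cp by auto
      have hL2': "set (heads L2') = insert s (set (heads L2)) - {z}" and tlL2': "map tl L2' = map tl L2" using cp by blast+
      have tailsL2: "tails L2' = tails L2" using tlL2' by (simp add: tails_def)
      have tLU: "tails (L @ U) = map tl L1 @ tails (L2 @ U)" "tails (L' @ U) = T1 @ tails (L2 @ U)"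
        using tails1 L L' tailsL2 by auto
      let ?K = "\<lambda>c. K c (tails (L @ U))" and ?K' = "\<lambda>c. K c (tails (L' @ U))"
      have sf: "s \<notin> ?f" using ys f1y Uz L by fastforce
      have hL': "set (heads (L' @ U)) = insert s ?f - {z}"
        using hL2' L' L mp f1y ys Uz by fastforce
      have IH: "mu ?f (?K' c) = mu ?f (?K c)" for c
        using less.hyps[of "map tl L1" "tails (L2 @ U)" "heads L1" x T1 y "heads (L2 @ U)" c] dec tt b1 srtf
          below_heads[OF tabLU] tLU L y False by (cases L2) auto
      \<comment> \<open>The letter \<open>s\<close> entering the first column remains unmatched:
        rows with a smaller head have second entry \<open>Suc\<close> of that head, so any closing
        bracket beyond \<open>s\<close> belongs to a row that starts beyond
        \<open>s\<close>.\<close>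
      have ins: "mu (insert s ?f) (?K' c) = mu ?f (?K c)" for c
      proof -
        have "\<exists>R\<in>set (L @ U). s < hd R \<and> tl R \<noteq> [] \<and> d = hd (tl R)" if d: "d \<in> ?K' c" "s < d" for d
        proof -
          have "d \<in> set (heads T1) \<union> set (heads (tails (L2 @ U)))" using K_subset d tLU by fastforce
          moreover have "d \<notin> set (heads T1)"
            using bump_heads[OF b1] tab_ok[OF tL] L srt_tl d ys by (fastforce simp: rows_ok_def)
          ultimately obtain R where R: "R \<in> set (L2 @ U)" "tl R \<noteq> []" "d = hd (tl R)" by (auto simp: tails_def)
          have special: "\<forall>R\<in>set L2. hd R < s \<longrightarrow> tl R \<noteq> [] \<and> hd (tl R) = Suc (hd R)" using cp by blast
          have "\<not> hd R < s"
          proof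
            assume "hd R < s"
            moreover have "R \<in> set U \<Longrightarrow> z < hd R" using Uz[of "hd R"] by simp
            ultimately have "R \<in> set L2" using R(1) ys by auto
            then have "d = Suc (hd R)" using special R \<open>hd R < s\<close> by simp
            then show False using d \<open>hd R < s\<close> by simp
          qed
          moreover have "hd R \<noteq> s" using sf R L by auto
          ultimately show ?thesis using R L by (intro bexI[of _ R]) auto
        qed
        then show ?thesis using mu_insert_column[OF tabLU refl sf, of "?K' c"] IH by simp
      qed
      \<comment> \<open>The hypothesis of \<open>mu_exchange\<close>: the elements of
        \<open>?e\<close> from \<open>u\<close> to \<open>z\<close> all lie in \<open>gs\<close>,
        each has a larger partner in \<open>hs\<close>, and the members of \<open>hs\<close> above
        \<open>w\<close> lie in \<open>X\<close>.\<close>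
      have H: "cnt ?e z + cnt X (Suc u) < cnt X z + cnt ?e (Suc u)"
        if u: "u \<in> ?e" "w \<le> u" "u < z" and w: "s \<le> w" and X: "\<And>h. h \<in> ?f \<Longrightarrow> w < h \<Longrightarrow> h < z \<Longrightarrow> h \<in> X" for X u w
      proof -
        have gsub: "{e \<in> ?e. u \<le> e \<and> e < z} \<subseteq> set gs"
        proof
          fix e assume e: "e \<in> {e \<in> ?e. u \<le> e \<and> e < z}"
          have "e \<notin> set es1" using es(3) e u w ys by force
          moreover have "e \<notin> set es2"
          proof
            assume "e \<in> set es2"
            then obtain a b where ab: "es2 = a # b" by (cases es2) auto
            then have "a \<le> e" using less.prems(3) \<open>e \<in> set es2\<close> by (auto simp: sorted_wrt_append)
            then show False using less.prems(5) ab e by auto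
          qed
          ultimately have "e \<in> set es3" using e es by auto
          moreover have "{e \<in> set es3. s \<le> e \<and> e < z} \<subseteq> set gs" using cp by blast
          ultimately show "e \<in> set gs" using e u w by auto
        qed
        have "set gs \<subseteq> set es3" using cp by (elim conjE)
        then have gz: "\<forall>g\<in>set gs. g < z" using bump_basic[OF b2] by auto
        have "srt gs" using cp less.prems(3) es by (simp add: sorted_wrt_append)
        then have st: "cnt (set gs) z + cnt (set hs) (Suc u) < cnt (set hs) z + cnt (set gs) (Suc u)"
          using below_cnt_strict[of gs hs u z] cp gsub u gz by auto
        have "card {e \<in> ?e. Suc u \<le> e \<and> e < z} \<le> card {g \<in> set gs. Suc u \<le> g \<and> g < z}"
          by (rule card_mono) (use gsub in auto)
        moreover have "card {h \<in> set hs. Suc u \<le> h \<and> h < z} \<le> card {h \<in> X. Suc u \<le> h \<and> h < z}"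
          by (rule card_mono) (use X cp u w L in auto)
        ultimately show ?thesis
          using st u cnt_between[of "Suc u" z ?e] cnt_between[of "Suc u" z X]
            cnt_between[of "Suc u" z "set gs"] cnt_between[of "Suc u" z "set hs"] by simp
      qed
      show ?thesis
      proof (cases "s = z")
        case True
        then have "set (heads (L' @ U)) = ?f" using hL' sf by auto
        moreover have "mu ?f (?K' c) = mu ?f (?K c)" for c by (rule IH)
        ultimately have "K c (L' @ U) = K c (L @ U)" by (cases c) auto
        then show ?thesis by simp
      next
        case sz: False
        then have sz': "s < z" and zf: "z \<in> ?f" using ys cp L by auto
        show ?thesis
        proof (cases c)
          case 0
          have "mu ?e (insert s (?f - {z})) = mu ?e ?f"
            by (rule mu_exchange[OF zf sf sz']) (rule H, auto)
          moreover have "insert s ?f - {z} = insert s (?f - {z})" using sz by auto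
          ultimately show ?thesis using hL' 0 by simp
        next
          case (Suc c')
          let ?X = "mu ?f (?K c')"
          have K': "K c (L' @ U) = mu (insert s ?f - {z}) (?K' c')" using hL' Suc by simp
          have KX: "K c (L @ U) = ?X" using Suc by simp
          show ?thesis
          proof (cases "z \<in> ?X")
            case False
            then have "K c (L' @ U) = ?X" using K' ins[of c'] mu_remove_unmatched[of z "insert s ?f" "?K' c'"] zf by simp
            then show ?thesis using KX by simp
          next
            case True
            \<comment> \<open>When \<open>z\<close> leaves, its partner goes to the largest
              unmatched element below \<open>z\<close>. As \<open>s\<close> is unmatched, this
              element is at least \<open>s\<close>, and all heads between it and \<open>z\<close>
              belong to \<open>?X\<close>.\<close>
            define W where "W = {v \<in> insert s ?f - ?X. v < z}"
            have sX: "s \<in> W" using sf sz' mu_subset by (auto simp: W_def)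
            have fW: "finite W" by (simp add: W_def)
            define w where "w = Max W"
            have w: "w \<in> W" using Max_in[OF fW] sX by (auto simp: w_def)
            have max: "v \<in> W \<Longrightarrow> v \<le> w" for v using Max_ge[OF fW] by (simp add: w_def)
            have "mu (insert s ?f - {z}) (?K' c') = insert w (?X - {z})"
              using mu_remove_matched[of z "insert s ?f" "?K' c'" w] True w max ins[of c'] by (auto simp: W_def)
            moreover have "mu ?e (insert w (?X - {z})) = mu ?e ?X"
            proof (rule mu_exchange[OF True])
              show "w \<notin> ?X" "w < z" using w by (auto simp: W_def)
              fix u assume u: "u \<in> ?e" "w \<le> u" "u < z"
              show "cnt ?e z + cnt ?X (Suc u) < cnt ?X z + cnt ?e (Suc u)"
              proof (rule H[OF u max[OF sX]])
                fix h assume h: "h \<in> ?f" "w < h" "h < z"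
                show "h \<in> ?X"
                proof (rule ccontr)
                  assume "h \<notin> ?X"
                  then have "h \<in> W" using h by (simp add: W_def)
                  then show False using max h by fastforce
                qed
              qed
            qed
            ultimately show ?thesis using K' KX by simp
          qed
        qed
      qed
    qed
  qed
qed

lemma insert_of_card_Suc:
  assumes "A \<subseteq> B" "card B = Suc (card A)" "finite B"
  shows "\<exists>z. B = insert z A \<and> z \<notin> A"
proof -
  have "card (B - A) = 1" using assms finite_subset[OF assms(1,3)] by (simp add: card_Diff_subset)
  then obtain z where "B - A = {z}" by (rule card_1_singletonE)
  then show ?thesis using assms(1) by (intro exI[of _ z]) auto
qed

definition adds_cell :: "nat list list \<Rightarrow> nat list list \<Rightarrow> bool" where
  "adds_cell P P' \<longleftrightarrow> (\<exists>c z. z \<notin> K c P \<and> K c P' = insert z (K c P) \<and> (\<forall>c'. c' \<noteq> c \<longrightarrow> K c' P' = K c' P) \<and>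
    (\<forall>s\<in>K c P - K (Suc c) P. z < s))"

text \<open>Either the path ends by appending to an existing row without having met the first
  column, and the new element is transported from the tails by the matching; or it ends in a new top
  row, and then the first column gains \<open>s\<close> while all other key columns stay.\<close>

lemma bump_adds_cell:
  "tab (L @ U) \<Longrightarrow> bump es L x L' z \<Longrightarrow> tab P' \<Longrightarrow>
    (U = [] \<and> P' = L' @ [[z]] \<or> (\<exists>R U1. U = R # U1 \<and> (\<forall>r\<in>set R. r < z) \<and> P' = L' @ (R @ [z]) # U1)) \<Longrightarrow>
    adds_cell (L @ U) P'"
proof (induction "length (concat (L @ U))" arbitrary: L U es x L' z P' rule: less_induct)
  case less
  note tabLU = less.prems(1) and bump = less.prems(2) and tabP' = less.prems(3)
  have tL: "tab L" and tU: "tab U" using tab_append[OF tabLU] by blast+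
  obtain L1 L2 T1 y L2' es1 es3 where L: "L = L1 @ L2" and es: "es = es1 @ es3" "length es1 = length L1"
    and b1: "bump (heads L1) (map tl L1) x T1 y" and b2: "bump es3 L2 y L2' z"
    and L': "L' = map2 (#) (heads L1) T1 @ L2'" and y: "L2 \<noteq> [] \<longrightarrow> y \<le> hd (hd L2)"
    using bump_split[OF bump tL] by blast
  let ?f = "set (heads (L @ U))"
  have lT: "length T1 = length L1" and ne: "\<forall>R\<in>set (map tl L1). R \<noteq> []" "\<forall>R\<in>set T1. R \<noteq> []"
    and f1y: "\<forall>h\<in>set (heads L1). h < y" using bump_basic[OF b1] by auto
  have mp: "heads (map2 (#) (heads L1) T1) = heads L1" "map tl (map2 (#) (heads L1) T1) = T1"
    using map2_Cons[of "heads L1" T1] lT by auto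
  have tails1: "tails L1 = map tl L1" "tails (map2 (#) (heads L1) T1) = T1"
    using tails_nonempty ne mp by metis+
  have tt: "tab (tails (L @ U))" "tab (tails P')" using tab_tails tabLU tabP' by blast+
  have srtf: "srt (heads (L @ U))" using srt_heads tabLU by blast
  show ?case
  proof (cases "L2 = [] \<and> U \<noteq> []")
    case True
    then have [simp]: "L = L1" "L' = map2 (#) (heads L1) T1" "L2' = []" "z = y"
      using L L' b2 by (auto elim: bump.cases)
    obtain R U1 where U: "U = R # U1" "\<forall>r\<in>set R. r < z" "P' = L' @ (R @ [z]) # U1" using less.prems(4) True by auto
    have R: "R \<noteq> []" using tU U by simp
    have hP': "heads P' = heads (L @ U)" using U R mp by simp
    have tP': "tails P' = T1 @ (tl R @ [z]) # tails U1" using U R tails1 by (simp add: tl_append split: list.splits)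
    have dec: "length (concat (tails (L @ U))) < length (concat (L @ U))"
    proof -
      have le: "length (concat (tails Q)) \<le> length (concat Q)" for Q
        by (induction Q) (auto simp: le_diff_conv)
      obtain R Q where "L @ U = R # Q" using True by (cases "L @ U") auto
      moreover have "R \<noteq> []" using calculation tabLU by auto
      ultimately show ?thesis using le[of Q] by (cases R) (auto simp: less_Suc_eq_le le_diff_conv)
    qed
    have "adds_cell (tails (L @ U)) (tails P')"
    proof (cases "tl R = []")
      case True
      then have "tails U = []" using tails_short[of R U1] tU U by simp
      then have e: "tails (L @ U) = map tl L1 @ []" "tails P' = T1 @ [[z]]" using True tP' tails1 U by auto
      show ?thesis unfolding e(1)
        by (rule less.hyps[OF _ _ b1]) (use e dec tt in auto)
    next
      case False
      then have e: "tails (L @ U) = map tl L1 @ (tl R # tails U1)" using tails1 U by auto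
      have "\<forall>r\<in>set (tl R). r < z" using U list.set_sel(2)[OF R] by auto
      then show ?thesis unfolding e
        using less.hyps[OF _ _ b1, of "tl R # tails U1" "tails P'"] e tP' dec tt by auto
    qed
    then obtain c z' where c: "z' \<notin> K c (tails (L @ U))" "K c (tails P') = insert z' (K c (tails (L @ U)))"
      "\<forall>c'. c' \<noteq> c \<longrightarrow> K c' (tails P') = K c' (tails (L @ U))"
      "\<forall>s\<in>K c (tails (L @ U)) - K (Suc c) (tails (L @ U)). z' < s" unfolding adds_cell_def by blast
    let ?B = "K c (tails (L @ U))"
    have f': "set (heads P') = ?f" using hP' by simp
    have "mu ?f ?B \<subseteq> mu ?f (insert z' ?B)" by (rule mu_mono) auto
    \<comment> \<open>Hall's condition for both tableaux fixes the number of matched elements, so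
      exactly one is new.\<close>
    moreover have "card (mu ?f (insert z' ?B)) = Suc (card (mu ?f ?B))"
      using card_mu_K[OF tabLU K_subset[of c]] card_mu_K[OF tabP' K_subset[of c]] f' c finite_K by simp
    moreover have "finite (mu ?f (insert z' ?B))" using card_mu_le[of "insert z' ?B" ?f] finite_K by simp
    ultimately obtain z2 where z2: "mu ?f (insert z' ?B) = insert z2 (mu ?f ?B)" "z2 \<notin> mu ?f ?B"
      using insert_of_card_Suc by metis
    have below: "z2 < s" if "s \<in> K (Suc c) (L @ U) - K (Suc (Suc c)) (L @ U)" for s
      using mu_insert_below[OF K_anti_Suc c(1,4) z2(2,1), of s] that by simp
    show ?thesis unfolding adds_cell_def
    proof (rule exI[of _ "Suc c"], rule exI[of _ z2], intro conjI allI impI ballI)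
      fix c' assume "c' \<noteq> Suc c"
      then show "K c' P' = K c' (L @ U)" using c(3) f' by (cases c') auto
    qed (use z2 f' c(2) below in auto)
  next
    case notI: False
    \<comment> \<open>A path running in the first column emits one of the heads of \<open>L2\<close>
      or the successor of the last one. This does not exceed the head of the next row and cannot be
      appended there.\<close>
    have U: "U = []"
    proof (rule ccontr)
      assume U0: "U \<noteq> []"
      then have L2: "L2 \<noteq> []" using notI by simp
      have tL2: "tab L2" using tab_append[of L1 L2] tL L by simp
      obtain s gs hs where cp: "column_path es3 L2 y L2' z s gs hs"
        using bump_column[OF b2 tL2 L2] y L2 by blast
      note cp = cp[unfolded column_path_def]
      obtain R U1 where U: "U = R # U1" "\<forall>r\<in>set R. r < z" using less.prems(4) U0 by auto
      have lt: "h < hd R" if "h \<in> set (heads L2)" for h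
        using srtf L U that by (auto simp: sorted_wrt_append)
      have "hd R < z" using U tU by auto
      then have "z \<notin> set (heads L2)" using lt[of z] by auto
      then have "s = z" using cp by blast
      then have "z = Suc (hd (last L2))" using cp by blast
      moreover have "hd (last L2) < hd R" using lt L2 by simp
      ultimately show False using \<open>hd R < z\<close> by simp
    qed
    then have P': "P' = L' @ [[z]]" using less.prems(4) by simp
    have tL2: "tab L2" using tab_append[of L1 L2] tL L by simp
    have tLs: "tails (L @ U) = map tl L1 @ tails L2" using L U tails1 by simp
    have f: "?f = set (heads L1) \<union> set (heads L2)" using L U by auto
    have "\<exists>s. y \<le> s \<and> s \<notin> ?f \<and> set (heads P') = insert s ?f \<and> tails P' = T1 @ tails L2 \<and>
      (\<forall>R\<in>set L2. hd R < s \<longrightarrow> tl R \<noteq> [] \<and> hd (tl R) = Suc (hd R))"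
    proof (cases "L2 = []")
      case True
      then have [simp]: "L = L1" "L' = map2 (#) (heads L1) T1" "L2' = []" "z = y"
        using L L' b2 by (auto elim: bump.cases)
      have "y \<notin> ?f" using f1y f True by fastforce
      then show ?thesis using True P' f mp tails1 by (intro exI[of _ y]) auto
    next
      case False
      obtain s gs hs where cp: "column_path es3 L2 y L2' z s gs hs"
        using bump_column[OF b2 tL2 False] y False by blast
      note cp = cp[unfolded column_path_def]
      have ys: "y \<le> s" "s \<le> z" "s \<notin> set (heads L2)" using cp by auto
      have hL2': "set (heads L2') = insert s (set (heads L2)) - {z}" and tlL2': "map tl L2' = map tl L2"
        and z: "z \<in> insert s (set (heads L2))" using cp by blast+
      have tailsL2: "tails L2' = tails L2" using tlL2' by (simp add: tails_def)
      have "s \<notin> ?f" using ys f1y f by fastforce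
      moreover have "set (heads P') = insert s ?f" using P' L' mp hL2' z f by auto
      moreover have "tails P' = T1 @ tails L2" using P' L' tails1 tailsL2 by simp
      ultimately show ?thesis using ys cp by blast
    qed
    then obtain s where s: "y \<le> s" "s \<notin> ?f" "set (heads P') = insert s ?f" "tails P' = T1 @ tails L2"
      "\<forall>R\<in>set L2. hd R < s \<longrightarrow> tl R \<noteq> [] \<and> hd (tl R) = Suc (hd R)" by blast
    have IH: "mu ?f (K c (tails P')) = mu ?f (K c (tails (L @ U)))" for c
      using mu_partial[of "map tl L1" "tails L2" "heads L1" x T1 y "heads L2" c] tt b1 srtf
        below_heads[OF tabLU] tLs s(4) L U y by (cases L2) auto
    have ins: "mu (insert s ?f) (K c (tails P')) = mu ?f (K c (tails (L @ U)))" for c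
    proof -
      have "\<exists>R\<in>set (L @ U). s < hd R \<and> tl R \<noteq> [] \<and> d = hd (tl R)" if d: "d \<in> K c (tails P')" "s < d" for d
      proof -
        have "d \<in> set (heads T1) \<union> set (heads (tails L2))" using K_subset d s(4) by fastforce
        moreover have "d \<notin> set (heads T1)"
          using bump_heads[OF b1] tab_ok[OF tL] L srt_tl d s(1) by (fastforce simp: rows_ok_def)
        ultimately obtain R where R: "R \<in> set L2" "tl R \<noteq> []" "d = hd (tl R)" by (auto simp: tails_def)
        have "\<not> hd R < s" using s(5) R d by auto
        moreover have "hd R \<noteq> s" using s(2) R L by auto
        ultimately show ?thesis using R L by (intro bexI[of _ R]) auto
      qed
      then show ?thesis using mu_insert_column[OF tabLU refl s(2), of "K c (tails P')"] IH by simp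
    qed
    \<comment> \<open>All elements of the old first column below \<open>s\<close> are matched: those
      in \<open>L1\<close> because the new heads \<open>T1\<close> lie strictly to their right and
      below \<open>y\<close>, those in \<open>L2\<close> because the successor is their neighbour in
      the row.\<close>
    have key: "s < v" if v: "v \<in> K 0 (L @ U) - K (Suc 0) (L @ U)" for v
    proof (rule ccontr)
      let ?D = "set (heads (tails P'))"
      assume "\<not> s < v"
      moreover have "v \<noteq> s" using v s(2) by auto
      ultimately have vs: "v < s" by simp
      have vf: "v \<in> ?f" "\<not> mt ?f ?D v" using v IH[of 0] by (auto simp: mu_def)
      consider "v \<in> set (heads L1)" | "v \<in> set (heads L2)" using vf(1) unfolding f by blast
      then show False
      proof cases
        case 1
        have "list_all2 (\<lambda>e R. \<forall>r\<in>set R. e < r) (heads L1) (map tl L1)"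
        proof -
          have "\<forall>R\<in>set L1. \<forall>r\<in>set (tl R). hd R < r"
            using tab_ok[OF tL] L srt_hd_less by (simp add: rows_ok_def)
          then show ?thesis by (simp add: list_all2_map1 list_all2_map2 list_all2_same)
        qed
        then have d: "below (heads L1) (heads T1)" by (rule bump_below[OF b1])
        have sT: "srt (heads T1)" using srt_heads[OF tt(2)] s(4) by (simp add: sorted_wrt_append)
        have sL: "srt (heads L1)" using srtf L by (simp add: sorted_wrt_append)
        have T1y: "\<forall>h\<in>set (heads T1). h < y"
          using bump_heads[OF b1] tab_ok[OF tL] L srt_tl by (fastforce simp: rows_ok_def)
        have vy: "v < y" using f1y 1 by blast
        have st: "cnt (set (heads L1)) y + cnt (set (heads T1)) (Suc v) < cnt (set (heads T1)) y + cnt (set (heads L1)) (Suc v)"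
          by (rule below_cnt_strict[OF sL sT d _ 1 T1y f1y]) (simp add: lT)
        have "srt (heads L2)" using srtf L by (simp add: sorted_wrt_append)
        then have L2y: "\<forall>h\<in>set (heads L2). y \<le> h" using y by (cases L2) auto
        have "card {u \<in> ?f. Suc v \<le> u \<and> u < y} \<le> card {u \<in> set (heads L1). Suc v \<le> u \<and> u < y}"
          by (rule card_mono) (use f L2y in auto)
        moreover have "card {u \<in> set (heads T1). Suc v \<le> u \<and> u < y} \<le> card {u \<in> ?D. Suc v \<le> u \<and> u < Suc y}"
          by (rule card_mono) (use s(4) in auto)
        ultimately have "mt ?f ?D v"
          using st vy cnt_between[of "Suc v" y ?f] cnt_between[of "Suc v" "Suc y" ?D]
            cnt_between[of "Suc v" y "set (heads L1)"] cnt_between[of "Suc v" y "set (heads T1)"]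
          by (intro mtI[of v y]) auto
        then show False using vf by simp
      next
        case 2
        then obtain R where "R \<in> set L2" "hd R = v" by auto
        then have "Suc v \<in> ?D" using s(4,5) vs by (auto simp: tails_def image_iff)
        then have "mt ?f ?D v" by (intro mtI[of v "Suc v"]) (auto simp: cnt_Suc)
        then show False using vf by simp
      qed
    qed
    show ?thesis unfolding adds_cell_def
    proof (rule exI[of _ 0], rule exI[of _ s], intro conjI allI impI ballI)
      fix c' :: nat assume "c' \<noteq> 0"
      then show "K c' P' = K c' (L @ U)" using ins s(3) by (cases c') auto
    qed (use s key in auto)
  qed
qed

text \<open>For a complete insertion the column to the left is an artificial column of zeros;
  positivity of \<open>x\<close> makes the path stay to the right of it.\<close>

lemma tins_bump:
  "rows_ok P \<Longrightarrow> red (rrw P @ [x]) \<Longrightarrow> 0 < x \<Longrightarrow> \<exists>L U L' z. P = L @ U \<and> bump (replicate (length L) 0) L x L' z \<and>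
    (U = [] \<and> tins P x = L' @ [[z]] \<or> (\<exists>R U1. U = R # U1 \<and> (\<forall>r\<in>set R. r < z) \<and> tins P x = L' @ (R @ [z]) # U1))"
proof (induction P arbitrary: x)
  case Nil
  have "bump (replicate (length []) 0) [] x [] x" by (simp add: bump_Nil)
  then show ?case by fastforce
next
  case (Cons R P)
  have r: "red (R @ [x])" using Cons.prems red_appendD2 by auto
  show ?case
  proof (cases R x rule: ins_cases)
    case (app R')
    then have "\<forall>r\<in>set R. r < x" "R' = R @ [x]" using ins_app[of R x] ins_app_eq[of R x] by auto
    moreover have "bump (replicate (length []) 0) [] x [] x" by (simp add: bump_Nil)
    ultimately show ?thesis using app
      by (intro exI[of _ "[]"] exI[of _ "R # P"] exI[of _ x]) auto
  next
    case (bump R' y)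
    have "red (rrw P @ [y] @ R')" using ins_red[of R "rrw P" x "[]"] Cons.prems bump by simp
    then have "red (rrw P @ [y])" using red_appendD1[of "rrw P @ [y]" R'] by simp
    then obtain L U L' z where IH: "P = L @ U" "bump (replicate (length L) 0) L y L' z"
      "U = [] \<and> tins P y = L' @ [[z]] \<or> (\<exists>R U1. U = R # U1 \<and> (\<forall>r\<in>set R. r < z) \<and> tins P y = L' @ (R @ [z]) # U1)"
      using Cons.IH[of y] Cons.prems bump by auto
    have "bump (replicate (length (R # L)) 0) (R # L) x (R' # L') z"
      using IH(2) bump Cons.prems red_insert_mem[of R x "[]"] r by (auto intro: bump_Cons)
    then show ?thesis using IH bump by (intro exI[of _ "R # L"] exI[of _ U] exI[of _ "R' # L'"] exI[of _ z]) auto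
  qed
qed

theorem tins_adds_cell: "tab P \<Longrightarrow> red (rrw P @ [x]) \<Longrightarrow> 0 < x \<Longrightarrow> adds_cell P (tins P x)"
  using tins_bump[of P x] bump_adds_cell tab_ok tab_tins by metis

lemma tins_K_mono: "tab P \<Longrightarrow> red (rrw P @ [x]) \<Longrightarrow> 0 < x \<Longrightarrow> K c P \<subseteq> K c (tins P x)"
  using tins_adds_cell[of P x] unfolding adds_cell_def by (metis subset_insertI order_refl)

lemma tinsw_K_mono: "tab P \<Longrightarrow> red (rrw P @ w) \<Longrightarrow> 0 \<notin> set w \<Longrightarrow> K c P \<subseteq> K c (tinsw P w)"
proof (induction w arbitrary: P)
  case (Cons x w)
  have r: "red (rrw P @ [x])" using Cons.prems red_appendD1[of "rrw P @ [x]" w] by simp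
  have "ckeq ((rrw P @ [x]) @ w) (rrw (tins P x) @ w)"
    using tins_ckeq[OF tab_ok r] Cons.prems by (intro ck_app) auto
  then have "red (rrw (tins P x) @ w)" using Cons.prems ck_red by simp
  then show ?case using Cons.IH[of "tins P x"] tins_K_mono[OF _ r] tab_tins Cons.prems by fastforce
qed simp

section \<open>Row insertion of increasing words\<close>

lemma insw_Nil: "srt w \<Longrightarrow> insw [] w = (w, [])"
  using insw_under[of w "[]"] by simp

text \<open>For an increasing word, whatever follows the letter settled at \<open>r\<close> is too
  large to come back to this place. Insertion thus becomes a simultaneous scan of both words, as in
  the drop alignment.\<close>

lemma insw_Cons:
  assumes "srt (s # w)"
  shows "insw (r # R) (s # w) =
    (if s < r then map_prod (Cons s) (Cons r) (insw R w)
     else if s = r then map_prod (Cons r) (Cons (Suc r)) (insw R w)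
     else apfst (Cons r) (insw R (s # w)))"
proof (cases "r < s")
  case True
  then have "\<forall>x\<in>set (s # w). r < x" using assms by auto
  then show ?thesis using True insw_Cons_gt[of "s # w" r R] by (simp del: insw.simps)
next
  case False
  then show ?thesis using assms insw_Cons_gt[of w s R] by (cases "insw R w") auto
qed

lemma insw_length:
  "srt w \<Longrightarrow> insw R w = (A, B) \<Longrightarrow>
    length A + length B = length R + length w \<and> length R \<le> length A \<and> length w \<le> length A"
proof (induction R arbitrary: w A B)
  case Nil then show ?case by (simp add: insw_Nil)
next
  case (Cons r R)
  show ?case
  proof (cases w)
    case Nil then show ?thesis using Cons.prems by simp
  next
    case w: (Cons s w')
    obtain A1 B1 where 1: "insw R w' = (A1, B1)" by fastforce
    obtain A2 B2 where 2: "insw R (s # w') = (A2, B2)" by fastforce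
    show ?thesis
      using Cons.prems Cons.IH[OF _ 1] Cons.IH[OF _ 2] w 1 2 insw_Cons[of s w' r R]
      by (auto simp del: insw.simps split: if_splits)
  qed
qed

lemma insw_length_snd: "length (snd (insw R w)) \<le> length w"
proof (induction w arbitrary: R)
  case (Cons x w)
  obtain R1 o1 where i: "ins R x = (R1, o1)" by fastforce
  have "length o1 \<le> 1" using ins_snd[of R x] i by auto
  then show ?case using Cons[of R1] i by auto
qed simp

lemma insw_out:
  "srt w \<Longrightarrow> srt R \<Longrightarrow> insw R w = (A, B) \<Longrightarrow>
    srt B \<and> (\<forall>b\<in>set B. w \<noteq> [] \<and> R \<noteq> [] \<and> hd w < b \<and> hd R \<le> b)"
proof (induction R arbitrary: w A B)
  case Nil then show ?case by (simp add: insw_Nil)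
next
  case (Cons r R)
  show ?case
  proof (cases w)
    case Nil then show ?thesis using Cons.prems by simp
  next
    case w: (Cons s w')
    have R: "srt R" "\<And>x. x \<in> set R \<Longrightarrow> r < x" and w': "srt w'" "\<And>x. x \<in> set w' \<Longrightarrow> s < x"
      using Cons.prems w by auto
    obtain A1 B1 where 1: "insw R w' = (A1, B1)" by fastforce
    obtain A2 B2 where 2: "insw R (s # w') = (A2, B2)" by fastforce
    have b1: "srt B1" "\<And>b. b \<in> set B1 \<Longrightarrow> r < b \<and> (\<exists>x. s < x \<and> x < b)"
      using Cons.IH[OF w'(1) R(1) 1] R(2) w'(2) by (auto, (metis hd_in_set order_less_le_trans)+)
    have b2: "srt B2" "\<And>b. b \<in> set B2 \<Longrightarrow> r < b \<and> s < b"
      using Cons.IH[OF _ R(1) 2] R(2) Cons.prems w by (auto, (metis hd_in_set order_less_le_trans)+)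
    consider "s < r" | "s = r" | "r < s" by linarith
    then show ?thesis
    proof cases
      case c: 1
      then have "\<forall>b\<in>set B1. s < b \<and> r < b" using b1(2) less_trans by blast
      moreover have "B = r # B1" using Cons.prems w 1 c insw_Cons[of s w' r R] by (auto simp del: insw.simps)
      ultimately show ?thesis using b1(1) c w by (auto simp: less_imp_le)
    next
      case c: 2
      then have "\<forall>b\<in>set B1. Suc r < b" using b1(2) by fastforce
      moreover have "B = Suc r # B1" using Cons.prems w 1 c insw_Cons[of s w' r R] by (auto simp del: insw.simps)
      ultimately show ?thesis using b1(1) c w by (auto simp: less_imp_le Suc_lessD)
    next
      case c: 3
      have "B = B2" using Cons.prems w 2 c insw_Cons[of s w' r R] by (auto simp del: insw.simps)
      then show ?thesis using b2 w by (auto simp: less_imp_le)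
    qed
  qed
qed

lemma insw_hd:
  assumes "srt w" "w \<noteq> []" "R \<noteq> []" "hd w < hd R" "insw R w = (A, B)"
  shows "A \<noteq> [] \<and> B \<noteq> [] \<and> hd A = hd w \<and> hd B = hd R"
proof -
  obtain r R0 s w0 where "R = r # R0" "w = s # w0" using assms by (cases R; cases w) auto
  then show ?thesis using assms insw_Cons[of s w0 r R0] by (cases "insw R0 w0") (auto simp del: insw.simps)
qed

text \<open>An entry passed over would make the new row longer than \<open>w\<close>. An entry met
  by an equal letter is followed by its successor, below which the next letter of \<open>w\<close>
  could not lie.\<close>

lemma insw_no_move:
  "srt R \<Longrightarrow> srt w \<Longrightarrow> red (R @ w) \<Longrightarrow> insw R w = (A, B) \<Longrightarrow> length A = length w \<Longrightarrow> below w R"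
proof (induction R arbitrary: w A B)
  case (Cons r R)
  show ?case
  proof (cases w)
    case Nil then show ?thesis using Cons.prems by simp
  next
    case w: (Cons s w')
    obtain A1 B1 where 1: "insw R w' = (A1, B1)" by fastforce
    obtain A2 B2 where 2: "insw R (s # w') = (A2, B2)" by fastforce
    have red1: "red (snd (ins (r # R) s) @ fst (ins (r # R) s) @ w')"
      using ins_red[of "r # R" "[]" s w'] Cons.prems w by simp
    consider "s < r" | "s = r" | "r < s" by linarith
    then show ?thesis
    proof cases
      case c: 1
      then have "red (R @ w')" using red1 red_ConsD by auto
      then show ?thesis using Cons.IH[OF _ _ _ 1] Cons.prems w 1 c insw_Cons[of s w' r R]
        by (auto simp del: insw.simps)
    next
      case c: 2
      then have "red (R @ w')" using red1 red_ConsD by auto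
      moreover have l: "length A1 = length w'"
        using Cons.prems w 1 c insw_Cons[of s w' r R] by (auto simp del: insw.simps)
      ultimately have "below w' R" using Cons.IH[OF _ _ _ 1] Cons.prems w by auto
      moreover obtain H where "R = Suc r # H" using red_special[of r R w'] Cons.prems w c by auto
      ultimately show ?thesis using Cons.prems w c by (cases w') auto
    next
      case c: 3
      then show ?thesis using insw_length[OF _ 2] Cons.prems w 2 insw_Cons[of s w' r R]
        by (auto simp del: insw.simps)
    qed
  qed
qed simp

section \<open>Reverse insertion\<close>

text \<open>Reverse insertion works on decreasing words, that is on reversed rows.\<close>

fun rin :: "nat list \<Rightarrow> nat \<Rightarrow> nat list \<times> nat list" where
  "rin [] y = ([y], [])"
| "rin (s # S) y = (if s < y then (y # S, [s]) else if s = y then (s # S, [y - 1]) else apfst (Cons s) (rin S y))"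

fun rinw :: "nat list \<Rightarrow> nat list \<Rightarrow> nat list \<times> nat list" where
  "rinw S [] = (S, [])"
| "rinw S (y # w) = (case rin S y of (S1, o1) \<Rightarrow> apsnd ((@) o1) (rinw S1 w))"

lemma rin_append_gt: "\<forall>a\<in>set S. y < a \<Longrightarrow> rin (S @ Q) y = apfst ((@) S) (rin Q y)"
  by (induction S) (auto simp: apfst_def map_prod_def split: prod.splits)

lemma rin_append_le: "\<exists>a\<in>set S. a \<le> y \<Longrightarrow> rin (S @ Q) y = apfst (\<lambda>S'. S' @ Q) (rin S y)"
proof (induction S)
  case (Cons a S)
  then show ?case by (cases "a \<le> y") (auto simp: apfst_def map_prod_def split: prod.splits)
qed simp

text \<open>After an ordinary bump \<open>y\<close> is gone from the row, and the first smaller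
  entry found from the right is \<open>x\<close>. After the exceptional rule
  \<open>y = Suc x\<close> is still there, and meeting it identifies this case.\<close>

lemma rin_ins:
  "srt R \<Longrightarrow> ins R x = (R', [y]) \<Longrightarrow> (x \<in> set R \<Longrightarrow> Suc x \<in> set R) \<Longrightarrow> rin (rev R') y = (rev R, [x])"
proof (induction R arbitrary: R')
  case (Cons r R)
  consider "x < r" | "x = r" | "r < x" by linarith
  then show ?case
  proof cases
    case 1
    then show ?thesis using Cons.prems rin_append_gt[of "rev R" r "[x]"] by auto
  next
    case 2
    then have "Suc r \<in> set R" "srt R" "\<forall>a\<in>set R. r < a" using Cons.prems by auto
    then obtain R1 where "R = Suc r # R1" by (cases R) fastforce+
    then show ?thesis using Cons.prems 2 rin_append_gt[of "rev R1" "Suc r" "[Suc r, r]"] by auto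
  next
    case 3
    then obtain R1 where R1: "ins R x = (R1, [y])" "R' = r # R1"
      using Cons.prems(2) by (cases "ins R x") auto
    then have IH: "rin (rev R1) y = (rev R, [x])" using Cons 3 by auto
    have "x \<in> set R1" "x < y" using ins_mem[of x R] ins_snd[of R x] R1 by auto
    then have "\<exists>a\<in>set (rev R1). a \<le> y" by (intro bexI[of _ x]) auto
    then show ?thesis using rin_append_le[of "rev R1" y "[r]"] IH R1 by simp
  qed
qed simp

lemma insw_red: "srt R \<Longrightarrow> red (R @ w @ v) \<Longrightarrow> red (fst (insw R w) @ v)"
  using insw_ckeq[of R w] ck_red[OF ck_app[OF insw_ckeq ck_refl], of R w v] red_appendD1[of "R @ w" v]
    red_appendD2[of "snd (insw R w)" "fst (insw R w) @ v"] by simp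

text \<open>The length condition says that every letter of \<open>w\<close> bumps. No insertion then
  ends by appending, and all of them can be undone, the last one first.\<close>

lemma rinw_insw:
  "srt R \<Longrightarrow> red (R @ w) \<Longrightarrow> insw R w = (A, B) \<Longrightarrow> length B = length w \<Longrightarrow>
    rinw (rev A) (rev B) = (rev R, rev w)"
proof (induction w arbitrary: A B rule: rev_induct)
  case (snoc x w)
  obtain A0 B0 where 0: "insw R w = (A0, B0)" by fastforce
  obtain A1 o1 where 1: "ins A0 x = (A1, o1)" by fastforce
  have AB: "A = A1" "B = B0 @ o1" using snoc.prems(3) 0 1 by (auto simp: insw_append)
  have "length B0 \<le> length w" "length o1 \<le> 1"
    using insw_length_snd[of R w] ins_snd[of A0 x] 0 1 by auto
  then have l: "length B0 = length w" "length o1 = 1" using snoc.prems(4) AB by auto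
  then obtain y where y: "o1 = [y]" by (auto simp: length_Suc_conv)
  have A0: "srt A0" "red (A0 @ [x])" using insw_srt[of R w] insw_red[of R w "[x]"] snoc.prems 0 by auto
  have "rin (rev A) y = (rev A0, [x])" using rin_ins[OF A0(1)] 1 y AB red_insert_mem[of A0 x "[]"] A0 by simp
  moreover have "rinw (rev A0) (rev B0) = (rev R, rev w)"
    using snoc.IH[OF _ _ 0 l(1)] snoc.prems red_appendD1[of "R @ w" "[x]"] by simp
  ultimately show ?case using AB y by simp
qed simp

text \<open>The letter released is the largest entry below \<open>y\<close>. If \<open>y\<close>
  itself occurs in \<open>S\<close>, that entry must be \<open>y - 1\<close>, since otherwise it
  commutes with \<open>y\<close> and two equal letters meet.\<close>

lemma reverse_ins:
  "srt S \<Longrightarrow> red (y # S) \<Longrightarrow> S \<noteq> [] \<Longrightarrow> hd S < y \<Longrightarrow>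
    \<exists>R x. ins R x = (S, [y]) \<and> srt R \<and> ckeq (R @ [x]) (y # S) \<and> x \<in> set S \<and> set R \<subseteq> insert y (set S)"
proof (induction S)
  case (Cons h H)
  show ?case
  proof (cases "H \<noteq> [] \<and> hd H < y")
    case True
    then obtain h2 H2 where H: "H = h2 # H2" by (cases H) auto
    have ck: "ckeq (y # h # H) (h # y # H)" 
      unfolding H using Cons.prems True H by (intro ck_sym[OF ck2]) auto
    then have "red (y # H)" using Cons.prems ck_red red_ConsD by blast
    then obtain R x where R: "ins R x = (H, [y])" "srt R" "ckeq (R @ [x]) (y # H)" "x \<in> set H" "set R \<subseteq> insert y (set H)"
      using Cons.IH Cons.prems True by auto
    have "ckeq ((h # R) @ [x]) (y # h # H)" using ck_trans[OF ck_Cons[OF R(3)] ck_sym[OF ck]] by simp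
    moreover have "h < x" "\<forall>r\<in>set R. h < r" using R Cons.prems by auto
    ultimately show ?thesis using R by (intro exI[of _ "h # R"] exI[of _ x]) auto
  next
    case F: False
    show ?thesis
    proof (cases "H \<noteq> [] \<and> hd H = y")
      case True
      then obtain H2 where H: "H = y # H2" by (cases H) auto
      have "y = Suc h"
      proof (rule ccontr)
        assume "y \<noteq> Suc h"
        then have "red (h # y # y # H2)" using Cons.prems H red_comm[of y h "y # H2"] by simp
        then show False using not_red_square[of y H2] red_ConsD by blast
      qed
      moreover have "ckeq (h # Suc h # H2 @ [h]) (h # Suc h # h # H2)"
        using Cons.prems H calculation by (intro ck_Cons ck_sym[OF ck_move]) auto
      then have "ckeq ((h # H) @ [h]) (y # h # H)"
        using ck_trans[OF _ ck3[of h H2]] H calculation by simp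
      ultimately show ?thesis using Cons.prems by (intro exI[of _ "h # H"] exI[of _ h]) auto
    next
      case False
      then have gt: "\<forall>a\<in>set H. y < a" using F Cons.prems by (cases H) auto
      then have "ckeq (y # H @ [h]) (y # h # H)"
        using Cons.prems by (intro ck_sym[OF ck_move]) auto
      then show ?thesis using Cons.prems gt by (intro exI[of _ "y # H"] exI[of _ h]) auto
    qed
  qed
qed simp

lemma below_reverse_ins:
  "below S (t @ [y]) \<Longrightarrow> srt (t @ [y]) \<Longrightarrow> srt R \<Longrightarrow> ins R x = (S, [y]) \<Longrightarrow> below R t"
proof (induction t arbitrary: R S)
  case (Cons a t)
  obtain h H where S: "S = h # H" using Cons.prems by (cases S) auto
  have dH: "below H (t @ [y])" "h < a" using Cons.prems S by auto
  then have hH: "H \<noteq> []" "hd H < y" using below_hd[OF dH(1)] Cons.prems by (cases t; auto)+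
  obtain r R0 where R: "R = r # R0" using Cons.prems(4) by (cases R) auto
  consider "x < r" | "x = r" | "r < x" by linarith
  then show ?case
  proof cases
    case 1 then show ?thesis using Cons.prems R S hH by (cases R0) auto
  next
    case 2 then show ?thesis using Cons.prems R S hH by (cases R0) auto
  next
    case 3
    then have "ins R0 x = (H, [y])" "h = r" using Cons.prems R S by (cases "ins R0 x"; auto)+
    then show ?thesis using Cons.IH[OF dH(1)] Cons.prems R dH by auto
  qed
qed simp

text \<open>The letters of \<open>t\<close> are pushed back from right to left. The released word is
  increasing: two released letters cannot be equal in a reduced word, and in the wrong order they
  would contradict \<open>insw_two_gt\<close>.\<close>

lemma reverse_insw:
  "srt t \<Longrightarrow> srt S \<Longrightarrow> below S t \<Longrightarrow> red (t @ S) \<Longrightarrow>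
    \<exists>R w. insw R w = (S, t) \<and> srt R \<and> srt w \<and> length w = length t \<and> ckeq (R @ w) (t @ S) \<and>
      set R \<union> set w \<subseteq> set t \<union> set S"
proof (induction t arbitrary: S rule: rev_induct)
  case Nil
  then show ?case by (intro exI[of _ S] exI[of _ "[]"]) auto
next
  case (snoc y t)
  have "S \<noteq> []" "hd S < y"
    using below_hd[OF snoc.prems(3)] snoc.prems(1) by (cases t; auto simp: sorted_wrt_append)+
  moreover have "red (y # S)" using snoc.prems(4) red_appendD2[of t "y # S"] by simp
  ultimately obtain R x where R: "ins R x = (S, [y])" "srt R" "ckeq (R @ [x]) (y # S)" "x \<in> set S" "set R \<subseteq> insert y (set S)"
    using reverse_ins snoc.prems(2) by blast
  have ck: "ckeq (t @ R @ [x]) (t @ y # S)" using ck_app[OF ck_refl R(3)] by simp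
  then have redtR: "red (t @ R)" using snoc.prems(4) ck_red red_appendD1[of "t @ R" "[x]"] by simp
  obtain R2 w where IH: "insw R2 w = (R, t)" "srt R2" "srt w" "length w = length t" "ckeq (R2 @ w) (t @ R)"
    "set R2 \<union> set w \<subseteq> set t \<union> set R"
    using snoc.IH[of R] R below_reverse_ins[OF snoc.prems(3,1) R(2,1)] snoc.prems(1) redtR by (auto simp: sorted_wrt_append)
  have ck2: "ckeq (R2 @ w @ [x]) (t @ y # S)" using ck_trans[OF ck_app[OF IH(5) ck_refl, of "[x]"]] ck by simp
  have "srt (w @ [x])"
  proof (cases w rule: rev_cases)
    case (snoc w1 x0)
    obtain R3 o1 where 1: "insw R2 w1 = (R3, o1)" by fastforce
    obtain R4 o2 where 2: "ins R3 x0 = (R4, o2)" by fastforce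
    have e: "R4 = R" "o1 @ o2 = t" using IH(1) snoc 1 2 by (auto simp: insw_append)
    have "length o1 \<le> length w1" using insw_length_snd[of R2 w1] 1 by simp
    then have "o2 \<noteq> []" using e IH(4) snoc by auto
    then obtain y0 where y0: "o2 = [y0]" using ins_snd[of R3 x0] 2 by auto
    have "y0 < y" using snoc.prems(1) e y0 \<open>srt (t @ [y])\<close> by (auto simp: sorted_wrt_append)
    have "srt R3" using insw_srt[OF IH(2), of w1] 1 by simp
    have "x0 < x"
    proof (rule ccontr)
      assume "\<not> x0 < x"
      moreover have "x0 \<noteq> x"
      proof
        assume "x0 = x"
        then have "red (R2 @ w1 @ [x, x])" using ck_red[OF ck2] \<open>red ((t @ [y]) @ S)\<close> snoc by simp
        then show False using red_appendD2[of "R2 @ w1" "[x, x]"] not_red_square[of x "[]"] by simp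
      qed
      ultimately have "x < x0" by simp
      then show False using insw_two_gt[OF \<open>srt R3\<close> _ 2, of x S "[y]"] R(1) e y0 \<open>y0 < y\<close> ins_snd[of R3 x0] 2 by auto
    qed
    then show ?thesis using IH(3) snoc by (auto simp: sorted_wrt_append)
  qed simp
  then show ?case using IH R ck2 by (intro exI[of _ R2] exI[of _ "w @ [x]"]) (auto simp: insw_append)
qed

section \<open>Extremal arrays\<close>

definition sq :: "nat list list \<Rightarrow> nat" where "sq T = (\<Sum>R\<leftarrow>T. (length R)\<^sup>2)"
definition cn :: "nat \<Rightarrow> nat list list \<Rightarrow> nat" where "cn c T = length (filter (\<lambda>R. c < length R) T)"

lemma sq_simps [simp]: "sq [] = 0" "sq (R # T) = (length R)\<^sup>2 + sq T" "sq (T @ U) = sq T + sq U"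
  by (simp_all add: sq_def)

lemma cn_simps [simp]: "cn c [] = 0" "cn c (R # T) = (if c < length R then 1 else 0) + cn c T" "cn c (T @ U) = cn c T + cn c U"
  by (simp_all add: cn_def)

lemma square_sum_le:
  fixes a b p q :: nat
  assumes "a + b = p + q" "p \<le> a" "q \<le> a"
  shows "p\<^sup>2 + q\<^sup>2 \<le> a\<^sup>2 + b\<^sup>2" "p\<^sup>2 + q\<^sup>2 = a\<^sup>2 + b\<^sup>2 \<Longrightarrow> a = p \<and> b = q \<or> a = q \<and> b = p"
proof -
  obtain d where a: "a = p + d" using assms le_Suc_ex by blast
  then have q: "q = b + d" "b \<le> p" using assms by auto
  then obtain k where k: "p = b + k" using le_Suc_ex by blast
  have e: "a\<^sup>2 + b\<^sup>2 = p\<^sup>2 + q\<^sup>2 + 2 * k * d" unfolding a q k by (simp add: power2_eq_square algebra_simps)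
  show "p\<^sup>2 + q\<^sup>2 \<le> a\<^sup>2 + b\<^sup>2" using e by simp
  show "a = p \<and> b = q \<or> a = q \<and> b = p" if "p\<^sup>2 + q\<^sup>2 = a\<^sup>2 + b\<^sup>2" using e that a q k by auto
qed

lemma tinsw_Nil: "srt w \<Longrightarrow> tinsw [] w = (if w = [] then [] else [w])"
  using tinsw_under[of w "[]"] by simp

text \<open>At each row the longer of the two lengths can only grow at the expense of the shorter
  one, which raises the sum of squares unless the two lengths are merely permuted. The word handed
  on is again increasing, so the argument repeats.\<close>

lemma sq_tinsw:
  "rows_ok Q \<Longrightarrow> srt w \<Longrightarrow> sq Q + (length w)\<^sup>2 \<le> sq (tinsw Q w) \<and>
    (sq Q + (length w)\<^sup>2 = sq (tinsw Q w) \<longrightarrow> (\<forall>c. cn c (tinsw Q w) = cn c Q + (if c < length w then 1 else 0)))"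
proof (induction Q arbitrary: w)
  case Nil then show ?case by (simp add: tinsw_Nil)
next
  case (Cons R Q)
  obtain A B where AB: "insw R w = (A, B)" by fastforce
  have B: "srt B" using insw_out[OF _ _ AB] Cons.prems by simp
  note l = insw_length[OF Cons.prems(2) AB]
  note s = square_sum_le[of "length A" "length B" "length R" "length w"]
  have IH: "sq Q + (length B)\<^sup>2 \<le> sq (tinsw Q B)"
    "sq Q + (length B)\<^sup>2 = sq (tinsw Q B) \<Longrightarrow> cn c (tinsw Q B) = cn c Q + (if c < length B then 1 else 0)" for c
    using Cons.IH[OF _ B] Cons.prems by auto
  have e: "tinsw (R # Q) w = A # tinsw Q B" using AB by (simp add: tinsw_Cons_row)
  show ?case
  proof (intro conjI impI allI)
    show "sq (R # Q) + (length w)\<^sup>2 \<le> sq (tinsw (R # Q) w)" using e l s(1) IH(1) by simp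
    fix c assume eq: "sq (R # Q) + (length w)\<^sup>2 = sq (tinsw (R # Q) w)"
    then have "(length R)\<^sup>2 + (length w)\<^sup>2 = (length A)\<^sup>2 + (length B)\<^sup>2" "sq Q + (length B)\<^sup>2 = sq (tinsw Q B)"
      using e l s(1) IH(1) by auto
    then show "cn c (tinsw (R # Q) w) = cn c (R # Q) + (if c < length w then 1 else 0)"
      using e l s(2) IH(2)[of c] by auto
  qed
qed

lemma eg_Cons: "eg (rrw (R # T)) = tinsw (eg (rrw T)) R" by (simp add: eg_append)

lemma sq_eg:
  "rows_ok T \<Longrightarrow> sq T \<le> sq (eg (rrw T)) \<and> (sq T = sq (eg (rrw T)) \<longrightarrow> (\<forall>c. cn c (eg (rrw T)) = cn c T))"
proof (induction T)
  case Nil then show ?case by (simp add: eg_def)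
next
  case (Cons R T)
  then show ?case using sq_tinsw[OF eg_ok, of R "rrw T"] unfolding eg_Cons by auto
qed

definition extremal :: "nat list list \<Rightarrow> bool" where
  "extremal T \<longleftrightarrow> rows_ok T \<and> red (rrw T) \<and> sq T = sq (eg (rrw T))"

lemma extremal_cn: "extremal T \<Longrightarrow> cn c (eg (rrw T)) = cn c T"
  using sq_eg by (simp add: extremal_def)

text \<open>No row insertion lowers \<open>sq\<close> relative to the array read so far, so equality
  at the end forces equality at every stage.\<close>

lemma extremal_append: "extremal (L @ U) \<Longrightarrow> extremal U"
proof (induction L)
  case (Cons R L)
  have "rows_ok (L @ U)" "srt R" "red (rrw (L @ U))"
    using Cons.prems red_appendD1[of "rrw (L @ U)" R] unfolding extremal_def by auto
  moreover have "sq (L @ U) = sq (eg (rrw (L @ U)))"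
    using Cons.prems sq_eg[OF \<open>rows_ok (L @ U)\<close>] sq_tinsw[OF eg_ok \<open>srt R\<close>, of "rrw (L @ U)"]
    unfolding extremal_def append_Cons eg_Cons by auto
  ultimately show ?case using Cons.IH by (simp add: extremal_def)
qed simp

lemma extremal_ckeq:
  "extremal T \<Longrightarrow> ckeq (rrw T) (rrw T') \<Longrightarrow> rows_ok T' \<Longrightarrow> sq T' = sq T \<Longrightarrow> extremal T'"
  using eg_ckeq_eq ck_red by (auto simp: extremal_def)

text \<open>\<open>sq\<close> is already at the maximum of its class, so the insertion cannot spread
  the two lengths; it only puts the longer one at the bottom.\<close>

lemma extremal_pair:
  assumes "extremal (L @ [s, t] @ U)" "insw t s = (A, B)"
  shows "ckeq (rrw (L @ [s, t] @ U)) (rrw (L @ [A, B] @ U))" "extremal (L @ [A, B] @ U)"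
    "length A = max (length s) (length t)" "length B = min (length s) (length t)"
    "srt A" "srt B"
proof -
  have ok: "rows_ok (L @ [s, t] @ U)" "red (rrw (L @ [s, t] @ U))" "srt s" "srt t"
    using assms(1) by (auto simp: extremal_def)
  have "red (t @ s)" using ok(2) red_middle[of "rrw U" "t @ s" "rrw L"] by simp
  then have "ckeq (t @ s) (B @ A)" using insw_ckeq[of t s] ok assms(2) by simp
  then show ck: "ckeq (rrw (L @ [s, t] @ U)) (rrw (L @ [A, B] @ U))"
    using ck_ctx[of "t @ s" "B @ A" "rrw U" "rrw L"] by simp
  show sAB: "srt A" "srt B" using insw_srt[of t s] insw_out[OF ok(3,4) assms(2)] ok assms(2) by auto
  have ok': "rows_ok (L @ [A, B] @ U)" using ok sAB by simp
  note l = insw_length[OF ok(3) assms(2)]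
  have "sq (L @ [A, B] @ U) \<le> sq (L @ [s, t] @ U)"
    using sq_eg[OF ok'] eg_ckeq_eq[OF ck ok(2)] assms(1) by (simp add: extremal_def)
  then have e: "(length t)\<^sup>2 + (length s)\<^sup>2 = (length A)\<^sup>2 + (length B)\<^sup>2"
    using square_sum_le(1)[of "length A" "length B" "length t" "length s"] l by simp
  then have "length A = length t \<and> length B = length s \<or> length A = length s \<and> length B = length t"
    using square_sum_le(2)[of "length A" "length B" "length t" "length s"] l by simp
  then show "length A = max (length s) (length t)" "length B = min (length s) (length t)" using l by auto
  show "extremal (L @ [A, B] @ U)"
    using extremal_ckeq[OF assms(1) ck ok'] e by simp
qed

lemma extremal_pair_below:
  assumes "extremal (L @ [s, t] @ U)" "length t \<le> length s"
  shows "below s t"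
proof -
  have ok: "srt s" "srt t" "red (rrw (L @ [s, t] @ U))" using assms(1) by (auto simp: extremal_def)
  have "red (t @ s)" using ok(3) red_middle[of "rrw U" "t @ s" "rrw L"] by simp
  moreover obtain A B where AB: "insw t s = (A, B)" by fastforce
  ultimately show ?thesis using insw_no_move[OF ok(2,1) _ AB] extremal_pair(3)[OF assms(1) AB] assms(2) by simp
qed

lemma extremal_swap:
  assumes "extremal (L @ [s, t] @ U)" "length t \<le> length s"
  obtains s' t' where "insw t' s' = (s, t)" "srt s'" "srt t'" "length s' = length t" "length t' = length s"
    "set s' \<union> set t' \<subseteq> set s \<union> set t" "red (t' @ s')"
    "ckeq (rrw (L @ [s, t] @ U)) (rrw (L @ [s', t'] @ U))" "extremal (L @ [s', t'] @ U)"
proof -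
  have ok: "srt s" "srt t" "red (rrw (L @ [s, t] @ U))" "rows_ok (L @ [s, t] @ U)"
    using assms(1) by (auto simp: extremal_def)
  have red: "red (t @ s)" using ok(3) red_middle[of "rrw U" "t @ s" "rrw L"] by simp
  obtain t' s' where r: "insw t' s' = (s, t)" "srt t'" "srt s'" "length s' = length t" "ckeq (t' @ s') (t @ s)"
    "set t' \<union> set s' \<subseteq> set t \<union> set s"
    using reverse_insw[OF ok(2,1) extremal_pair_below[OF assms] red] by blast
  have l: "length t' = length s" using insw_length[OF r(3,1)] r(4) by simp
  have ck: "ckeq (rrw (L @ [s, t] @ U)) (rrw (L @ [s', t'] @ U))"
    using ck_ctx[OF ck_sym[OF r(5)], of "rrw U" "rrw L"] by simp
  moreover have "extremal (L @ [s', t'] @ U)"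
    using extremal_ckeq[OF assms(1) ck] ok r l by simp
  moreover have "red (t' @ s')" using ck_red[OF r(5)] red by simp
  ultimately show ?thesis using that r l by blast
qed

section \<open>Arrays with a given tableau\<close>

text \<open>
  In the class of \<open>P\<close> the sum \<open>sq\<close> of the squared row lengths is largest if and only if the
  lengths are a permutation of those of \<open>P\<close>.
\<close>

definition arr :: "nat list list \<Rightarrow> nat list list \<Rightarrow> bool" where
  "arr P T \<longleftrightarrow> rows_ok T \<and> ckeq (rrw P) (rrw T) \<and> sq T = sq P \<and> (\<forall>R\<in>set T. R \<noteq> []) \<and> srt (heads T)"

definition redtab :: "nat list list \<Rightarrow> bool" where "redtab P \<longleftrightarrow> tab P \<and> red (rrw P)"

lemma arr_eg: "redtab P \<Longrightarrow> arr P T \<Longrightarrow> eg (rrw T) = P"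
  using eg_ckeq_eq[of "rrw P" "rrw T"] eg_rrw by (simp add: redtab_def arr_def)

lemma arr_extremal: "redtab P \<Longrightarrow> arr P T \<Longrightarrow> extremal T"
  using arr_eg ck_red by (auto simp: extremal_def arr_def redtab_def)

lemma arr_self: "redtab P \<Longrightarrow> arr P P"
  using tab_ok tab_nonempty srt_heads by (auto simp: arr_def redtab_def)

lemma cn_0: "\<forall>R\<in>set T. R \<noteq> [] \<Longrightarrow> cn 0 T = length T"
  by (simp add: cn_def filter_id_conv)

lemma arr_cn: "redtab P \<Longrightarrow> arr P T \<Longrightarrow> cn c T = cn c P"
  using arr_extremal extremal_cn arr_eg by metis

lemma arr_length: "redtab P \<Longrightarrow> arr P T \<Longrightarrow> length T = length P"
  using arr_cn[of P T 0] cn_0[of T] cn_0[of P] tab_nonempty[of P] by (auto simp: arr_def redtab_def)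

text \<open>As \<open>hd s < hd t\<close>, the first letter of \<open>s\<close> bumps the first
  letter of \<open>t\<close>. Hence the first column survives while the two lengths are
  exchanged.\<close>

lemma arr_drop:
  assumes P: "redtab P" and T: "arr P (L @ [s, t] @ U)" and lt: "length s < length t" and AB: "insw t s = (A, B)"
  shows "arr P (L @ [A, B] @ U)" "length A = length t" "length B = length s" "hd A = hd s" "hd B = hd t"
proof -
  have e: "extremal (L @ [s, t] @ U)" using arr_extremal[OF P T] .
  note p = extremal_pair[OF e AB]
  show l: "length A = length t" "length B = length s" using p(3,4) lt by auto
  have st: "s \<noteq> []" "t \<noteq> []" "hd s < hd t" "srt s" "srt t" using T by (auto simp: arr_def sorted_wrt_append)
  note h = insw_hd[OF st(4,1,2,3) AB]
  show "hd A = hd s" "hd B = hd t" using h by auto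
  then show "arr P (L @ [A, B] @ U)"
    using T p h l ck_trans[OF _ p(1)] by (auto simp: arr_def extremal_def)
qed

text \<open>Total height of the letters, the termination measure for drops.\<close>

definition wt :: "nat list list \<Rightarrow> nat" where "wt T = (\<Sum>i<length T. i * length (T ! i))"

lemma wt_Cons: "wt (R # T) = length (concat T) + wt T"
proof -
  have "wt (R # T) = (\<Sum>i<length T. Suc i * length (T ! i))"
    unfolding wt_def by (simp add: sum.lessThan_Suc_shift del: sum.lessThan_Suc)
  also have "\<dots> = (\<Sum>i<length T. length (T ! i)) + wt T" unfolding wt_def by (simp add: sum.distrib)
  also have "(\<Sum>i<length T. length (T ! i)) = length (concat T)"
    by (simp add: length_concat sum_list_sum_nth atLeast0LessThan)
  finally show ?thesis .
qed

lemma wt_swap: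
  assumes "length A + length B = length s + length t" "length B < length t"
  shows "wt (L @ [A, B] @ U) < wt (L @ [s, t] @ U)"
proof -
  have c: "length (concat (L @ [A, B] @ U)) = length (concat (L @ [s, t] @ U))" for L
    using assms by simp
  show ?thesis
  proof (induction L)
    case Nil then show ?case using assms by (simp add: wt_Cons)
  next
    case (Cons R L)
    then show ?case using c[of L] by (simp only: append_Cons wt_Cons)
  qed
qed

lemma adjacent_or_tab:
  assumes "\<forall>R\<in>set T. R \<noteq> [] \<and> srt R" "\<not> tab T"
  obtains L s t U where "T = L @ [s, t] @ U" "\<not> below s t"
proof -
  have "\<exists>L s t U. T = L @ [s, t] @ U \<and> \<not> below s t" using assms
  proof (induction T)
    case (Cons R T)
    show ?case
    proof (cases "tab T")
      case True
      then obtain S T' where T: "T = S # T'" "\<not> below R S" using Cons.prems by (cases T) auto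
      then show ?thesis
        by (metis append_Cons append_Nil)
    next
      case False
      then obtain L s t U where "T = L @ [s, t] @ U \<and> \<not> below s t" using Cons by auto
      then show ?thesis by (metis append_Cons)
    qed
  qed simp
  then show ?thesis using that by blast
qed

lemma arr_sorted_eq:
  assumes P: "redtab P" and T: "arr P T" and s: "\<And>L s t U. T = L @ [s, t] @ U \<Longrightarrow> length t \<le> length s"
  shows "T = P"
proof -
  have "tab T"
  proof (rule ccontr)
    assume "\<not> tab T"
    moreover have "\<forall>R\<in>set T. R \<noteq> [] \<and> srt R" using T by (auto simp: arr_def rows_ok_def)
    ultimately obtain L s' t U where e: "T = L @ [s', t] @ U" "\<not> below s' t"
      using adjacent_or_tab by blast
    then show False using extremal_pair_below[of L s' t U] arr_extremal[OF P T] s[OF e(1)] by simp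
  qed
  then show ?thesis using eg_rrw[of T] arr_eg[OF P T] by simp
qed

text \<open>If some row is shorter than the next one, dropping there in both arrays gives arrays
  with equal lengths and smaller \<open>wt\<close>; these agree by induction, and reverse insertion
  recovers the original rows. Without such a pair both arrays are \<open>P\<close>.\<close>

lemma arr_unique:
  "redtab P \<Longrightarrow> arr P T \<Longrightarrow> arr P T2 \<Longrightarrow> map length T = map length T2 \<Longrightarrow> T = T2"
proof (induction "wt T" arbitrary: T T2 rule: less_induct)
  case less
  note P = less.prems(1)
  show ?case
  proof (cases "\<exists>L s t U. T = L @ [s, t] @ U \<and> length s < length t")
    case False
    have "T = P" by (rule arr_sorted_eq[OF P less.prems(2)]) (use False not_less in blast)
    moreover have "T2 = P"
    proof (rule arr_sorted_eq[OF P less.prems(3)])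
      fix L s t U assume T2: "T2 = L @ [s, t] @ U"
      let ?n = "length L"
      have "length T = length T2" using less.prems(4) by (metis length_map)
      then have "T = take ?n T @ [T ! ?n, T ! Suc ?n] @ drop (Suc (Suc ?n)) T"
        using T2 by (simp add: id_take_nth_drop Cons_nth_drop_Suc)
      then have "length (T ! Suc ?n) \<le> length (T ! ?n)" using False not_less by blast
      moreover have "length (T ! i) = length (T2 ! i)" if "i < length T2" for i
        using less.prems(4) that by (metis length_map nth_map)
      ultimately show "length t \<le> length s" using T2 by (simp add: nth_append)
    qed
    ultimately show ?thesis by simp
  next
    case True
    then obtain L s t U where T: "T = L @ [s, t] @ U" and lt: "length s < length t" by blast
    have "map length T2 = map length L @ [length s, length t] @ map length U" using less.prems(4) T by simp
    then obtain L2 s2 t2 U2 where T2: "T2 = L2 @ [s2, t2] @ U2" "map length L2 = map length L"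
      "length s2 = length s" "length t2 = length t" "map length U2 = map length U"
      by (auto simp: map_eq_append_conv map_eq_Cons_conv)
    obtain A B where AB: "insw t s = (A, B)" by fastforce
    obtain A2 B2 where AB2: "insw t2 s2 = (A2, B2)" by fastforce
    note d = arr_drop[OF P less.prems(2)[unfolded T] lt AB]
    have lt2: "length s2 < length t2" using lt T2 by simp
    note d2 = arr_drop[OF P less.prems(3)[unfolded T2] lt2 AB2]
    have "wt (L @ [A, B] @ U) < wt T" unfolding T by (rule wt_swap) (use d lt in auto)
    then have e: "L @ [A, B] @ U = L2 @ [A2, B2] @ U2"
      using less.hyps[of "L @ [A, B] @ U" "L2 @ [A2, B2] @ U2"] P d d2 T2 by simp
    moreover have "length L = length L2" using T2(2) by (metis length_map)
    ultimately have e: "L = L2" "A = A2" "B = B2" "U = U2" by auto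
    have ok: "srt t" "srt t2" "red (t @ s)" "red (t2 @ s2)"
      using arr_extremal[OF P less.prems(2)] arr_extremal[OF P less.prems(3)] T T2
        red_middle[of "rrw U" "t @ s" "rrw L"] red_middle[of "rrw U2" "t2 @ s2" "rrw L2"]
      by (auto simp: extremal_def)
    have "(rev t, rev s) = (rev t2, rev s2)"
      using rinw_insw[OF ok(1,3) AB] rinw_insw[OF ok(2,4) AB2] d(3) d2(3) e by simp
    then show ?thesis using e T T2 by simp
  qed
qed

section \<open>The key bounds the row lengths\<close>

lemma ck_set: "ckeq t t' \<Longrightarrow> set t = set t'"
  by (induction rule: ckeq.induct) (auto elim!: kb.cases)

lemma tins_letters: "\<forall>x\<in>set (rrw P). v < x \<Longrightarrow> v < x0 \<Longrightarrow> \<forall>x\<in>set (rrw (tins P x0)). v < x"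
proof (induction P arbitrary: x0)
  case (Cons R P)
  have R: "\<forall>x\<in>set (fst (ins R x0)). v < x" using ins_fst_set[of R x0] Cons.prems by auto
  show ?case
  proof (cases R x0 rule: ins_cases)
    case (app R') then show ?thesis using R Cons.prems by auto
  next
    case (bump R' y)
    then have "v < y" using Cons.prems(2) by simp
    then have "\<forall>x\<in>set (rrw (tins P y)). v < x"
      by (rule Cons.IH[rotated]) (use Cons.prems(1) in simp)
    moreover have "set (rrw (tins (R # P) x0)) = set (rrw (tins P y)) \<union> set R'" using bump by simp
    moreover have "\<forall>x\<in>set R'. v < x" using R bump by simp
    ultimately show ?thesis by blast
  qed
qed simp

lemma eg_positive: "0 \<notin> set w \<Longrightarrow> 0 \<notin> set (rrw (eg w))"
proof (induction w rule: rev_induct)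
  case (snoc x w)
  then have "\<forall>y\<in>set (rrw (eg w)). 0 < y" "0 < x" by (auto intro!: gr0I)
  then have "\<forall>y\<in>set (rrw (tins (eg w) x)). 0 < y" by (rule tins_letters)
  then show ?case by (auto simp: eg_append)
qed (simp add: eg_def)

lemma redtab_eg: "red w \<Longrightarrow> redtab (eg w)"
  using eg_ckeq ck_red tab_eg by (auto simp: redtab_def)

text \<open>The head of the next row is smaller than the whole first column, so it enters at the
  corner. First columns only grow under insertion, and an extremal array has as many rows as its
  tableau, which leaves no room for further elements.\<close>

lemma heads_eg:
  "extremal U \<Longrightarrow> \<forall>R\<in>set U. R \<noteq> [] \<Longrightarrow> srt (heads U) \<Longrightarrow> 0 \<notin> set (rrw U) \<Longrightarrow>
    set (heads (eg (rrw U))) = set (heads U)"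
proof (induction U)
  case Nil then show ?case by (simp add: eg_def)
next
  case (Cons R U)
  have eU: "extremal U" using extremal_append[of "[R]" U] Cons.prems by simp
  define Q where "Q = eg (rrw U)"
  have IH: "set (heads Q) = set (heads U)" using Cons eU by (simp add: Q_def)
  have tQ: "tab Q" by (simp add: Q_def tab_eg)
  obtain r R0 where R: "R = r # R0" using Cons.prems by (cases R) auto
  have redR: "red (rrw U @ r # R0)" using Cons.prems(1) R by (simp add: extremal_def)
  then have redQ: "red (rrw Q @ r # R0)"
    unfolding Q_def using ck_red[OF ck_app[OF eg_ckeq ck_refl]] red_appendD1 by blast
  then have redQr: "red (rrw Q @ [r])" using red_appendD1[of "rrw Q @ [r]" R0] by simp
  have red0: "red (rrw (tins Q r) @ R0)"
    using ck_red[OF ck_app[OF tins_ckeq[OF tab_ok[OF tQ] redQr] ck_refl], of R0] redQ by simp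
  have "r < hd q" if "Q = q # Q'" for q Q'
  proof -
    have "hd q \<in> set (heads U)" using IH that by auto
    then show ?thesis using Cons.prems(3) R by auto
  qed
  then have "hd (hd (tins Q r)) = r"
    using tab_nonempty[OF tQ] by (cases Q; cases "hd Q") (fastforce split: prod.splits list.splits)+
  then have "r \<in> K 0 (tins Q r)" using hd_tins(2)[of Q r] by (cases "tins Q r") auto
  moreover have "K 0 (tins Q r) \<subseteq> K 0 (tinsw (tins Q r) R0)"
    by (rule tinsw_K_mono[OF tab_tins[OF tQ] red0]) (use Cons.prems(4) R in simp)
  moreover have "K 0 Q \<subseteq> K 0 (tins Q r)" by (rule tins_K_mono[OF tQ redQr]) (use Cons.prems(4) R in auto)
  moreover have fin: "eg (rrw (R # U)) = tinsw (tins Q r) R0" unfolding eg_Cons R Q_def by simp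
  moreover have "set (heads (R # U)) = insert r (K 0 Q)" using IH R by simp
  ultimately have "set (heads (R # U)) \<subseteq> K 0 (eg (rrw (R # U)))" by (metis insert_subsetI subset_iff)
  then have sub: "set (heads (R # U)) \<subseteq> set (heads (eg (rrw (R # U))))" by simp
  have d: "distinct (heads (R # U))" using Cons.prems(3) strict_sorted_iff by blast
  have "length (eg (rrw (R # U))) = length (R # U)"
    using extremal_cn[OF Cons.prems(1), of 0] cn_0[OF Cons.prems(2)] cn_0 tab_nonempty[OF tab_eg[of "rrw (R # U)"]] by auto
  then have "card (set (heads (eg (rrw (R # U))))) \<le> card (set (heads (R # U)))"
    using card_length[of "heads (eg (rrw (R # U)))"] distinct_card[OF d] by simp
  then show ?case using card_seteq[OF _ sub] by simp
qed

text \<open>The rows \<open>U\<close> alone give a tableau \<open>Q\<close>. Its key columns only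
  grow when the rows of \<open>L\<close> are inserted, they lie in the first column, that is, in the
  heads of \<open>U\<close>, and their sizes are the numbers \<open>cn c U\<close>.\<close>

lemma arr_bound:
  assumes P: "redtab P" "0 \<notin> set (rrw P)" and T: "arr P (L @ U)"
  shows "cn c U \<le> card (K c P \<inter> set (heads U))"
proof -
  define Q where "Q = eg (rrw U)"
  have eT: "extremal (L @ U)" using arr_extremal P T by simp
  then have eU: "extremal U" by (rule extremal_append)
  have l: "set (rrw (L @ U)) = set (rrw P)" using T ck_set by (auto simp: arr_def)
  have 0: "0 \<notin> set (rrw U)" "0 \<notin> set (rrw L)" using l P by auto
  have rU: "\<forall>R\<in>set U. R \<noteq> []" "srt (heads U)" using T by (auto simp: arr_def sorted_wrt_append)
  have redQ: "redtab Q" using eU redtab_eg by (simp add: Q_def extremal_def)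
  have "P = tinsw Q (rrw L)" using arr_eg[OF P(1) T] by (simp add: Q_def eg_append)
  moreover have "red (rrw Q @ rrw L)"
    using eT ck_red[OF ck_app[OF eg_ckeq ck_refl], of "rrw U" "rrw L"] eU by (simp add: Q_def extremal_def)
  ultimately have "K c Q \<subseteq> K c P" using tinsw_K_mono[of Q "rrw L"] redQ 0 by (simp add: redtab_def)
  moreover have "K c Q \<subseteq> set (heads U)" using K_subset[of c Q] heads_eg[OF eU rU 0(1)] by (simp add: Q_def)
  ultimately have "card (K c Q) \<le> card (K c P \<inter> set (heads U))" by (intro card_mono) auto
  moreover have "card (K c Q) = cn c U"
    using card_K[of Q c] redQ extremal_cn[OF eU, of c] by (simp add: Q_def redtab_def cn_def)
  ultimately show ?thesis by simp
qed

section \<open>The array with the lengths of the key\<close>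

text \<open>Since \<open>K c P\<close> decreases with \<open>c\<close>, this says that the length of
  a row is the number of key columns that contain its first letter.\<close>

definition canon :: "nat list list \<Rightarrow> nat list list \<Rightarrow> bool" where
  "canon P T \<longleftrightarrow> arr P T \<and> (\<forall>R\<in>set T. \<forall>c. c < length R \<longleftrightarrow> hd R \<in> K c P)"

lemma ck_move_column:
  "\<forall>g\<in>set gs. g < f \<Longrightarrow> sorted_wrt (>) gs \<Longrightarrow> srt R \<Longrightarrow> \<forall>r\<in>set R. f < r \<Longrightarrow> ckeq (f # R @ gs) (f # gs @ R)"
proof (induction gs arbitrary: f)
  case (Cons g gs)
  have "ckeq ((f # R @ [g]) @ gs) ((f # g # R) @ gs)"
    using Cons.prems by (intro ck_app ck_sym[OF ck_move]) (auto intro: less_trans)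
  moreover have "ckeq (f # g # R @ gs) (f # g # gs @ R)"
    using Cons by (intro ck_Cons Cons.IH) (auto intro: less_trans)
  ultimately show ?case using ck_trans by simp
qed simp

lemma ck_column:
  "length fs = length Rs \<Longrightarrow> srt fs \<Longrightarrow> list_all2 (\<lambda>f R. srt R \<and> (\<forall>r\<in>set R. f < r)) fs Rs \<Longrightarrow>
    ckeq (rrw (map2 (#) fs Rs)) (rev fs @ rrw Rs)"
proof (induction fs arbitrary: Rs rule: rev_induct)
  case (snoc f fs)
  then obtain Rs0 R where Rs: "Rs = Rs0 @ [R]" by (cases Rs rule: rev_cases) auto
  have p: "length fs = length Rs0" "srt fs" "list_all2 (\<lambda>f R. srt R \<and> (\<forall>r\<in>set R. f < r)) fs Rs0"
    "srt R" "\<forall>r\<in>set R. f < r" "\<forall>g\<in>set fs. g < f"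
    using snoc.prems Rs by (auto simp: sorted_wrt_append list_all2_append)
  have "ckeq ((f # R) @ rrw (map2 (#) fs Rs0)) ((f # R) @ rev fs @ rrw Rs0)"
    using snoc.IH[OF p(1-3)] by (intro ck_app) auto
  moreover have "sorted_wrt (>) (rev fs)" using p(2) by (simp add: sorted_wrt_rev)
  then have "ckeq ((f # R @ rev fs) @ rrw Rs0) ((f # rev fs @ R) @ rrw Rs0)"
    using p by (intro ck_app ck_move_column) auto
  ultimately show ?case using Rs p(1) ck_trans by simp
qed simp

text \<open>Reading the first column separately stays within the class. This makes it possible to
  rearrange the tails independently and to put the column back afterwards.\<close>

lemma ck_tails: "tab P \<Longrightarrow> ckeq (rrw P) (rev (heads P) @ rrw (tails P))"
proof -
  assume P: "tab P"
  have "list_all2 (\<lambda>f R. srt R \<and> (\<forall>r\<in>set R. f < r)) (heads P) (map tl P)"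
    using tab_ok[OF P] srt_tl srt_hd_less by (auto simp: list_all2_map1 list_all2_map2 rows_ok_def intro!: list_all2_refl[THEN list_all2_mono] list.rel_refl_strong)
  then have "ckeq (rrw (map2 (#) (heads P) (map tl P))) (rev (heads P) @ rrw (map tl P))"
    using srt_heads[OF P] by (intro ck_column) auto
  moreover have "map2 (#) (heads P) (map tl P) = P" using tab_nonempty[OF P] by (induction P) auto
  moreover have "rrw (map tl P) = rrw (tails P)" by (induction P) (auto split: if_splits)
  ultimately show ?thesis by simp
qed

lemma redtab_tails: "redtab P \<Longrightarrow> redtab (tails P)"
  using ck_tails[of P] ck_red red_appendD2 tab_tails by (auto simp: redtab_def)

text \<open>One round of insertion sort by length, in which \<open>extremal_swap\<close> exchanges
  the lengths of neighbouring rows without leaving the class.\<close>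

lemma sort_one:
  "extremal (A @ [X] @ Y @ D) \<Longrightarrow> sorted (map length Y) \<Longrightarrow>
    \<exists>Y'. ckeq (rrw (A @ [X] @ Y @ D)) (rrw (A @ Y' @ D)) \<and> extremal (A @ Y' @ D) \<and> sorted (map length Y') \<and>
      mset (map length Y') = mset (map length (X # Y)) \<and> set (concat Y') \<subseteq> set (concat (X # Y))"
proof (induction Y arbitrary: A X)
  case Nil then show ?case by (intro exI[of _ "[X]"]) auto
next
  case (Cons y Y)
  show ?case
  proof (cases "length X \<le> length y")
    case True then show ?thesis using Cons.prems by (intro exI[of _ "X # y # Y"]) auto
  next
    case False
    obtain s' t' where st: "length s' = length y" "length t' = length X" "set s' \<union> set t' \<subseteq> set X \<union> set y"
      "ckeq (rrw (A @ [X, y] @ Y @ D)) (rrw (A @ [s', t'] @ Y @ D))" "extremal (A @ [s', t'] @ Y @ D)"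
      using extremal_swap[of A X y "Y @ D"] Cons.prems False by (metis append_Cons append_Nil linear)
    obtain Y' where Y': "ckeq (rrw ((A @ [s']) @ [t'] @ Y @ D)) (rrw ((A @ [s']) @ Y' @ D))"
      "extremal ((A @ [s']) @ Y' @ D)" "sorted (map length Y')" "mset (map length Y') = mset (map length (t' # Y))"
      "set (concat Y') \<subseteq> set (concat (t' # Y))"
      using Cons.IH[of "A @ [s']" t'] st Cons.prems by auto
    have "set (map length Y') = set (map length (t' # Y))" using Y'(4) by (metis mset_eq_setD)
    then have "sorted (map length (s' # Y'))" using Y'(3) st False Cons.prems(2) by auto
    then show ?thesis using Y' st ck_trans[OF st(4), of "rrw (A @ [s'] @ Y' @ D)"]
      by (intro exI[of _ "s' # Y'"]) auto
  qed
qed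

lemma sort_pool:
  "extremal (A @ Y @ D) \<Longrightarrow>
    \<exists>Y'. ckeq (rrw (A @ Y @ D)) (rrw (A @ Y' @ D)) \<and> extremal (A @ Y' @ D) \<and> sorted (map length Y') \<and>
      mset (map length Y') = mset (map length Y) \<and> set (concat Y') \<subseteq> set (concat Y)"
proof (induction Y arbitrary: A)
  case Nil then show ?case by (intro exI[of _ "[]"]) auto
next
  case (Cons X Y)
  obtain Y1 where Y1: "ckeq (rrw ((A @ [X]) @ Y @ D)) (rrw ((A @ [X]) @ Y1 @ D))" "extremal ((A @ [X]) @ Y1 @ D)"
    "sorted (map length Y1)" "mset (map length Y1) = mset (map length Y)" "set (concat Y1) \<subseteq> set (concat Y)"
    using Cons.IH[of "A @ [X]"] Cons.prems by auto
  obtain Y2 where Y2: "ckeq (rrw (A @ [X] @ Y1 @ D)) (rrw (A @ Y2 @ D))" "extremal (A @ Y2 @ D)"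
    "sorted (map length Y2)" "mset (map length Y2) = mset (map length (X # Y1))" "set (concat Y2) \<subseteq> set (concat (X # Y1))"
    using sort_one[of A X Y1 D] Y1(2,3) unfolding append_assoc by blast
  have "set (concat Y2) \<subseteq> set (concat (X # Y))"
    using Y1(5) Y2(5) unfolding concat.simps set_append by blast
  moreover have "ckeq (rrw (A @ (X # Y) @ D)) (rrw (A @ Y2 @ D))"
    using ck_trans[OF _ Y2(1)] Y1(1) by simp
  ultimately show ?case using Y1(4) Y2 by (intro exI[of _ Y2]) simp
qed

lemma srt_dropWhile: "srt (heads X) \<Longrightarrow> R \<in> set (dropWhile (\<lambda>R. hd R \<le> f) X) \<Longrightarrow> f < hd R"
  by (induction X) (auto split: if_splits)

lemma cn_mset: "mset (map length Y) = mset (map length Y') \<Longrightarrow> cn c Y = cn c Y'"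
proof -
  have "cn c Y = size (filter_mset (\<lambda>n. c < n) (mset (map length Y)))" for Y
    by (induction Y) auto
  then show "mset (map length Y) = mset (map length Y') \<Longrightarrow> cn c Y = cn c Y'" by metis
qed

lemma cn_pos: "0 < cn c Y \<longleftrightarrow> (\<exists>R\<in>set Y. c < length R)"
  by (induction Y) auto

lemma cn_heads:
  "distinct (heads X) \<Longrightarrow> \<forall>R\<in>set X. c < length R \<longleftrightarrow> hd R \<in> A \<Longrightarrow> cn c X = card (A \<inter> set (heads X))"
proof (induction X)
  case (Cons R X)
  then have "A \<inter> set (heads (R # X)) = (if c < length R then insert (hd R) (A \<inter> set (heads X)) else A \<inter> set (heads X))"
    by auto
  then show ?case using Cons by (auto simp: card_insert_if)
qed simp

text \<open>
  The elements \<open>f\<close> of the column \<open>fs\<close> are served from the largest one on: the pool \<open>Y\<close> contains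
  the rows above \<open>f\<close> not yet used, in increasing order of length, and \<open>f\<close> receives the longest.
\<close>

lemma distribute:
  assumes fin: "\<And>c. finite (Kc c)" and tot: "card (mu F (Kc 0)) = card (Kc 0)"
  shows "extremal (X @ Y @ D) \<Longrightarrow> \<forall>R\<in>set X \<union> set Y. R \<noteq> [] \<Longrightarrow> srt (heads X) \<Longrightarrow> sorted (map length Y) \<Longrightarrow> srt fs \<Longrightarrow>
    \<forall>r\<in>set (concat Y). \<forall>f\<in>set fs. f < r \<Longrightarrow> (fs = [] \<longrightarrow> X = []) \<Longrightarrow> (fs \<noteq> [] \<longrightarrow> (\<forall>R\<in>set X. hd fs < hd R)) \<Longrightarrow>
    \<forall>R\<in>set X. \<forall>c. c < length R \<longleftrightarrow> hd R \<in> Kc c \<Longrightarrow>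
    (\<And>c. cn c Y + card {u \<in> mu F (Kc c). u \<notin> set fs} = card (Kc c - set (heads X))) \<Longrightarrow>
    set fs \<subseteq> F \<Longrightarrow> \<forall>u\<in>F - set fs. \<forall>f\<in>set fs. f < u \<Longrightarrow>
    \<forall>c. \<forall>d\<in>Kc c. d \<in> set (heads X) \<or> (\<forall>f\<in>set fs. f < d) \<Longrightarrow>
    \<exists>Rs. length Rs = length fs \<and> ckeq (rrw (X @ Y @ D)) (rrw (Rs @ D)) \<and> extremal (Rs @ D) \<and>
      list_all2 (\<lambda>f R. (\<forall>r\<in>set R. f < r) \<and> (\<forall>c. c < length R \<longleftrightarrow> f \<in> mu F (Kc c))) fs Rs"
proof (induction fs arbitrary: X Y D rule: rev_induct)
  case Nil
  then have "cn 0 Y = 0" using Nil.prems(10)[of 0] tot by simp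
  then have "Y = []" using cn_0[of Y] Nil.prems(2) by simp
  then show ?case using Nil by (intro exI[of _ "[]"]) simp
next
  case (snoc f fs)
  \<comment> \<open>Rows starting beyond \<open>f\<close> may stand to the right of \<open>f\<close>
    and now join the pool. \<open>X1\<close> keeps the rows still out of reach, and \<open>D\<close>
    holds the rows already handed out.\<close>
  define X1 where "X1 = takeWhile (\<lambda>R. hd R \<le> f) X"
  define X2 where "X2 = dropWhile (\<lambda>R. hd R \<le> f) X"
  have X: "X = X1 @ X2" by (simp add: X1_def X2_def)
  have X1: "hd R \<le> f" if "R \<in> set X1" for R using that set_takeWhileD by (fastforce simp: X1_def)
  have X2: "f < hd R" if "R \<in> set X2" for R using srt_dropWhile[OF snoc.prems(3)] that by (simp add: X2_def)
  have fs: "\<forall>g\<in>set fs. g < f" "srt fs" using snoc.prems(5) by (auto simp: sorted_wrt_append)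
  have ok: "rows_ok (X @ Y @ D)" using snoc.prems(1) by (simp add: extremal_def)
  have X2f: "f < r" if r: "r \<in> set (concat X2)" for r
  proof -
    obtain R where R: "R \<in> set X2" "r \<in> set R" using r by auto
    then have "hd R \<le> r" using ok X by (intro srt_hd_le) (auto simp: rows_ok_def)
    then show ?thesis using X2[OF R(1)] by simp
  qed
  have Yf: "f < r" if "r \<in> set (concat Y)" for r using snoc.prems(6) that by auto
  obtain Y' where Y': "ckeq (rrw (X1 @ (X2 @ Y) @ D)) (rrw (X1 @ Y' @ D))" "extremal (X1 @ Y' @ D)" "sorted (map length Y')"
    "mset (map length Y') = mset (map length (X2 @ Y))" "set (concat Y') \<subseteq> set (concat (X2 @ Y))"
    using sort_pool[of X1 "X2 @ Y" D] snoc.prems(1) X by auto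
  have Y'f: "\<forall>r\<in>set (concat Y'). f < r"
  proof
    fix r assume "r \<in> set (concat Y')"
    then have "r \<in> set (concat X2) \<union> set (concat Y)" using Y'(5) by auto
    then show "f < r" using X2f Yf by blast
  qed
  have cnY': "cn c Y' = cn c X2 + cn c Y" for c using cn_mset[OF Y'(4)] by simp
  have Y'ne: "\<forall>R\<in>set Y'. R \<noteq> []"
  proof -
    have "cn 0 Y' = length Y'" using cnY'[of 0] cn_0[of X2] cn_0[of Y] snoc.prems(2) X mset_eq_length[OF Y'(4)] by auto
    moreover have "length (filter (\<lambda>R. 0 < length R) Y') = length Y' \<longleftrightarrow> (\<forall>R\<in>set Y'. R \<noteq> [])"
      using length_filter_less by (metis filter_id_conv length_greater_0_conv order_less_irrefl)
    ultimately show ?thesis by (simp add: cn_def)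
  qed
  have dX: "distinct (heads X2)" using snoc.prems(3) X by (auto simp: sorted_wrt_append strict_sorted_iff)
  \<comment> \<open>The invariant in the form needed by \<open>mem_mu_iff\<close>: closing brackets
    beyond \<open>f\<close> have been spent on matched elements beyond \<open>f\<close> or are still
    available as rows of the pool.\<close>
  have count: "cn c Y' + card {u \<in> mu F (Kc c). f < u} = card {d \<in> Kc c. f < d}" for c
  proof -
    have "{u \<in> mu F (Kc c). u \<notin> set (fs @ [f])} = {u \<in> mu F (Kc c). f < u}"
      using snoc.prems(11,12) fs(1) mu_subset by fastforce
    moreover have "cn c X2 = card (Kc c \<inter> set (heads X2))"
      by (rule cn_heads[OF dX]) (use snoc.prems(9) X in auto)
    moreover have "{d \<in> Kc c. f < d} = (Kc c - set (heads X)) \<union> (Kc c \<inter> set (heads X2))"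
    proof (intro set_eqI iffI)
      fix d assume d: "d \<in> {d \<in> Kc c. f < d}"
      then have "d \<notin> set (heads X1)" using X1 by fastforce
      then show "d \<in> (Kc c - set (heads X)) \<union> (Kc c \<inter> set (heads X2))" using d X by auto
    next
      fix d assume "d \<in> (Kc c - set (heads X)) \<union> (Kc c \<inter> set (heads X2))"
      then show "d \<in> {d \<in> Kc c. f < d}" using snoc.prems(13) X2 by auto
    qed
    moreover have "card ((Kc c - set (heads X)) \<union> (Kc c \<inter> set (heads X2))) = card (Kc c - set (heads X)) + card (Kc c \<inter> set (heads X2))"
      using fin X by (intro card_Un_disjoint) auto
    ultimately show ?thesis using snoc.prems(10)[of c] cnY'[of c] by simp
  qed
  have fF: "f \<in> F" using snoc.prems(11) by simp
  have matched: "f \<in> mu F (Kc c) \<longleftrightarrow> (\<exists>R\<in>set Y'. c < length R)" for c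
    using mem_mu_iff[OF fin fF, of c] count[of c] cn_pos[of c Y'] by auto
  \<comment> \<open>The longest row of the pool goes to \<open>f\<close>; if the pool is exhausted,
    \<open>f\<close> receives the empty row.\<close>
  obtain Y2 R where R: "(Y' = [] \<and> Y2 = [] \<and> R = []) \<or> Y' = Y2 @ [R]" by (cases Y' rule: rev_cases) auto
  have Rlen: "c < length R \<longleftrightarrow> f \<in> mu F (Kc c)" for c
    using matched[of c] R Y'(3) by (auto simp: sorted_append) (meson less_le_trans)
  have cnY2: "cn c Y2 + (if f \<in> mu F (Kc c) then 1 else 0) = cn c Y'" for c using R Rlen[of c] by auto
  have e2: "extremal (X1 @ Y2 @ R # D)"
    using R Y'(2) by (auto simp: extremal_def)
  have ck2: "rrw (X1 @ Y' @ D) = rrw (X1 @ Y2 @ R # D)" using R by auto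
  have "\<exists>Rs. length Rs = length fs \<and> ckeq (rrw (X1 @ Y2 @ R # D)) (rrw (Rs @ R # D)) \<and> extremal (Rs @ R # D) \<and>
      list_all2 (\<lambda>f R. (\<forall>r\<in>set R. f < r) \<and> (\<forall>c. c < length R \<longleftrightarrow> f \<in> mu F (Kc c))) fs Rs"
  proof (rule snoc.IH[OF e2])
    show "\<forall>R\<in>set X1 \<union> set Y2. R \<noteq> []" using snoc.prems(2) X R Y'ne by auto
    show "srt (heads X1)" using snoc.prems(3) X by (simp add: sorted_wrt_append)
    show "sorted (map length Y2)" using R Y'(3) by (auto simp: sorted_append)
    show "srt fs" by (rule fs)
    have "set (concat Y2) \<subseteq> set (concat Y')" using R by auto
    then show "\<forall>r\<in>set (concat Y2). \<forall>f\<in>set fs. f < r" using Y'f fs(1) less_trans by blast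
    show "fs = [] \<longrightarrow> X1 = []"
    proof
      assume "fs = []"
      then have "\<forall>R\<in>set X. f < hd R" using snoc.prems(8) by simp
      then show "X1 = []" using X X1 by (cases X1) force+
    qed
    show "fs \<noteq> [] \<longrightarrow> (\<forall>R\<in>set X1. hd fs < hd R)" using snoc.prems(8) X by auto
    show "\<forall>R\<in>set X1. \<forall>c. c < length R \<longleftrightarrow> hd R \<in> Kc c" using snoc.prems(9) X by auto
    show "set fs \<subseteq> F" using snoc.prems(11) by simp
    show "\<forall>u\<in>F - set fs. \<forall>f\<in>set fs. f < u" using snoc.prems(12) fs(1) by auto
    show "\<forall>c. \<forall>d\<in>Kc c. d \<in> set (heads X1) \<or> (\<forall>f\<in>set fs. f < d)"
    proof (intro allI ballI)
      fix c d assume "d \<in> Kc c"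
      then consider "d \<in> set (heads X)" | "\<forall>g\<in>set (fs @ [f]). g < d" using snoc.prems(13) by blast
      then show "d \<in> set (heads X1) \<or> (\<forall>f\<in>set fs. f < d)"
      proof cases
        case 1
        then consider "d \<in> set (heads X1)" | "f < d" using X X2 by auto
        then show ?thesis using fs(1) less_trans by cases blast+
      qed simp
    qed
    show "cn c Y2 + card {u \<in> mu F (Kc c). u \<notin> set fs} = card (Kc c - set (heads X1))" for c
    proof -
      have "{u \<in> mu F (Kc c). u \<notin> set fs} = {u \<in> mu F (Kc c). f < u} \<union> (if f \<in> mu F (Kc c) then {f} else {})"
        using snoc.prems(12) fs(1) mu_subset[of F "Kc c"] by (auto split: if_splits)
      moreover have "finite (mu F (Kc c))" using card_mu_le[OF fin] by simp
      ultimately have "card {u \<in> mu F (Kc c). u \<notin> set fs} = card {u \<in> mu F (Kc c). f < u} + (if f \<in> mu F (Kc c) then 1 else 0)"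
        by (auto simp: card_insert_if)
      moreover have "Kc c - set (heads X1) = {d \<in> Kc c. f < d}"
        using snoc.prems(13) X X1 X2 by fastforce
      ultimately show ?thesis using count[of c] cnY2[of c] by (simp split: if_splits)
    qed
  qed
  then obtain Rs where Rs: "length Rs = length fs" "ckeq (rrw (X1 @ Y2 @ R # D)) (rrw (Rs @ R # D))" "extremal (Rs @ R # D)"
      "list_all2 (\<lambda>f R. (\<forall>r\<in>set R. f < r) \<and> (\<forall>c. c < length R \<longleftrightarrow> f \<in> mu F (Kc c))) fs Rs" by blast
  have "\<forall>r\<in>set R. f < r" using R Y'f by auto
  moreover have "ckeq (rrw (X @ Y @ D)) (rrw ((Rs @ [R]) @ D))"
    using ck_trans[OF Y'(1)] Rs(2) ck2 X by simp
  ultimately show ?case using Rs Rlen by (intro exI[of _ "Rs @ [R]"]) (simp add: list_all2_appendI)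
qed

text \<open>Follows the recursion of \<open>K\<close>: the rows of the canonical array of the tails
  are redistributed over the first column, with lengths dictated by the matching, and then the
  column is attached.\<close>

theorem canon_exists: "redtab P \<Longrightarrow> \<exists>T. canon P T"
proof (induction "length (concat P)" arbitrary: P rule: less_induct)
  case less
  note P = less.prems
  have tP: "tab P" using P by (simp add: redtab_def)
  show ?case
  proof (cases "P = []")
    case True
    then show ?thesis using arr_self[OF P] by (intro exI[of _ "[]"]) (simp add: canon_def)
  next
    case False
    have dec: "length (concat (tails P)) < length (concat P)"
    proof -
      have le: "length (concat (tails Q)) \<le> length (concat Q)" for Q
        by (induction Q) (auto simp: le_diff_conv)
      obtain R Q where "P = R # Q" using False by (cases P) auto
      moreover have "R \<noteq> []" using calculation tP by auto
      ultimately show ?thesis using le[of Q] by (cases R) (auto simp: less_Suc_eq_le le_diff_conv)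
    qed
    have P': "redtab (tails P)" by (rule redtab_tails[OF P])
    then obtain T' where T': "canon (tails P) T'" using less.hyps dec by blast
    then have a: "arr (tails P) T'" and len: "\<forall>R\<in>set T'. \<forall>c. c < length R \<longleftrightarrow> hd R \<in> K c (tails P)"
      by (auto simp: canon_def)
    let ?F = "set (heads P)"
    have srtT': "srt (heads T')" "\<forall>R\<in>set T'. R \<noteq> []" using a by (auto simp: arr_def)
    have heads: "set (heads T') = K 0 (tails P)"
    proof (rule card_subset_eq[OF finite_K])
      show "set (heads T') \<subseteq> K 0 (tails P)" using len srtT' by fastforce
      have "distinct (heads T')" using srtT' strict_sorted_iff by blast
      then have "card (set (heads T')) = length T'" using distinct_card[of "heads T'"] by simp
      also have "\<dots> = card (K 0 (tails P))"
        using arr_length[OF P' a] card_K[of "tails P" 0] P' tab_nonempty[of "tails P"] by (simp add: redtab_def filter_id_conv)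
      finally show "card (set (heads T')) = card (K 0 (tails P))" .
    qed
    have KT: "K c (tails P) \<subseteq> set (heads T')" for c using heads K_anti[of 0 c "tails P"] by simp
    have "\<exists>Rs. length Rs = length (heads P) \<and> ckeq (rrw (T' @ [] @ [])) (rrw (Rs @ [])) \<and> extremal (Rs @ []) \<and>
      list_all2 (\<lambda>f R. (\<forall>r\<in>set R. f < r) \<and> (\<forall>c. c < length R \<longleftrightarrow> f \<in> mu ?F (K c (tails P)))) (heads P) Rs"
    proof (rule distribute)
      show "card (mu ?F (K 0 (tails P))) = card (K 0 (tails P))" by (rule card_mu_K[OF tP K_subset])
      show "extremal (T' @ [] @ [])" using arr_extremal[OF P' a] by simp
      show "heads P \<noteq> [] \<longrightarrow> (\<forall>R\<in>set T'. hd (heads P) < hd R)"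
      proof (intro impI ballI)
        fix R assume "R \<in> set T'"
        then have "hd R \<in> set (heads (tails P))" using heads by auto
        then have h: "hd (heads (tails P)) \<le> hd R" "tails P \<noteq> []"
          using srt_heads[OF tab_tails[OF tP]] by (cases "tails P"; auto)+
        moreover have "hd (heads P) < hd (heads (tails P))" using below_hd[OF below_heads[OF tP]] h by auto
        ultimately show "hd (heads P) < hd R" by simp
      qed
      show "cn c [] + card {u \<in> mu ?F (K c (tails P)). u \<notin> set (heads P)} = card (K c (tails P) - set (heads T'))" for c
      proof -
        have "{u \<in> mu ?F (K c (tails P)). u \<notin> set (heads P)} = {}" using mu_subset by blast
        moreover have "K c (tails P) - set (heads T') = {}" using KT by blast
        ultimately show ?thesis by (simp only: card.empty cn_simps)
      qed
      show "\<forall>c. \<forall>d\<in>K c (tails P). d \<in> set (heads T') \<or> (\<forall>f\<in>set (heads P). f < d)" using KT by blast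
    qed (use False srtT' srt_heads[OF tP] len finite_K KT in auto)
    then obtain Rs where Rs: "length Rs = length (heads P)" "ckeq (rrw T') (rrw Rs)" "extremal Rs"
      "list_all2 (\<lambda>f R. (\<forall>r\<in>set R. f < r) \<and> (\<forall>c. c < length R \<longleftrightarrow> f \<in> mu ?F (K c (tails P)))) (heads P) Rs"
      by auto
    define T where "T = map2 (#) (heads P) Rs"
    have hT: "heads T = heads P" "map tl T = Rs" using map2_Cons[of "heads P" Rs] Rs(1) by (auto simp: T_def)
    have okRs: "rows_ok Rs" using Rs(3) by (simp add: extremal_def)
    have la: "list_all2 (\<lambda>f R. srt R \<and> (\<forall>r\<in>set R. f < r)) (heads P) Rs"
      using Rs(4) okRs by (auto simp: list_all2_conv_all_nth rows_ok_def)
    have "ckeq (rrw T) (rev (heads P) @ rrw Rs)"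
      unfolding T_def using ck_column[OF _ srt_heads[OF tP] la] Rs(1) by simp
    moreover have "ckeq (rrw (tails P)) (rrw Rs)" using a Rs(2) ck_trans by (auto simp: arr_def)
    then have "ckeq (rev (heads P) @ rrw (tails P)) (rev (heads P) @ rrw Rs)" by (intro ck_app) auto
    ultimately have ck: "ckeq (rrw P) (rrw T)" using ck_tails[OF tP] ck_trans ck_sym by blast
    \<comment> \<open>By \<open>(m + 1)^2 = m^2 + 2 m + 1\<close>, attaching a first column raises
      \<open>sq\<close> by an amount that depends only on the numbers of letters and rows.\<close>
    have sqs: "sq Q = sq (map tl Q) + 2 * length (rrw (map tl Q)) + length Q" if "\<forall>R\<in>set Q. R \<noteq> []" for Q
      using that
    proof (induction Q)
      case (Cons R Q)
      then show ?case by (cases R) (auto simp: power2_eq_square algebra_simps)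
    qed simp
    have neT: "\<forall>R\<in>set T. R \<noteq> []" by (auto simp: T_def)
    have "sq Rs = sq (tails P)"
      using Rs(2,3) a arr_extremal[OF P' a] eg_ckeq_eq[OF Rs(2)] by (simp add: extremal_def arr_def)
    moreover have "sq (tails Q) = sq (map tl Q)" for Q
    proof (induction Q)
      case (Cons R Q) then show ?case by (cases R) auto
    qed simp
    moreover have "length (rrw (map tl P)) = length (rrw Rs)"
    proof -
      have "length (rrw (tails P)) = length (rrw Rs)" using a Rs(2) ck_perm by (metis arr_def)
      moreover have "length (rrw (tails Q)) = length (rrw (map tl Q))" for Q
      proof (induction Q)
        case (Cons R Q) then show ?case by (cases R) auto
      qed simp
      ultimately show ?thesis by simp
    qed
    moreover have "length T = length P" using Rs(1) by (simp add: T_def)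
    ultimately have "sq T = sq P" using sqs[OF neT] sqs[of P] tab_nonempty[OF tP] hT by simp
    moreover have "rows_ok T" using la by (auto simp: T_def rows_ok_def list_all2_conv_all_nth set_zip)
    ultimately have "arr P T" using ck neT hT srt_heads[OF tP] by (simp add: arr_def)
    moreover have "c < length R \<longleftrightarrow> hd R \<in> K c P" if R: "R \<in> set T" for R c
    proof -
      obtain i where i: "i < length P" "R = hd (P ! i) # Rs ! i"
        using R Rs(1) by (auto simp: T_def set_zip)
      have "hd (P ! i) \<in> ?F" using i by auto
      moreover have "c' < length (Rs ! i) \<longleftrightarrow> hd (P ! i) \<in> mu ?F (K c' (tails P))" for c'
        using Rs(4) i(1) by (auto simp: list_all2_conv_all_nth)
      ultimately show ?thesis using i by (cases c) auto
    qed
    ultimately show ?thesis unfolding canon_def by blast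
  qed
qed

section \<open>Drop is row insertion\<close>

lemma first_block_simps [simp]: "first_block [] = []" "first_block (Inl x # cs) = []"
  "first_block (Inr p # cs) = p # first_block cs"
  by (simp_all add: first_block_def)

text \<open>Turns the maxima in \<open>drop_shift\<close> and \<open>lift_shift\<close> into a
  recursion along the block.\<close>

lemma max_run:
  "Max {b \<in> {..Suc n}. \<forall>i<b. Q i} = (if Q 0 then Suc (Max {b \<in> {..n}. \<forall>i<b. Q (Suc i)}) else 0)"
proof (cases "Q 0")
  case False
  then have "{b \<in> {..Suc n}. \<forall>i<b. Q i} = {0}" by (auto simp: gr0_conv_Suc)
  then show ?thesis using False by simp
next
  case True
  let ?B = "{b \<in> {..n}. \<forall>i<b. Q (Suc i)}"
  have "{b \<in> {..Suc n}. \<forall>i<b. Q i} = insert 0 (Suc ` ?B)"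
  proof (intro set_eqI iffI)
    fix b assume "b \<in> {b \<in> {..Suc n}. \<forall>i<b. Q i}"
    then show "b \<in> insert 0 (Suc ` ?B)" by (cases b) auto
  next
    fix b assume "b \<in> insert 0 (Suc ` ?B)"
    then show "b \<in> {b \<in> {..Suc n}. \<forall>i<b. Q i}" using True by (auto simp: less_Suc_eq_0_disj)
  qed
  moreover have ne: "finite ?B" "?B \<noteq> {}" by (auto intro!: exI[of _ 0])
  moreover have "Max (insert 0 (Suc ` ?B)) = Max (Suc ` ?B)" using ne by simp
  moreover have "Max (Suc ` ?B) = Suc (Max ?B)" using ne by (intro mono_Max_commute[symmetric]) (auto simp: mono_def)
  ultimately show ?thesis using True by simp
qed

fun drop_hat_run :: "nat \<Rightarrow> (nat \<times> nat) list \<Rightarrow> nat list" where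
  "drop_hat_run w [] = []"
| "drop_hat_run w ((t, s) # ps) = (if t = Suc w then Suc s # drop_hat_run t ps else map snd ((t, s) # ps))"

lemma drop_hat_run:
  "b = Max {b \<in> {..length ps}. \<forall>i<b. fst (ps ! i) = x + Suc i} \<Longrightarrow>
    map (\<lambda>s. s + 1) (take b (map snd ps)) @ drop b (map snd ps) = drop_hat_run x ps"
proof (induction ps arbitrary: x b)
  case Nil then show ?case by simp
next
  case (Cons p ps)
  obtain t s where p: "p = (t, s)" by fastforce
  have "b = (if t = Suc x then Suc (Max {b \<in> {..length ps}. \<forall>i<b. fst (ps ! i) = Suc x + Suc i}) else 0)"
    using Cons.prems max_run[of "length ps" "\<lambda>i. fst ((p # ps) ! i) = x + Suc i"] p by simp
  then show ?case using Cons.IH[OF refl, of "Suc x"] p by auto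
qed

lemma drop_hat_eq_run:
  assumes "ps = [] \<or> fst (hd ps) \<noteq> Suc x \<or> snd (hd ps) = x"
  shows "drop_hat x ps = drop_hat_run x ps"
proof (cases "ps \<noteq> [] \<and> fst (hd ps) = Suc x")
  case True
  then show ?thesis using assms drop_hat_run[OF refl, of ps x] by (simp add: drop_hat_def drop_shift_def)
next
  case False
  then show ?thesis by (cases ps) (auto simp: drop_hat_def drop_shift_def)
qed

fun drop_top :: "column list \<Rightarrow> nat list" where
  "drop_top [] = []"
| "drop_top (Inl x # cs) = drop_top cs"
| "drop_top (Inr (t, s) # cs) = t # drop_top cs"

text \<open>The first argument is the preceding top letter if a run of raised letters may continue.\<close>

fun drop_bottom :: "nat option \<Rightarrow> column list \<Rightarrow> nat list" where
  "drop_bottom v [] = []"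
| "drop_bottom v (Inl x # cs) = x # drop_bottom (Some x) cs"
| "drop_bottom v (Inr (t, s) # cs) =
    (if v \<noteq> None \<and> t = Suc (the v) then Suc s # drop_bottom (Some t) cs else s # drop_bottom None cs)"

text \<open>\<open>drop_shift\<close> measures its run from the first lower letter,
  \<open>drop_hat_run\<close> from \<open>x\<close>. They agree because an alignment skips
  \<open>x\<close> only if the lower letter is at least \<open>x\<close>, and this letter then lies
  below \<open>x + 1\<close>.\<close>

fun drop_columns :: "column list \<Rightarrow> bool" where
  "drop_columns [] = True"
| "drop_columns (Inl x # cs) \<longleftrightarrow> (\<forall>t s cs'. cs = Inr (t, s) # cs' \<longrightarrow> t = Suc x \<longrightarrow> s = x) \<and> drop_columns cs"
| "drop_columns (Inr p # cs) = drop_columns cs"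

lemma drop_top_blocks:
  "map fst (first_block cs) @ concat (map (\<lambda>(x, ps). map fst ps) (later_blocks cs)) = drop_top cs"
  by (induction cs rule: drop_top.induct) auto

lemma drop_bottom_blocks:
  "drop_columns cs \<Longrightarrow> (case v of None \<Rightarrow> map snd (first_block cs) | Some w \<Rightarrow> drop_hat_run w (first_block cs)) @
    concat (map (\<lambda>(x, ps). x # drop_hat x ps) (later_blocks cs)) = drop_bottom v cs"
proof (induction v cs rule: drop_bottom.induct)
  case (1 v) then show ?case by (simp split: option.split)
next
  case (2 v x cs)
  have "drop_hat x (first_block cs) = drop_hat_run x (first_block cs)"
  proof (rule drop_hat_eq_run)
    show "first_block cs = [] \<or> fst (hd (first_block cs)) \<noteq> Suc x \<or> snd (hd (first_block cs)) = x"
    proof (cases cs)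
      case (Cons c cs')
      then show ?thesis using "2.prems" by (cases c) auto
    qed simp
  qed
  then show ?case using 2 by (simp split: option.split)
next
  case (3 v t s cs)
  then show ?case by (cases v) auto
qed

lemma drop_align_columns: "drop_align \<tau> \<sigma> = (cs, r) \<Longrightarrow> drop_columns cs"
proof (induction \<tau> \<sigma> arbitrary: cs r rule: drop_align.induct)
  case (2 t \<tau>)
  have "drop_columns (map Inl xs)" for xs by (induction xs) auto
  then show ?case using 2 by auto
next
  case (3 t \<tau> s \<sigma>)
  show ?case
  proof (cases "s < t")
    case True then show ?thesis using 3 by (cases "drop_align \<tau> \<sigma>") auto
  next
    case False
    obtain cs' where cs': "drop_align \<tau> (s # \<sigma>) = (cs', r)" "cs = Inl t # cs'"
      using 3 False by (cases "drop_align \<tau> (s # \<sigma>)") auto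
    have "s' = t" if "cs' = Inr (t', s') # cs2" "t' = Suc t" for t' s' cs2
      using cs'(1) that False by (cases \<tau>) (auto simp: apfst_def map_prod_def split: if_splits prod.splits)
    then show ?thesis using 3 False cs' by auto
  qed
qed auto

lemma drop_align_Nil: "drop_align \<tau> [] = (map Inl \<tau>, [])"
  by (cases \<tau>) auto

lemma drop_Inl: "drop_bottom v (map Inl \<tau>) = \<tau>" "drop_top (map Inl \<tau>) = []"
  by (induction \<tau> arbitrary: v) auto

lemma red_after_bump:
  assumes "srt (r # R)" "red (r # R @ s # w)" "s \<le> r"
  shows "red (R @ w)"
proof -
  have "red (snd (ins (r # R) s) @ fst (ins (r # R) s) @ w)"
    using ins_red[of "r # R" "[]" s w] assms by simp
  then show ?thesis using assms(3) red_ConsD by (auto split: if_splits)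
qed

text \<open>The second half treats a row that still carries an unmatched letter \<open>u\<close> in
  front, which the next inserted letter may equal. The exceptional rule then keeps \<open>u\<close>
  and emits \<open>Suc u\<close>, and this is what raises the letters of a run.\<close>

lemma drop_align_insw:
  "srt \<tau> \<Longrightarrow> srt \<sigma> \<Longrightarrow> drop_align \<tau> \<sigma> = (cs, r) \<Longrightarrow>
    (red (\<tau> @ \<sigma>) \<longrightarrow> insw \<tau> \<sigma> = (drop_bottom None cs @ r, drop_top cs)) \<and>
    (\<forall>u. srt (u # \<tau>) \<longrightarrow> (\<sigma> \<noteq> [] \<longrightarrow> u \<le> hd \<sigma>) \<longrightarrow> red (u # \<tau> @ \<sigma>) \<longrightarrow>
      insw (u # \<tau>) \<sigma> = (u # drop_bottom (Some u) cs @ r, drop_top cs))"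
proof (induction \<tau> arbitrary: \<sigma> cs r)
  case Nil
  then have [simp]: "cs = []" "r = \<sigma>" by auto
  have "insw [u] \<sigma> = (u # \<sigma>, [])" if "\<sigma> \<noteq> [] \<longrightarrow> u \<le> hd \<sigma>" "red (u # \<sigma>)" for u
  proof -
    have "\<forall>x\<in>set \<sigma>. u < x"
    proof (cases \<sigma>)
      case (Cons s \<sigma>')
      moreover have "u \<noteq> s" using that(2) Cons not_red_square by auto
      ultimately show ?thesis using that Nil.prems by auto
    qed simp
    then show ?thesis using insw_Cons_gt[of \<sigma> u "[]"] insw_Nil[OF Nil.prems(2)] by simp
  qed
  then show ?case using insw_Nil[OF Nil.prems(2)] by simp
next
  case (Cons t \<tau>)
  have t\<tau>: "srt \<tau>" "\<forall>x\<in>set \<tau>. t < x" using Cons.prems by auto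
  show ?case
  proof (cases \<sigma>)
    case Nil
    then show ?thesis using Cons.prems drop_align_Nil[of "t # \<tau>"] drop_Inl by auto
  next
    case \<sigma>: (Cons s \<sigma>')
    have s\<sigma>: "srt \<sigma>'" "\<forall>x\<in>set \<sigma>'. s < x" using Cons.prems \<sigma> by auto
    obtain c1 r1 where a1: "drop_align \<tau> \<sigma>' = (c1, r1)" by fastforce
    obtain c2 r2 where a2: "drop_align \<tau> (s # \<sigma>') = (c2, r2)" by fastforce
    note IH1 = Cons.IH[OF t\<tau>(1) s\<sigma>(1) a1]
    note IH2 = Cons.IH[OF t\<tau>(1) _ a2]
    have cs1: "cs = Inr (t, s) # c1" "r = r1" if "s < t" using Cons.prems(3) \<sigma> a1 that by auto
    have cs2: "cs = Inl t # c2" "r = r2" if "\<not> s < t" using Cons.prems(3) \<sigma> a2 that by auto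
    note iC = insw_Cons[of s \<sigma>']
    have N: "insw (t # \<tau>) \<sigma> = (drop_bottom None cs @ r, drop_top cs)" if red: "red ((t # \<tau>) @ \<sigma>)"
    proof (cases "s < t")
      case True
      then have "red (\<tau> @ \<sigma>')" using red_after_bump[OF Cons.prems(1), of s \<sigma>'] red \<sigma> by simp
      then show ?thesis using IH1 cs1[OF True] iC[of t \<tau>] Cons.prems(2) \<sigma> True by (simp del: insw.simps)
    next
      case False
      then show ?thesis using IH2 cs2 Cons.prems \<sigma> red by (simp del: insw.simps)
    qed
    have G: "insw (u # t # \<tau>) \<sigma> = (u # drop_bottom (Some u) cs @ r, drop_top cs)"
      if u: "srt (u # t # \<tau>)" "u \<le> s" and red: "red (u # (t # \<tau>) @ \<sigma>)" for u
    proof (cases "u = s")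
      case True
      then have tu: "t = Suc u" using red_special[of u "t # \<tau>" \<sigma>'] red \<sigma> u by auto
      have "red ((t # \<tau>) @ \<sigma>')" using red_after_bump[OF u(1), of s \<sigma>'] red \<sigma> True by simp
      moreover have "\<sigma>' \<noteq> [] \<longrightarrow> t \<le> hd \<sigma>'" using s\<sigma> True tu by (cases \<sigma>') auto
      ultimately have "insw (t # \<tau>) \<sigma>' = (t # drop_bottom (Some t) c1 @ r1, drop_top c1)"
        using IH1 Cons.prems by simp
      then show ?thesis using iC[of u "t # \<tau>"] Cons.prems(2) \<sigma> True tu cs1 by (simp del: insw.simps)
    next
      case False
      then have us: "u < s" using u by simp
      have red': "red ((t # \<tau>) @ \<sigma>)" using red red_ConsD by blast
      have "insw (u # t # \<tau>) \<sigma> = apfst (Cons u) (insw (t # \<tau>) \<sigma>)"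
        using iC[of u "t # \<tau>"] Cons.prems(2) \<sigma> us by (simp del: insw.simps)
      moreover have "drop_bottom (Some u) cs = drop_bottom None cs"
        using us cs1 cs2 by (cases "s < t") auto
      ultimately show ?thesis using N[OF red'] by simp
    qed
    show ?thesis using N G \<sigma> by auto
  qed
qed

lemma drop_pair_insw:
  assumes "srt \<tau>" "srt \<sigma>" "red (\<tau> @ \<sigma>)"
  shows "drop_pair \<tau> \<sigma> = (snd (insw \<tau> \<sigma>), fst (insw \<tau> \<sigma>))"
proof -
  obtain cs r where a: "drop_align \<tau> \<sigma> = (cs, r)" by fastforce
  show ?thesis
    using drop_align_insw[OF assms(1,2) a] assms(3) drop_top_blocks[of cs]
      drop_bottom_blocks[OF drop_align_columns[OF a], of None]
    by (simp add: drop_pair_def a Let_def)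
qed

section \<open>Lift inverts drop where the first column allows it\<close>

lemma rinw_Cons_lt: "\<forall>x\<in>set w. x < s \<Longrightarrow> rinw (s # S) w = apfst (Cons s) (rinw S w)"
  by (induction w arbitrary: S) (auto split: prod.splits simp: apfst_def apsnd_def map_prod_def)

lemma rinw_Cons:
  assumes "sorted_wrt (>) (t # w)"
  shows "rinw (s # S) (t # w) =
    (if s < t then map_prod (Cons t) (Cons s) (rinw S w)
     else if s = t then map_prod (Cons s) (Cons (s - 1)) (rinw S w)
     else apfst (Cons s) (rinw S (t # w)))"
proof (cases "t < s")
  case True
  then have "\<forall>x\<in>set (t # w). x < s" using assms by auto
  then show ?thesis using True rinw_Cons_lt[of "t # w" s S] by (simp del: rinw.simps)
next
  case False
  then show ?thesis using assms rinw_Cons_lt[of w t S] by (cases "rinw S w") auto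
qed

lemma rinw_Nil: "sorted_wrt (>) w \<Longrightarrow> rinw [] w = (w, [])"
proof (induction w)
  case (Cons y w)
  then show ?case using rinw_Cons_lt[of w y "[]"] by simp
qed simp

definition lift_top :: "column list \<Rightarrow> nat list" where
  "lift_top cs = map (case_sum id fst) cs"

fun lift_out :: "column list \<Rightarrow> nat list" where
  "lift_out [] = []"
| "lift_out (Inl x # cs) = lift_out cs"
| "lift_out (Inr (t, s) # cs) = (if s = t then s - 1 else s) # lift_out cs"

text \<open>Scanned from the right, the lift alignment makes the comparisons of reverse insertion.
  Letters in \<open>l\<close> would be appended and release nothing; letters in \<open>p\<close>
  keep their place at the left end, so that the new upper row starts like the old lower one.\<close>

lemma lift_align_rinw:
  "sorted_wrt (>) \<tau> \<Longrightarrow> sorted_wrt (>) \<sigma> \<Longrightarrow> lift_align_rev \<tau> \<sigma> = (cs, l, p) \<Longrightarrow>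
    (l = [] \<longrightarrow> rinw \<sigma> \<tau> = (lift_top cs @ p, lift_out cs)) \<and> (l \<noteq> [] \<longrightarrow> length (snd (rinw \<sigma> \<tau>)) < length \<tau>) \<and>
    (p \<noteq> [] \<longrightarrow> \<sigma> \<noteq> [] \<and> last p = last \<sigma>) \<and>
    (l = [] \<and> p = [] \<and> \<tau> \<noteq> [] \<and> \<sigma> \<noteq> [] \<and> last \<sigma> < last \<tau> \<longrightarrow>
      cs \<noteq> [] \<and> last (lift_top cs) = last \<tau> \<and> lift_out cs \<noteq> [] \<and> last (lift_out cs) = last \<sigma>)"
proof (induction \<tau> \<sigma> arbitrary: cs l p rule: lift_align_rev.induct)
  case (1 \<tau>)
  then show ?case using rinw_Nil by (auto simp: lift_top_def)
next
  case (2 s \<sigma>)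
  then show ?case by (auto simp: lift_top_def)
next
  case (3 t \<tau> s \<sigma>)
  show ?case
  proof (cases "s \<le> t")
    case True
    then obtain cs' where cs': "lift_align_rev \<tau> \<sigma> = (cs', l, p)" "cs = Inr (t, s) # cs'"
      using "3.prems" by (cases "lift_align_rev \<tau> \<sigma>") auto
    have d: "sorted_wrt (>) \<tau>" "sorted_wrt (>) \<sigma>" using "3.prems" by auto
    note IH = "3.IH"(1)[OF True d cs'(1)]
    have rec: "rinw (s # \<sigma>) (t # \<tau>) = map_prod (Cons t) (Cons (if s = t then s - 1 else s)) (rinw \<sigma> \<tau>)"
      using rinw_Cons[OF "3.prems"(1), of s \<sigma>] True by auto
    have c: "lift_top cs = t # lift_top cs'" "lift_out cs = (if s = t then s - 1 else s) # lift_out cs'"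
      using cs' by (auto simp: lift_top_def)
    show ?thesis
    proof (intro conjI impI)
      assume "l = []"
      then show "rinw (s # \<sigma>) (t # \<tau>) = (lift_top cs @ p, lift_out cs)" using IH c unfolding rec by simp
    next
      assume "l \<noteq> []"
      then show "length (snd (rinw (s # \<sigma>) (t # \<tau>))) < length (t # \<tau>)" using IH unfolding rec by simp
    next
      assume "p \<noteq> []" then show "last p = last (s # \<sigma>)" using IH by simp
    next
      assume a: "l = [] \<and> p = [] \<and> t # \<tau> \<noteq> [] \<and> s # \<sigma> \<noteq> [] \<and> last (s # \<sigma>) < last (t # \<tau>)"
      have "\<sigma> = [] \<Longrightarrow> \<tau> = [] \<and> cs' = []" using cs'(1) a by simp
      moreover have "\<tau> = [] \<Longrightarrow> \<sigma> = []" using cs'(1) a by (cases \<sigma>) auto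
      ultimately consider "\<sigma> = []" "\<tau> = []" "cs' = []" | "\<sigma> \<noteq> []" "\<tau> \<noteq> []" by blast
      then have "last (lift_top cs) = last (t # \<tau>) \<and> last (lift_out cs) = last (s # \<sigma>)"
      proof cases
        case 1 then show ?thesis using a c by (simp add: lift_top_def)
      next
        case 2
        then have "cs' \<noteq> [] \<and> last (lift_top cs') = last \<tau> \<and> lift_out cs' \<noteq> [] \<and> last (lift_out cs') = last \<sigma>" using IH a by simp
        then show ?thesis using 2 c by (simp add: lift_top_def)
      qed
      then show "last (lift_top cs) = last (t # \<tau>)" "last (lift_out cs) = last (s # \<sigma>)" by auto
    qed (use cs' c in auto)
  next
    case False
    then obtain cs' where cs': "lift_align_rev (t # \<tau>) \<sigma> = (cs', l, p)" "cs = Inl s # cs'"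
      using "3.prems" by (cases "lift_align_rev (t # \<tau>) \<sigma>") auto
    have d: "sorted_wrt (>) \<sigma>" using "3.prems" by auto
    note IH = "3.IH"(2)[OF False "3.prems"(1) d cs'(1)]
    have rec: "rinw (s # \<sigma>) (t # \<tau>) = apfst (Cons s) (rinw \<sigma> (t # \<tau>))"
      using rinw_Cons[OF "3.prems"(1), of s \<sigma>] False by auto
    have c: "lift_top cs = s # lift_top cs'" "lift_out cs = lift_out cs'" using cs' by (auto simp: lift_top_def)
    show ?thesis
    proof (intro conjI impI)
      assume "l = []"
      then show "rinw (s # \<sigma>) (t # \<tau>) = (lift_top cs @ p, lift_out cs)" using IH c unfolding rec by simp
    next
      assume "l \<noteq> []"
      then show "length (snd (rinw (s # \<sigma>) (t # \<tau>))) < length (t # \<tau>)" using IH unfolding rec by simp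
    next
      assume "p \<noteq> []" then show "last p = last (s # \<sigma>)" using IH by simp
    next
      assume a: "l = [] \<and> p = [] \<and> t # \<tau> \<noteq> [] \<and> s # \<sigma> \<noteq> [] \<and> last (s # \<sigma>) < last (t # \<tau>)"
      have "\<sigma> \<noteq> []" using cs'(1) a by auto
      then have "cs' \<noteq> [] \<and> last (lift_top cs') = last (t # \<tau>) \<and> lift_out cs' \<noteq> [] \<and> last (lift_out cs') = last \<sigma>"
        using IH a by simp
      then show "last (lift_top cs) = last (t # \<tau>)" "lift_out cs \<noteq> []" "last (lift_out cs) = last (s # \<sigma>)"
        using c \<open>\<sigma> \<noteq> []\<close> by (auto simp: lift_top_def)
    qed (use cs' in auto)
  qed
qed

fun lift_bottom :: "nat option \<Rightarrow> column list \<Rightarrow> nat list" where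
  "lift_bottom v [] = []"
| "lift_bottom v (Inl x # cs) = lift_bottom (Some x) cs"
| "lift_bottom v (Inr (t, s) # cs) =
    (if v \<noteq> None \<and> t = Suc (the v) \<and> s = Suc (the v) then (s - 1) # lift_bottom (Some s) cs else s # lift_bottom None cs)"

fun lift_check_run :: "nat \<Rightarrow> (nat \<times> nat) list \<Rightarrow> nat list" where
  "lift_check_run w [] = []"
| "lift_check_run w ((t, s) # ps) = (if t = Suc w \<and> s = Suc w then (s - 1) # lift_check_run s ps else map snd ((t, s) # ps))"

lemma lift_check_run:
  "b = Max {b \<in> {..length ps}. \<forall>i<b. fst (ps ! i) = x + Suc i \<and> snd (ps ! i) = x + Suc i} \<Longrightarrow>
    map (\<lambda>s. s - 1) (take b (map snd ps)) @ drop b (map snd ps) = lift_check_run x ps"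
proof (induction ps arbitrary: x b)
  case Nil then show ?case by simp
next
  case (Cons p ps)
  obtain t s where p: "p = (t, s)" by fastforce
  have "b = (if t = Suc x \<and> s = Suc x then Suc (Max {b \<in> {..length ps}. \<forall>i<b. fst (ps ! i) = Suc x + Suc i \<and> snd (ps ! i) = Suc x + Suc i}) else 0)"
    using Cons.prems max_run[of "length ps" "\<lambda>i. fst ((p # ps) ! i) = x + Suc i \<and> snd ((p # ps) ! i) = x + Suc i"] p by simp
  then show ?case using Cons.IH[OF refl, of "Suc x"] p by auto
qed

lemma lift_check_eq_run: "lift_check x ps = lift_check_run x ps"
proof (cases "ps \<noteq> [] \<and> snd (hd ps) = Suc x")
  case True
  then show ?thesis using lift_check_run[OF refl, of ps x] by (simp add: lift_check_def lift_shift_def)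
next
  case False
  then show ?thesis by (cases ps) (auto simp: lift_check_def lift_shift_def)
qed

lemma lift_top_blocks:
  "map fst (first_block cs) @ concat (map (\<lambda>(x, ps). x # map fst ps) (later_blocks cs)) = lift_top cs"
  by (induction cs rule: drop_top.induct) (auto simp: lift_top_def)

lemma lift_bottom_blocks:
  "(case v of None \<Rightarrow> map snd (first_block cs) | Some w \<Rightarrow> lift_check_run w (first_block cs)) @
    concat (map (\<lambda>(x, ps). lift_check x ps) (later_blocks cs)) = lift_bottom v cs"
proof (induction v cs rule: lift_bottom.induct)
  case (1 v) then show ?case by (simp split: option.split)
next
  case (2 v x cs) then show ?case by (simp add: lift_check_eq_run split: option.split)
next
  case (3 v t s cs)
  then show ?case by (cases v) auto
qed

text \<open>A pair of equal letters continues a run starting at an unmatched letter.\<close>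

fun lift_run :: "nat option \<Rightarrow> column list \<Rightarrow> bool" where
  "lift_run v [] = True"
| "lift_run v (Inl x # cs) = lift_run (Some x) cs"
| "lift_run v (Inr (t, s) # cs) \<longleftrightarrow> (t = s \<longrightarrow> v = Some (s - 1) \<and> 0 < s) \<and> lift_run (if t = s then Some s else None) cs"

fun run_state :: "nat option \<Rightarrow> column list \<Rightarrow> nat option" where
  "run_state v [] = v"
| "run_state v (Inl x # cs) = run_state (Some x) cs"
| "run_state v (Inr (t, s) # cs) = run_state (if t = s then Some s else None) cs"

lemma lift_run_append: "lift_run v (a @ b) \<longleftrightarrow> lift_run v a \<and> lift_run (run_state v a) b"
  by (induction v a rule: run_state.induct) auto

lemma run_state_append: "run_state v (a @ b) = run_state (run_state v a) b"
  by (induction v a rule: run_state.induct) auto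

lemma lift_out_append: "lift_out (a @ b) = lift_out a @ lift_out b"
  by (induction a rule: lift_out.induct) auto

lemma lift_out_rev: "lift_out (rev cs) = rev (lift_out cs)"
  by (induction cs rule: lift_out.induct) (auto simp: lift_out_append)

lemma lift_bottom_run: "lift_run v cs \<Longrightarrow> lift_bottom v cs = lift_out cs"
proof (induction v cs rule: lift_run.induct)
  case (3 v t s cs)
  show ?case
  proof (cases "t = s")
    case True
    then obtain w where "s = Suc w" "v = Some w" using 3 by (cases s) auto
    then show ?thesis using 3 True by simp
  next
    case False
    then show ?thesis using 3 by (cases v) auto
  qed
qed auto

text \<open>Reverse insertion lowers the lower letter of every equal pair, lift only within a run
  that starts at an unmatched letter. The columns are listed from right to left, so the condition
  says that the run continues to the left of each equal pair.\<close>

fun lift_columns :: "column list \<Rightarrow> bool" where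
  "lift_columns [] = True"
| "lift_columns (Inl x # cs) = lift_columns cs"
| "lift_columns (Inr (t, s) # cs) \<longleftrightarrow>
    (t = s \<longrightarrow> 0 < s \<and> (\<exists>cs'. cs = Inl (s - 1) # cs' \<or> cs = Inr (s - 1, s - 1) # cs')) \<and> lift_columns cs"

lemma lift_columns_run: "lift_columns cs \<Longrightarrow> lift_run v (rev cs)"
proof (induction cs rule: lift_columns.induct)
  case (3 t s cs)
  then have "t = s \<Longrightarrow> run_state v (rev cs) = Some (s - 1)" by (auto simp: run_state_append)
  then show ?case using 3 by (auto simp: lift_run_append)
qed (auto simp: lift_run_append)

lemma red_special_rev:
  assumes "red (s # W @ [s])" "srt W" "\<forall>x\<in>set W. x < s"
  shows "0 < s \<and> W \<noteq> [] \<and> last W = s - 1"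
proof -
  have "red (s # W @ [s]) \<Longrightarrow> \<forall>x\<in>set W. Suc x < s \<Longrightarrow> False" for W
  proof (induction W rule: rev_induct)
    case Nil then show ?case using not_red_square[of s "[]"] by simp
  next
    case (snoc x W)
    have "word_perm ((s # W @ [s]) @ [x]) = word_perm (s # (W @ [x]) @ [s])"
      using transpose_comm[of x s] snoc.prems(2) by (simp add: comp_assoc)
    then have "red ((s # W @ [s]) @ [x])" using snoc.prems(1) red_peq by simp
    then have "red (s # W @ [s])" by (rule red_appendD1)
    then show ?case using snoc by simp
  qed
  then obtain x where x: "x \<in> set W" "s \<le> Suc x" using assms by (meson not_le)
  then have "s = Suc x" using assms(3) by force
  moreover have "last W = x"
  proof -
    obtain W' y where W: "W = W' @ [y]" using x by (cases W rule: rev_cases) auto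
    then show ?thesis using x assms \<open>s = Suc x\<close> by (auto simp: sorted_wrt_append)
  qed
  ultimately show ?thesis using x by auto
qed

text \<open>For \<open>t = s\<close> the reduced word contains \<open>s W s\<close> with
  \<open>W\<close> the lower letters before \<open>s\<close>, so \<open>W\<close> ends in
  \<open>s - 1\<close> by \<open>red_special_rev\<close>. The next upper letter is below
  \<open>s\<close> and can only be matched with \<open>s - 1\<close> by being equal to it.\<close>

lemma lift_align_columns:
  "sorted_wrt (>) \<tau> \<Longrightarrow> sorted_wrt (>) \<sigma> \<Longrightarrow> red (rev \<tau> @ rev \<sigma>) \<Longrightarrow> lift_align_rev \<tau> \<sigma> = (cs, l, []) \<Longrightarrow> lift_columns cs"
proof (induction \<tau> \<sigma> arbitrary: cs l rule: lift_align_rev.induct)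
  case (3 t \<tau> s \<sigma>)
  show ?case
  proof (cases "s \<le> t")
    case True
    then obtain cs' where cs': "lift_align_rev \<tau> \<sigma> = (cs', l, [])" "cs = Inr (t, s) # cs'"
      using "3.prems" by (cases "lift_align_rev \<tau> \<sigma>") auto
    have srt: "srt (rev \<sigma> @ [s])" using "3.prems"(2) by (simp add: sorted_wrt_append sorted_wrt_rev)
    have red: "red (rev \<tau> @ t # rev \<sigma> @ [s])" using "3.prems"(3) by simp
    have eq: "0 < s \<and> rev \<sigma> \<noteq> [] \<and> last (rev \<sigma>) = s - 1" if "t = s"
    proof (rule red_special_rev)
      show "red (s # rev \<sigma> @ [s])" using red_appendD2[OF red] that by simp
    qed (use srt in \<open>auto simp: sorted_wrt_append\<close>)
    have "hd (rev \<sigma> @ [s]) < t"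
    proof (cases "t = s")
      case True
      then have "rev \<sigma> \<noteq> []" using eq by simp
      then have "hd (rev \<sigma>) \<in> set (rev \<sigma>)" by (rule hd_in_set)
      then have "hd (rev \<sigma>) < s" using srt by (simp add: sorted_wrt_append)
      then show ?thesis using True \<open>rev \<sigma> \<noteq> []\<close> by (simp add: hd_append)
    next
      case False
      then have "\<forall>x\<in>set (rev \<sigma> @ [s]). x < t" using srt \<open>s \<le> t\<close> by (auto simp: sorted_wrt_append)
      then show ?thesis using hd_in_set[of "rev \<sigma> @ [s]"] by blast
    qed
    then obtain R x where R: "ins R x = (rev \<sigma> @ [s], [t])" "srt R" "ckeq (R @ [x]) (t # rev \<sigma> @ [s])"
      using reverse_ins[OF srt red_appendD2[OF red]] by auto
    have redR: "red (rev \<tau> @ R @ [x])" using red ck_red[OF ck_app[OF ck_refl R(3)]] by blast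
    have "red (R @ [x])" using red_appendD2[OF redR] .
    then have rin: "rin (s # \<sigma>) t = (rev R, [x])"
      using rin_ins[OF R(2,1)] red_insert_mem[of R x "[]"] R(2) by simp
    have "red (rev \<tau> @ rev \<sigma>)"
    proof -
      have "\<exists>a. R = rev \<sigma> @ [a]" using rin True by (auto split: if_splits simp: rev_swap[symmetric])
      then obtain a where "R = rev \<sigma> @ [a]" by blast
      then show ?thesis using redR red_appendD1[of "rev \<tau> @ rev \<sigma>" "[a, x]"] by simp
    qed
    then have IH: "lift_columns cs'" using "3.IH"(1)[OF True _ _ _ cs'(1)] "3.prems" by simp
    moreover have "\<exists>cs2. cs' = Inl (s - 1) # cs2 \<or> cs' = Inr (s - 1, s - 1) # cs2" if ts: "t = s"
    proof -
      obtain \<sigma>2 where \<sigma>: "\<sigma> = (s - 1) # \<sigma>2" using eq[OF ts] by (cases \<sigma>) auto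
      obtain t' \<tau>2 where \<tau>: "\<tau> = t' # \<tau>2" using cs'(1) \<sigma> by (cases \<tau>) auto
      have "t' < s" using "3.prems"(1) \<tau> ts by simp
      then show ?thesis using cs'(1) \<sigma> \<tau> by (cases "s - 1 \<le> t'") (auto simp: apfst_def map_prod_def split: prod.splits)
    qed
    ultimately show ?thesis using cs' eq by simp
  next
    case False
    then obtain cs' where cs': "lift_align_rev (t # \<tau>) \<sigma> = (cs', l, [])" "cs = Inl s # cs'"
      using "3.prems" by (cases "lift_align_rev (t # \<tau>) \<sigma>") auto
    have "red (rev (t # \<tau>) @ rev \<sigma>)" using "3.prems"(3) red_appendD1[of "rev (t # \<tau>) @ rev \<sigma>" "[s]"] by simp
    then show ?thesis using "3.IH"(2)[OF False _ _ _ cs'(1)] "3.prems" cs' by simp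
  qed
qed auto

text \<open>Lift undoes the insertion exactly when the first letters stay in increasing order.
  Otherwise the lower row protrudes to the left and nothing is lifted.\<close>

lemma lift_pair_swap:
  assumes "srt t'" "srt s'" "red (t' @ s')" "insw t' s' = (s, t)" "length t = length s'"
    and ne: "s' \<noteq> []" "t' \<noteq> []" and hd: "hd s < hd t"
  shows "lift_pair t s = (if hd s' < hd t' then (t', s') else (t, s))"
proof -
  have st: "srt s" "srt t" using insw_srt[OF assms(1), of s'] insw_out[OF assms(2,1,4)] assms(4) by auto
  have redts: "red (t @ s)" using insw_ckeq[OF assms(1,3)] ck_red assms(3,4) by simp
  have lens: "length s = length t'" using insw_length[OF assms(2,4)] assms(5) by simp
  then have ne2: "s \<noteq> []" "t \<noteq> []" using ne assms(5) by auto
  have desc: "sorted_wrt (>) (rev t)" "sorted_wrt (>) (rev s)" using st by (simp_all add: sorted_wrt_rev)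
  obtain cs l p where a: "lift_align_rev (rev t) (rev s) = (cs, l, p)" by (metis prod_cases3)
  note A = lift_align_rinw[OF desc a]
  have r: "rinw (rev s) (rev t) = (rev t', rev s')" using rinw_insw[OF assms(1,3,4,5)] .
  then have l: "l = []" using A assms(5) by auto
  have res: "rev t' = lift_top cs @ p" "rev s' = lift_out cs" using A r l by auto
  show ?thesis
  proof (cases "p = []")
    case False
    then have "last (rev t') = last (rev s)" using A res by simp
    then have e: "hd t' = hd s" using ne ne2 by (simp add: last_rev)
    have "\<not> hd s' < hd t'"
    proof
      assume "hd s' < hd t'"
      then have "hd s = hd s'" using insw_hd[OF assms(2) ne _ assms(4)] by simp
      then show False using e \<open>hd s' < hd t'\<close> by simp
    qed
    then show ?thesis using False a by (simp add: lift_pair_def)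
  next
    case True
    have "lift_columns cs" using lift_align_columns[OF desc _ a[unfolded True]] redts by simp
    then have "lift_run None (rev cs)" by (rule lift_columns_run)
    then have "lift_bottom None (rev cs) = s'" using res lift_bottom_run lift_out_rev[of cs] by (metis rev_rev_ident)
    moreover have "lift_top (rev cs) = t'" using res True by (simp add: lift_top_def rev_swap flip: rev_map)
    ultimately have lp: "lift_pair t s = (t', s')"
      using a True l lift_top_blocks[of "rev cs"] lift_bottom_blocks[of "rev cs" None]
      by (simp add: lift_pair_def Let_def)
    have "last (rev s) < last (rev t)" using hd ne2 by (simp add: last_rev)
    then have "last (rev t') = last (rev t)" "last (rev s') = last (rev s)"
      using A l True res ne2 by auto
    then have "hd s' < hd t'" using hd ne ne2 by (simp add: last_rev)
    then show ?thesis using lp by simp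
  qed
qed

text \<open>Applied to reversed rows this is right-justified weak domination, the case in which the
  lift alignment has no unmatched letters.\<close>

fun wbelow :: "nat list \<Rightarrow> nat list \<Rightarrow> bool" where
  "wbelow T [] = True"
| "wbelow [] (s # S) = False"
| "wbelow (t # T) (s # S) \<longleftrightarrow> s \<le> t \<and> wbelow T S"

lemma wbelow_append: "wbelow T S \<Longrightarrow> wbelow (T @ Q) S"
  by (induction T S rule: wbelow.induct) auto

lemma wbelow_snoc: "wbelow T S \<Longrightarrow> s \<le> r \<Longrightarrow> \<forall>x\<in>set T. s \<le> x \<Longrightarrow> wbelow (T @ [r]) (S @ [s])"
proof (induction T S rule: wbelow.induct)
  case (1 T) then show ?case by (cases T) auto
qed auto

lemma insw_all_bump_wbelow:
  "srt R \<Longrightarrow> srt w \<Longrightarrow> insw R w = (A, B) \<Longrightarrow> length B = length w \<Longrightarrow> wbelow (rev R) (rev w)"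
proof (induction R arbitrary: w A B)
  case Nil then show ?case by (simp add: insw_Nil)
next
  case (Cons r R)
  show ?case
  proof (cases w)
    case (Cons s w')
    obtain A1 B1 where 1: "insw R w' = (A1, B1)" by fastforce
    obtain A2 B2 where 2: "insw R (s # w') = (A2, B2)" by fastforce
    show ?thesis
    proof (cases "s \<le> r")
      case True
      then have "length B1 = length w'"
        using Cons.prems \<open>w = s # w'\<close> 1 insw_Cons[of s w' r R] by (auto simp del: insw.simps split: if_splits)
      then have "wbelow (rev R) (rev w')" using Cons.IH[OF _ _ 1] Cons.prems \<open>w = s # w'\<close> by simp
      moreover have "\<forall>x\<in>set (rev R). s \<le> x" using True Cons.prems(1) by fastforce
      ultimately show ?thesis using True \<open>w = s # w'\<close> wbelow_snoc[of "rev R" "rev w'" s r] by simp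
    next
      case False
      then have "length B2 = length w"
        using Cons.prems \<open>w = s # w'\<close> 2 insw_Cons[of s w' r R] by (auto simp del: insw.simps split: if_splits)
      then have "wbelow (rev R) (rev w)" using Cons.IH[OF _ _ 2] Cons.prems \<open>w = s # w'\<close> by simp
      then show ?thesis by (simp add: wbelow_append)
    qed
  qed simp
qed

lemma lift_align_wbelow:
  "wbelow \<tau> \<sigma> \<Longrightarrow> lift_align_rev \<tau> \<sigma> = (map Inr (zip \<tau> \<sigma>), drop (length \<sigma>) \<tau>, [])"
  by (induction \<tau> \<sigma> rule: wbelow.induct) auto

lemma wbelow_length: "wbelow T S \<Longrightarrow> length S \<le> length T"
  by (induction T S rule: wbelow.induct) auto

text \<open>If every letter of \<open>s\<close> bumps when inserted into \<open>t\<close>, each has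
  a distinct entry of \<open>t\<close> at least as large, even right-justified; the alignment then
  consists of pairs only.\<close>

lemma lift_pair_fixed:
  assumes "srt t" "srt s" "insw t s = (A, B)" "length B = length s"
  shows "lift_pair t s = (t, s)"
proof -
  have w: "wbelow (rev t) (rev s)" by (rule insw_all_bump_wbelow[OF assms])
  note len = wbelow_length[OF w]
  have f: "first_block (map Inr ps) = ps" "later_blocks (map Inr ps) = []" for ps by (induction ps) auto
  have "map fst (rev (zip (rev t) (rev s))) = rev (take (length s) (rev t))"
    using len by (simp add: rev_map[symmetric] map_fst_zip_take)
  moreover have "map snd (rev (zip (rev t) (rev s))) = s"
    using len by (simp add: rev_map[symmetric] map_snd_zip_take)
  moreover have "rev (drop (length s) (rev t)) @ rev (take (length s) (rev t)) = t"
    by (metis append_take_drop_id rev_append rev_rev_ident)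
  ultimately show ?thesis
    using lift_align_wbelow[OF w] by (simp add: lift_pair_def Let_def rev_map f)
qed

section \<open>The lift algorithm\<close>

lemma lift_at_form:
  "lift_at (length L) (L @ [s, t] @ U) = L @ [snd (lift_pair t s), fst (lift_pair t s)] @ U"
  by (simp add: lift_at_def nth_append list_update_append split: prod.split)

lemma split_pair: "Suc i < length T \<Longrightarrow> T = take i T @ [T ! i, T ! Suc i] @ drop (Suc (Suc i)) T"
  by (simp add: id_take_nth_drop Cons_nth_drop_Suc)

text \<open>If the lower row is not longer, all its letters bump and the lift is trivial by
  \<open>lift_pair_fixed\<close>. An effective lift therefore carries the greater length upward, and
  it preserves the first column.\<close>

lemma lift_at_arr:
  assumes P: "redtab P" and T: "arr P T" and ne: "lift_at i T \<noteq> T"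
  shows "Suc i < length T" "arr P (lift_at i T)" "length (T ! Suc i) < length (T ! i)"
    "length (lift_at i T ! Suc i) = length (T ! i)" "drop (Suc (Suc i)) (lift_at i T) = drop (Suc (Suc i)) T"
proof -
  show l: "Suc i < length T" using ne by (auto simp: lift_at_def split: if_splits)
  define L where "L = take i T"
  define s where "s = T ! i"
  define t where "t = T ! Suc i"
  define U where "U = drop (Suc (Suc i)) T"
  have Tf: "T = L @ [s, t] @ U" using split_pair[OF l] by (simp add: L_def s_def t_def U_def)
  have i: "i = length L" using l by (simp add: L_def)
  have e: "extremal (L @ [s, t] @ U)" using arr_extremal[OF P T] Tf by simp
  have st: "srt s" "srt t" "s \<noteq> []" "t \<noteq> []" "hd s < hd t"
    using T Tf by (auto simp: arr_def sorted_wrt_append)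
  have lt: "length t < length s"
  proof (rule ccontr)
    assume "\<not> length t < length s"
    moreover obtain A B where AB: "insw t s = (A, B)" by fastforce
    ultimately have "length B = length s" using extremal_pair(4)[OF e AB] by simp
    then have "lift_pair t s = (t, s)" by (rule lift_pair_fixed[OF st(2,1) AB])
    then show False using ne Tf i lift_at_form[of L s t U] by simp
  qed
  then show "length (T ! Suc i) < length (T ! i)" by (simp add: s_def t_def)
  obtain s' t' where sw: "insw t' s' = (s, t)" "srt s'" "srt t'" "length s' = length t" "length t' = length s"
    "red (t' @ s')" "ckeq (rrw (L @ [s, t] @ U)) (rrw (L @ [s', t'] @ U))" "extremal (L @ [s', t'] @ U)"
    using extremal_swap[OF e] lt by (metis less_imp_le)
  have ne': "s' \<noteq> []" "t' \<noteq> []" using sw(4,5) st by auto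
  note lp = lift_pair_swap[OF sw(3,2,6,1) sw(4)[symmetric] ne' st(5)]
  have h: "hd s' < hd t'"
  proof (rule ccontr)
    assume "\<not> hd s' < hd t'"
    then show False using lp ne Tf i lift_at_form[of L s t U] by simp
  qed
  then have lf: "lift_at i T = L @ [s', t'] @ U" using lp Tf i lift_at_form[of L s t U] by simp
  have hh: "hd s = hd s'" "hd t = hd t'" using insw_hd[OF sw(2) ne' h sw(1)] by auto
  show "arr P (lift_at i T)"
    using T Tf lf sw hh ne' ck_trans[OF _ sw(7)] by (auto simp: arr_def extremal_def)
  show "length (lift_at i T ! Suc i) = length (T ! i)" "drop (Suc (Suc i)) (lift_at i T) = drop (Suc (Suc i)) T"
    using lf i sw(5) by (auto simp: nth_append s_def U_def)
qed

lemma lift_at_drop: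
  assumes P: "redtab P" and T: "arr P (L @ [s, t] @ U)" and lt: "length s < length t" and AB: "insw t s = (A, B)"
  shows "lift_at (length L) (L @ [A, B] @ U) = L @ [s, t] @ U"
proof -
  note d = arr_drop[OF P T lt AB]
  have st: "srt s" "srt t" "s \<noteq> []" "t \<noteq> []" "hd s < hd t"
    using T by (auto simp: arr_def sorted_wrt_append)
  have red: "red (t @ s)" using arr_extremal[OF P T] red_middle[of "rrw U" "t @ s" "rrw L"] by (simp add: extremal_def)
  have "lift_pair B A = (t, s)"
    using lift_pair_swap[OF st(2,1) red AB d(3) st(3,4)] d(4,5) st(5) by simp
  then show ?thesis using lift_at_form[of L A B U] by simp
qed

lemma lift_range_same [simp]: "lift_range i i T = T" by (simp add: lift_range_def)
lemma lift_range_Suc: "i \<le> j \<Longrightarrow> lift_range i (Suc j) T = lift_at j (lift_range i j T)" by (simp add: lift_range_def)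

definition decr :: "nat \<Rightarrow> nat list list \<Rightarrow> bool" where
  "decr j T \<longleftrightarrow> (\<forall>k. Suc k < j \<longrightarrow> length (T ! Suc k) \<le> length (T ! k))"

lemma decr_le: "decr j T \<Longrightarrow> k \<le> l \<Longrightarrow> l < j \<Longrightarrow> length (T ! l) \<le> length (T ! k)"
proof (induction l)
  case (Suc l)
  then show ?case by (cases "k = Suc l") (auto simp: decr_def intro: le_trans)
qed simp

lemma sort_down:
  "redtab P \<Longrightarrow> arr P T \<Longrightarrow> j \<le> length T \<Longrightarrow> \<exists>T'. arr P T' \<and> drop j T' = drop j T \<and> decr j T'"
proof (induction "wt T" arbitrary: T rule: less_induct)
  case less
  note P = less.prems(1)
  show ?case
  proof (cases "decr j T")
    case False
    then obtain k where k: "Suc k < j" "length (T ! k) < length (T ! Suc k)" by (auto simp: decr_def not_le)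
    define L where "L = take k T"
    define U where "U = drop (Suc (Suc k)) T"
    have T: "T = L @ [T ! k, T ! Suc k] @ U" using split_pair[of k T] k less.prems(3) by (simp add: L_def U_def)
    obtain A B where AB: "insw (T ! Suc k) (T ! k) = (A, B)" by fastforce
    have a: "arr P (L @ [T ! k, T ! Suc k] @ U)" using less.prems(2) T by simp
    note d = arr_drop[OF P a k(2) AB]
    have "wt (L @ [A, B] @ U) < wt (L @ [T ! k, T ! Suc k] @ U)" by (rule wt_swap) (use d k in auto)
    moreover have dr: "drop j (L @ [A, B] @ U) = drop j T"
    proof -
      have "length L = k" using k less.prems(3) by (simp add: L_def)
      moreover obtain m where "j = Suc (Suc k) + m" using k(1) le_Suc_ex[of "Suc (Suc k)" j] by auto
      ultimately have "drop j (L @ [x, y] @ U) = drop m U" for x y by simp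
      then show ?thesis using T by metis
    qed
    moreover have "length (L @ [A, B] @ U) = length T" using arg_cong[OF T, of length] by simp
    ultimately show ?thesis using less.hyps[of "L @ [A, B] @ U"] P d(1) T less.prems(3) by metis
  qed (use less in blast)
qed

text \<open>Row \<open>j\<close> is dropped past shorter rows until the initial rows are sorted, and
  lifts from the landing row \<open>i\<close> retrace this. The clause on lower bounds
  \<open>b\<close> keeps the lengths below from falling under that of the row just passed, so the
  enlarged initial part stays sorted.\<close>

lemma push_down:
  "redtab P \<Longrightarrow> arr P T' \<Longrightarrow> j < length T' \<Longrightarrow> decr j T' \<Longrightarrow>
    \<exists>i T. i \<le> j \<and> arr P T \<and> drop (Suc j) T = drop (Suc j) T' \<and> decr (Suc j) T \<and> lift_range i j T = T' \<and>
      (\<forall>m\<in>{i..<j}. lift_at m (lift_range i m T) \<noteq> lift_range i m T) \<and> length (T ! i) = length (T' ! j) \<and>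
      (\<forall>b. (\<forall>k\<le>j. b \<le> length (T' ! k)) \<longrightarrow> (\<forall>k\<le>j. b \<le> length (T ! k)))"
proof (induction j arbitrary: T')
  case 0
  then show ?case by (intro exI[of _ 0] exI[of _ T']) (auto simp: decr_def)
next
  case (Suc j)
  show ?case
  proof (cases "length (T' ! Suc j) \<le> length (T' ! j)")
    case True
    then have "decr (Suc (Suc j)) T'" using Suc.prems(4) by (auto simp: decr_def less_Suc_eq)
    then show ?thesis using Suc.prems by (intro exI[of _ "Suc j"] exI[of _ T']) auto
  next
    case False
    define L where "L = take j T'"
    define s where "s = T' ! j"
    define t where "t = T' ! Suc j"
    define U where "U = drop (Suc (Suc j)) T'"
    have T': "T' = L @ [s, t] @ U" using split_pair[OF Suc.prems(3)] by (simp add: L_def s_def t_def U_def)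
    have lL: "length L = j" using Suc.prems(3) by (simp add: L_def)
    have lt: "length s < length t" using False by (simp add: s_def t_def)
    obtain A B where AB: "insw t s = (A, B)" by fastforce
    have a: "arr P (L @ [s, t] @ U)" using Suc.prems(2) T' by simp
    note d = arr_drop[OF Suc.prems(1) a lt AB]
    note undo = lift_at_drop[OF Suc.prems(1) a lt AB]
    define T2 where "T2 = L @ [A, B] @ U"
    have nth: "T2 ! k = T' ! k" if "k < j" for k using that T' lL by (simp add: T2_def nth_append)
    have T2j: "T2 ! j = A" "T2 ! Suc j = B" using lL by (auto simp: T2_def nth_append)
    have "decr j T'" "decr j T2" using Suc.prems(4) nth by (auto simp: decr_def)
    moreover have "j < length T2" using Suc.prems(3) T' by (simp add: T2_def lL)
    ultimately obtain i T where IH: "i \<le> j" "arr P T" "drop (Suc j) T = drop (Suc j) T2" "decr (Suc j) T" "lift_range i j T = T2"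
      "\<forall>m\<in>{i..<j}. lift_at m (lift_range i m T) \<noteq> lift_range i m T" "length (T ! i) = length (T2 ! j)"
      "\<forall>b. (\<forall>k\<le>j. b \<le> length (T2 ! k)) \<longrightarrow> (\<forall>k\<le>j. b \<le> length (T ! k))"
      using Suc.IH[OF Suc.prems(1), of T2] d(1) by (auto simp: T2_def)
    have lT: "length T = length T'" using arr_length[OF Suc.prems(1)] IH(2) Suc.prems(2) by metis
    have Tj: "T ! Suc j = B"
    proof -
      have "T ! Suc j = hd (drop (Suc j) T)" using lT Suc.prems(3) by (simp add: hd_drop_conv_nth)
      also have "\<dots> = B" using IH(3) by (simp add: T2_def lL)
      finally show ?thesis .
    qed
    have bT2: "\<forall>k\<le>j. length s \<le> length (T2 ! k)"
    proof (intro allI impI)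
      fix k assume "k \<le> j"
      then show "length s \<le> length (T2 ! k)"
        using nth[of k] T2j d(2) lt decr_le[OF Suc.prems(4), of k j] by (cases "k = j") (auto simp: s_def)
    qed
    then have sj: "length s \<le> length (T ! j)" using IH(8) by blast
    have "decr (Suc (Suc j)) T" using IH(4) sj Tj d(3) by (auto simp: decr_def less_Suc_eq)
    moreover have "lift_range i (Suc j) T = T'" using lift_range_Suc[OF IH(1)] IH(5) undo lL T' by (simp add: T2_def)
    moreover have "T' \<noteq> T2" using T2j d(2) lt by (auto simp: s_def)
    then have "\<forall>m\<in>{i..<Suc j}. lift_at m (lift_range i m T) \<noteq> lift_range i m T"
      using IH(5,6) undo lL T' by (auto simp: less_Suc_eq T2_def)
    moreover have "drop (Suc (Suc j)) T = drop (Suc (Suc j)) T'"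
      using IH(3) T' lL by (metis (no_types, lifting) T2_def U_def append_assoc append_eq_conv_conj drop_Suc drop_Suc_Cons
          drop_drop length_append list.size(3,4) plus_1_eq_Suc Suc_eq_plus1 add.commute append_Cons append_Nil drop0 tl_drop)
    moreover have "length (T ! i) = length (T' ! Suc j)" using IH(7) T2j d(2) by (simp add: t_def)
    moreover have "\<forall>k\<le>Suc j. b \<le> length (T ! k)" if b: "\<forall>k\<le>Suc j. b \<le> length (T' ! k)" for b
    proof -
      have bs: "b \<le> length s" "b \<le> length t" using b by (auto simp: s_def t_def)
      have "\<forall>k\<le>j. b \<le> length (T2 ! k)"
        using bT2 bs(1) le_trans by blast
      then have "\<forall>k\<le>j. b \<le> length (T ! k)" using IH(8) by blast
      then show ?thesis using Tj d(3) bs by (auto simp: le_Suc_eq)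
    qed
    ultimately show ?thesis using IH(1,2) by (intro exI[of _ i] exI[of _ T]) auto
  qed
qed

lemma desc_eq:
  "sorted_wrt (\<ge>) xs \<Longrightarrow> sorted_wrt (\<ge>) ys \<Longrightarrow> \<forall>x\<in>set xs \<union> set ys. 0 < x \<Longrightarrow>
    (\<And>c. length (filter (\<lambda>x. c < x) xs) = length (filter (\<lambda>x. (c::nat) < x) ys)) \<Longrightarrow> xs = ys"
proof (induction xs arbitrary: ys)
  case Nil
  then show ?case using Nil.prems(4)[of 0] by (cases ys) auto
next
  case (Cons x xs)
  have "ys \<noteq> []" using Cons.prems(4)[of 0] Cons.prems(3) by auto
  then obtain y ys' where ys: "ys = y # ys'" by (cases ys) auto
  have none: "filter (\<lambda>z. u < z) zs = []" if "sorted_wrt (\<ge>) (u # zs)" for u :: nat and zs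
    using that by (auto simp: filter_empty_conv not_less)
  have "x = y"
  proof (rule ccontr)
    assume "x \<noteq> y"
    then consider "x < y" | "y < x" by linarith
    then show False
    proof cases
      case 1 then show False using Cons.prems(4)[of x] none[OF Cons.prems(1)] ys by simp
    next
      case 2 then show False using Cons.prems(4)[of y] none[of y ys'] Cons.prems(2) ys by simp
    qed
  qed
  moreover have "length (filter (\<lambda>x. c < x) xs) = length (filter (\<lambda>x. c < x) ys')" for c
    using Cons.prems(4)[of c] ys \<open>x = y\<close> by (simp split: if_splits)
  ultimately show ?case using Cons ys by auto
qed

lemma decr_sorted: "decr j T \<Longrightarrow> j \<le> length T \<Longrightarrow> sorted_wrt (\<ge>) (map length (take j T))"
  using decr_le[of j T] by (auto simp: sorted_wrt_iff_nth_less)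

lemma arr_eq_lengths:
  assumes P: "redtab P" and T: "arr P T" "arr P T2" and d: "drop j T = drop j T2" "decr j T" "decr j T2" "j \<le> length T"
  shows "T = T2"
proof (rule arr_unique[OF P T])
  have l: "length T = length T2" using arr_length[OF P] T by metis
  have cn: "cn c (take j T) = cn c (take j T2)" for c
  proof -
    have "cn c (take j T @ drop j T) = cn c (take j T2 @ drop j T2)" using arr_cn[OF P] T by simp
    then show ?thesis using d(1) by (simp del: append_take_drop_id)
  qed
  have "map length (take j T) = map length (take j T2)"
  proof (rule desc_eq)
    show "\<forall>x\<in>set (map length (take j T)) \<union> set (map length (take j T2)). 0 < x"
      using T set_take_subset by (fastforce simp: arr_def)
    have "length (filter (\<lambda>x. c < x) (map length Q)) = cn c Q" for c Q by (simp add: cn_def filter_map o_def)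
    then show "length (filter (\<lambda>x. c < x) (map length (take j T))) = length (filter (\<lambda>x. c < x) (map length (take j T2)))" for c
      using cn by simp
  qed (use decr_sorted d l in auto)
  then have "map length (take j T @ drop j T) = map length (take j T2 @ drop j T2)" using d(1) unfolding map_append by simp
  then show "map length T = map length T2" by simp
qed

text \<open>Each effective step moves the length of the original row \<open>i\<close> up by one row,
  past a strictly shorter row.\<close>

lemma faithful_push:
  "redtab P \<Longrightarrow> arr P T \<Longrightarrow> i \<le> j \<Longrightarrow> faithful i j T \<Longrightarrow>
    Suc j < length T \<and> arr P (lift_range i (Suc j) T) \<and>
    drop (Suc (Suc j)) (lift_range i (Suc j) T) = drop (Suc (Suc j)) T \<and>
    length (lift_range i (Suc j) T ! Suc j) = length (T ! i) \<and> (\<forall>k. i < k \<and> k \<le> Suc j \<longrightarrow> length (T ! k) < length (T ! i))"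
proof (induction j)
  case 0
  then have "lift_at 0 T \<noteq> T" by (simp add: faithful_def)
  note l = lift_at_arr[OF 0(1,2) this]
  show ?case using l 0 by (auto simp: lift_range_Suc le_Suc_eq)
next
  case (Suc j)
  show ?case
  proof (cases "i = Suc j")
    case True
    then have "lift_at i T \<noteq> T" using Suc.prems(4) by (auto simp: faithful_def)
    note l = lift_at_arr[OF Suc.prems(1,2) this]
    show ?thesis using l True by (auto simp: lift_range_Suc le_Suc_eq)
  next
    case False
    then have i: "i \<le> j" using Suc.prems by simp
    have f: "faithful i j T" using Suc.prems(4) by (auto simp: faithful_def)
    define T2 where "T2 = lift_range i (Suc j) T"
    note IH = Suc.IH[OF Suc.prems(1,2) i f, folded T2_def]
    have ne: "lift_at (Suc j) T2 \<noteq> T2" using Suc.prems(3,4) by (auto simp: faithful_def T2_def)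
    have a2: "arr P T2" using IH by blast
    note l = lift_at_arr[OF Suc.prems(1) a2 ne]
    have len: "length T2 = length T" using arr_length[OF Suc.prems(1)] a2 Suc.prems(2) by metis
    have n: "T2 ! Suc (Suc j) = T ! Suc (Suc j)"
      using IH l(1) len by (metis hd_drop_conv_nth)
    have "lift_range i (Suc (Suc j)) T = lift_at (Suc j) T2" using lift_range_Suc[of i "Suc j" T] i by (simp add: T2_def)
    moreover have "drop (Suc (Suc (Suc j))) T2 = drop (Suc (Suc (Suc j))) T"
      using IH by (metis drop_Suc drop_Suc_Cons tl_drop)
    ultimately show ?thesis using IH l len n by (auto simp: le_Suc_eq)
  qed
qed

lemma arr_heads: "redtab P \<Longrightarrow> 0 \<notin> set (rrw P) \<Longrightarrow> arr P T \<Longrightarrow> heads T = heads P"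
proof -
  assume P: "redtab P" and 0: "0 \<notin> set (rrw P)" and T: "arr P T"
  have "set (rrw T) = set (rrw P)" using T ck_set by (auto simp: arr_def)
  then have "set (heads (eg (rrw T))) = set (heads T)"
    using heads_eg[OF arr_extremal[OF P T]] T 0 by (simp add: arr_def)
  then have s: "set (heads P) = set (heads T)" using arr_eg[OF P T] by simp
  have "srt (heads P)" "srt (heads T)" using srt_heads P T by (auto simp: redtab_def arr_def)
  then show ?thesis using s by (metis strict_sorted_equal)
qed

section \<open>Comparison of the lift sequence with the canonical array\<close>

lemma canon_bound:
  assumes P: "redtab P" "0 \<notin> set (rrw P)" and C: "canon P C" and T: "arr P T"
  shows "cn c (drop k T) \<le> cn c (drop k C)"
proof -
  have aC: "arr P C" using C by (simp add: canon_def)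
  have h: "heads (drop k T) = heads (drop k C)" using arr_heads[OF P T] arr_heads[OF P aC] by (simp flip: drop_map)
  have "cn c (drop k T) \<le> card (K c P \<inter> set (heads (drop k T)))"
    using arr_bound[OF P, of "take k T" "drop k T"] T by simp
  also have "\<dots> = cn c (drop k C)" unfolding h
  proof (rule cn_heads[symmetric])
    have "distinct (heads C)" using aC strict_sorted_iff by (auto simp: arr_def)
    then show "distinct (heads (drop k C))" by (simp flip: drop_map)
    show "\<forall>R\<in>set (drop k C). c < length R \<longleftrightarrow> hd R \<in> K c P"
      using C set_drop_subset[of k C] by (auto simp: canon_def)
  qed
  finally show ?thesis .
qed

lemma cn_drop: "k < length T \<Longrightarrow> cn c (drop k T) = (if c < length (T ! k) then 1 else 0) + cn c (drop (Suc k) T)"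
  by (simp add: Cons_nth_drop_Suc[symmetric])

lemma drop_eq_le: "drop j T = drop j T2 \<Longrightarrow> j \<le> k \<Longrightarrow> drop k T = drop k T2"
  by (metis drop_drop le_add_diff_inverse2)

text \<open>The lifted array still belongs to the class and agrees with \<open>C\<close> above row
  \<open>Suc j\<close>, where the length of row \<open>i\<close> has arrived. By
  \<open>canon_bound\<close> it cannot exceed the length of that row in \<open>C\<close>.\<close>

lemma faithful_bound:
  assumes P: "redtab P" "0 \<notin> set (rrw P)" and C: "canon P C" and T: "arr P T"
    and f: "i \<le> j" "faithful i j T" and d: "drop (Suc (Suc j)) T = drop (Suc (Suc j)) C"
  shows "length (T ! i) \<le> length (C ! Suc j)" "Suc j < length T"
proof -
  define T2 where "T2 = lift_range i (Suc j) T"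
  note p = faithful_push[OF P(1) T f, folded T2_def]
  have aC: "arr P C" using C by (simp add: canon_def)
  have a2: "arr P T2" using p by blast
  have len: "length T2 = length T" "length C = length T" using arr_length[OF P(1)] a2 aC T by metis+
  show "Suc j < length T" using p by blast
  \<comment> \<open>Columns are numbered from 0, so this is the last column that row
    \<open>i\<close> reaches.\<close>
  define c where "c = length (T ! i) - 1"
  have "0 < length (T ! i)" using p f(1) by (metis gr_zeroI less_nat_zero_code le_imp_less_Suc order_refl)
  then have c: "c < length (T ! i)" by (simp add: c_def)
  have "cn c (drop (Suc j) T2) \<le> cn c (drop (Suc j) C)" by (rule canon_bound[OF P C a2])
  then have "c < length (C ! Suc j)"
    using cn_drop[of "Suc j" T2 c] cn_drop[of "Suc j" C c] p len d c by (auto split: if_splits)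
  then show "length (T ! i) \<le> length (C ! Suc j)" by (simp add: c_def)
qed

text \<open>The rows from index \<open>j\<close> on are final and the rows before are sorted;
  \<open>j\<close> decreases from the number of rows to 0.\<close>

definition lift_state :: "nat list list \<Rightarrow> nat list list \<Rightarrow> nat \<Rightarrow> nat list list \<Rightarrow> bool" where
  "lift_state P C j T \<longleftrightarrow> arr P T \<and> drop j T = drop j C \<and> decr j T \<and> j \<le> length T"

text \<open>A faithful sequence reaching a final row would place there a length greater than that of
  the canonical row, against \<open>faithful_bound\<close>.\<close>

lemma lift_state_faithful:
  assumes P: "redtab P" "0 \<notin> set (rrw P)" and C: "canon P C" and T: "lift_state P C j T"
    and f: "i \<le> k" "faithful i k T"
  shows "Suc k < j"
proof (rule ccontr)
  assume k: "\<not> Suc k < j"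
  have a: "arr P T" "drop j T = drop j C" using T by (auto simp: lift_state_def)
  have d: "drop (Suc k) T = drop (Suc k) C" "drop (Suc (Suc k)) T = drop (Suc (Suc k)) C"
    using drop_eq_le[OF a(2)] k by auto
  note b = faithful_bound[OF P C a(1) f d(2)]
  have "length C = length T" using arr_length[OF P(1)] C a(1) by (metis canon_def)
  then have "C ! Suc k = T ! Suc k" using d(1) b(2) by (metis hd_drop_conv_nth)
  moreover have "length (T ! Suc k) < length (T ! i)" using faithful_push[OF P(1) a(1) f] f(1) by auto
  ultimately show False using b(1) by simp
qed

text \<open>The next state is known in advance: \<open>B\<close> arises from \<open>C\<close> by
  sorting the rows below \<open>j\<close>. Pushing row \<open>j\<close> of \<open>B\<close> down
  yields \<open>T\<close> by uniqueness, so the retracing lifts lead from \<open>T\<close> to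
  \<open>B\<close>; it remains to see that \<open>lift_step\<close> chooses these lifts, unless
  \<open>T = B\<close>.\<close>

lemma lift_state_step:
  assumes P: "redtab P" "0 \<notin> set (rrw P)" and C: "canon P C" and T: "lift_state P C (Suc j) T"
  shows "lift_state P C j T \<or> (\<exists>i. lift_at i T \<noteq> T) \<and> lift_state P C j (lift_step T)"
proof -
  have aC: "arr P C" using C by (simp add: canon_def)
  have a: "arr P T" "drop (Suc j) T = drop (Suc j) C" "decr (Suc j) T" "j < length T" using T by (auto simp: lift_state_def)
  have lC: "length C = length T" using arr_length[OF P(1)] aC a(1) by metis
  obtain B where B: "arr P B" "drop j B = drop j C" "decr j B" using sort_down[OF P(1) aC, of j] a(4) lC by auto
  have lB: "length B = length T" using arr_length[OF P(1)] B(1) a(1) by metis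
  obtain i S where S: "i \<le> j" "arr P S" "drop (Suc j) S = drop (Suc j) B" "decr (Suc j) S" "lift_range i j S = B"
    "\<forall>m\<in>{i..<j}. lift_at m (lift_range i m S) \<noteq> lift_range i m S" "length (S ! i) = length (B ! j)"
    using push_down[OF P(1) B(1) _ B(3)] a(4) lB by metis
  have "S = T"
  proof (rule arr_eq_lengths[OF P(1) S(2) a(1) _ S(4) a(3)])
    show "drop (Suc j) S = drop (Suc j) T" using S(3) drop_eq_le[OF B(2), of "Suc j"] a(2) by simp
    show "Suc j \<le> length S" using arr_length[OF P(1)] S(2) a(1,4) by (metis Suc_leI)
  qed
  have stB: "lift_state P C j B" using B lB a(4) by (simp add: lift_state_def)
  show ?thesis
  proof (cases "i = j")
    case True
    then show ?thesis using S(5) \<open>S = T\<close> stB by simp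
  next
    case False
    then obtain j1 where j: "j = Suc j1" "i \<le> j1" using S(1) by (cases j) auto
    have f: "faithful i j1 T" using S(6) j \<open>S = T\<close> by (auto simp: faithful_def)
    \<comment> \<open>Anything beyond \<open>j1\<close> would end in a final row.\<close>
    have G: "(GREATEST j. \<exists>i\<le>j. faithful i j T) = j1"
    proof (rule Greatest_equality)
      show "\<exists>i\<le>j1. faithful i j1 T" using f j by blast
      fix k assume "\<exists>i\<le>k. faithful i k T"
      then show "k \<le> j1" using lift_state_faithful[OF P C T] j by fastforce
    qed
    \<comment> \<open>Starting at a lower row would lift a length strictly greater than that of row
      \<open>i\<close>, which already equals the length of the canonical row
      \<open>j\<close>.\<close>
    have "(LEAST i. i \<le> j1 \<and> faithful i j1 T) = i"
    proof (rule Least_equality)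
      show "i \<le> j1 \<and> faithful i j1 T" using f j by simp
      fix i' assume i': "i' \<le> j1 \<and> faithful i' j1 T"
      show "i \<le> i'"
      proof (rule ccontr)
        assume n: "\<not> i \<le> i'"
        have "length (T ! i') \<le> length (C ! Suc j1)"
          using faithful_bound(1)[OF P C a(1)] i' a(2) j by simp
        moreover have "C ! j = B ! j" using B(2) lB lC a(4) by (metis hd_drop_conv_nth)
        moreover have "length (T ! i) < length (T ! i')"
          using faithful_push[OF P(1) a(1), of i' j1] i' n j by auto
        ultimately show False using S(7) \<open>S = T\<close> j by simp
      qed
    qed
    then have "lift_step T = B" using G S(5) \<open>S = T\<close> j by (simp add: lift_step_def Let_def)
    moreover have "lift_at i T \<noteq> T" using f j(2) by (metis atLeastAtMost_iff faithful_def lift_range_same order_refl)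
    ultimately show ?thesis using stB by blast
  qed
qed

lemma lift_state_while:
  assumes P: "redtab P" "0 \<notin> set (rrw P)" and C: "canon P C"
  shows "lift_state P C j T \<Longrightarrow> while (\<lambda>T. \<exists>i. lift_at i T \<noteq> T) lift_step T = C"
proof (induction j arbitrary: T)
  case 0
  have "\<not> (\<exists>i. lift_at i T \<noteq> T)"
  proof
    assume "\<exists>i. lift_at i T \<noteq> T"
    then obtain i where "faithful i i T" by (auto simp: faithful_def)
    then show False using lift_state_faithful[OF P C 0, of i i] by simp
  qed
  moreover have "T = C" using 0 by (simp add: lift_state_def)
  ultimately show ?case by (subst while_unfold) simp
next
  case (Suc j)
  consider "lift_state P C j T" | "\<exists>i. lift_at i T \<noteq> T" "lift_state P C j (lift_step T)"
    using lift_state_step[OF P C Suc.prems] by blast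
  then show ?case
  proof cases
    case 1 then show ?thesis by (rule Suc.IH)
  next
    case 2
    then show ?thesis using Suc.IH[OF 2(2)] by (subst while_unfold) simp
  qed
qed

theorem lift_tableau_canon:
  assumes P: "redtab P" "0 \<notin> set (rrw P)" and C: "canon P C"
  shows "lift_tableau P = C"
proof -
  have "length C = length P" using arr_length[OF P(1)] C by (simp add: canon_def)
  moreover have "decr (length P) P"
    using P(1) increasing_tableau_tab[of P] by (auto simp: decr_def redtab_def increasing_tableau_def)
  ultimately have "lift_state P C (length P) P" using arr_self[OF P(1)] by (simp add: lift_state_def)
  then show ?thesis unfolding lift_tableau_def by (rule lift_state_while[OF P C])
qed

section \<open>Drop recovers the tableau\<close>

lemma drop_at_form:
  assumes "srt t" "srt s" "red (t @ s)" "insw t s = (A, B)"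
  shows "drop_at (length L) (L @ [s, t] @ U) = L @ [A, B] @ U"
  using drop_pair_insw[OF assms(1-3)] assms(4) by (simp add: drop_at_def nth_append list_update_append)

lemma below_violation:
  "(length s < length t \<or> (\<exists>j<min (length s) (length t). t ! j \<le> s ! j)) \<longleftrightarrow> \<not> below s t"
  by (auto simp: below_nth not_le not_less) (meson le_less_trans not_less)

text \<open>Unlike \<open>arr\<close> this leaves lengths and first letters free and allows empty
  rows, because an arbitrary sequence of drops may pass through such arrays.\<close>

definition in_class :: "nat list list \<Rightarrow> nat list list \<Rightarrow> bool" where
  "in_class P S \<longleftrightarrow> rows_ok S \<and> ckeq (rrw P) (rrw S)"

lemma drop_step_class:
  assumes P: "redtab P" and S: "in_class P S" and k: "Suc k < length S" and v: "\<not> below (S ! k) (S ! Suc k)"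
  shows "in_class P (drop_at k S)" "wt (drop_at k S) < wt S"
proof -
  define L where "L = take k S"
  define s where "s = S ! k"
  define t where "t = S ! Suc k"
  define U where "U = drop (Suc (Suc k)) S"
  have Sf: "S = L @ [s, t] @ U" using split_pair[OF k] by (simp add: L_def s_def t_def U_def)
  have lL: "length L = k" using k by (simp add: L_def)
  have ok: "srt s" "srt t" "rows_ok L" "rows_ok U" using S Sf by (auto simp: in_class_def)
  have "red (rrw S)" using P S ck_red by (auto simp: redtab_def in_class_def)
  then have red: "red (t @ s)" using Sf red_middle[of "rrw U" "t @ s" "rrw L"] by simp
  obtain A B where AB: "insw t s = (A, B)" by fastforce
  have d: "drop_at k S = L @ [A, B] @ U" using drop_at_form[OF ok(2,1) red AB, of L U] Sf lL by simp
  have "ckeq (t @ s) (B @ A)" using insw_ckeq[OF ok(2) red] AB by simp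
  then have "ckeq (rrw S) (rrw (L @ [A, B] @ U))" using ck_ctx[of "t @ s" "B @ A" "rrw U" "rrw L"] Sf by simp
  moreover have "srt A" "srt B" using insw_srt[OF ok(2), of s] insw_out[OF ok(1,2) AB] AB by auto
  ultimately show "in_class P (drop_at k S)" using S d ok ck_trans by (auto simp: in_class_def)
  note l = insw_length[OF ok(1) AB]
  have "length A \<noteq> length s" using insw_no_move[OF ok(2,1) red AB] v by (auto simp: s_def t_def)
  then show "wt (drop_at k S) < wt S" unfolding d using Sf wt_swap[of A B s t L U] l by simp
qed

text \<open>If no neighbouring pair violates \<open>below\<close>, only empty rows can stand above
  an empty row, so deleting empty rows creates no new neighbours.\<close>

lemma nonempty_rows_tab:
  "rows_ok S \<Longrightarrow> (\<And>k. Suc k < length S \<Longrightarrow> below (S ! k) (S ! Suc k)) \<Longrightarrow> tab (nonempty_rows S)"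
proof (induction S)
  case (Cons R S)
  have d: "below (S ! k) (S ! Suc k)" if "Suc k < length S" for k using Cons.prems(2)[of "Suc k"] that by simp
  then have IH: "tab (nonempty_rows S)" using Cons by simp
  have e: "nonempty_rows S = []" if "S = [] \<or> hd S = []"
    using that d
  proof (induction S)
    case (Cons a S)
    have "below ((a # S) ! k) ((a # S) ! Suc k)" if "Suc k < length (a # S)" for k using Cons.prems(2)[OF that] .
    note dd = this
    have "S = [] \<or> hd S = []" using dd[of 0] Cons.prems(1) by (cases S; cases "hd S") auto
    moreover have "below (S ! k) (S ! Suc k)" if "Suc k < length S" for k using dd[of "Suc k"] that by simp
    ultimately show ?case using Cons.IH Cons.prems(1) by (simp add: nonempty_rows_def)
  qed (simp add: nonempty_rows_def)
  show ?case
  proof (cases "S \<noteq> [] \<and> hd S \<noteq> []")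
    case False
    then have "nonempty_rows S = []" using e by blast
    then show ?thesis using Cons.prems(1) by (simp add: nonempty_rows_def)
  next
    case True
    then obtain S0 S1 where S: "S = S0 # S1" "S0 \<noteq> []" by (cases S) auto
    then have "below R S0" using Cons.prems(2)[of 0] by simp
    then show ?thesis using IH S Cons.prems(1) below_hd[of R S0] by (simp add: nonempty_rows_def)
  qed
qed (simp add: nonempty_rows_def)

lemma drop_steps_exist:
  "redtab P \<Longrightarrow> in_class P S \<Longrightarrow> \<exists>S'. drop_step\<^sup>*\<^sup>* S S' \<and> tab (nonempty_rows S')"
proof (induction "wt S" arbitrary: S rule: less_induct)
  case less
  show ?case
  proof (cases "tab (nonempty_rows S)")
    case False
    then obtain k where k: "Suc k < length S" "\<not> below (S ! k) (S ! Suc k)"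
      using nonempty_rows_tab[of S] less.prems(2) by (auto simp: in_class_def)
    have "drop_step S (drop_at k S)"
      unfolding drop_step_def using k below_violation[of "S ! k" "S ! Suc k"] False increasing_tableau_tab by blast
    moreover obtain S' where "drop_step\<^sup>*\<^sup>* (drop_at k S) S'" "tab (nonempty_rows S')"
      using less.hyps[OF drop_step_class(2)[OF less.prems k] less.prems(1) drop_step_class(1)[OF less.prems k]] by blast
    ultimately show ?thesis using converse_rtranclp_into_rtranclp by metis
  qed blast
qed

lemma drop_steps_class: "drop_step\<^sup>*\<^sup>* S S' \<Longrightarrow> redtab P \<Longrightarrow> in_class P S \<Longrightarrow> in_class P S'"
proof (induction rule: rtranclp_induct)
  case (step S1 S2)
  then obtain k where k: "Suc k < length S1" "S2 = drop_at k S1" "\<not> below (S1 ! k) (S1 ! Suc k)"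
    using below_violation unfolding drop_step_def by blast
  then show ?case using drop_step_class(1)[OF step.prems(1) _ k(1,3)] step by simp
qed

lemma rrw_nonempty: "rrw (nonempty_rows S) = rrw S"
  by (induction S) (auto simp: nonempty_rows_def)

text \<open>Every drop keeps the reading word in its class, and a tableau is recovered from any word
  of its class by insertion. So all orders of drops end at the same tableau.\<close>

lemma drop_tableau_class:
  assumes P: "redtab P" and S: "in_class P (runs \<pi>)"
  shows "drop_tableau \<pi> = P"
proof -
  have uniq: "nonempty_rows S' = P" if "drop_step\<^sup>*\<^sup>* (runs \<pi>) S'" "tab (nonempty_rows S')" for S'
  proof -
    have "in_class P S'" using drop_steps_class[OF that(1) P S] .
    then have "eg (rrw S') = P" using eg_ckeq_eq[of "rrw P" "rrw S'"] eg_rrw[of P] P by (simp add: in_class_def redtab_def)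
    then show ?thesis using eg_rrw[OF that(2)] by (simp add: rrw_nonempty)
  qed
  obtain S' where "drop_step\<^sup>*\<^sup>* (runs \<pi>) S'" "tab (nonempty_rows S')" using drop_steps_exist[OF P S] by blast
  then show ?thesis unfolding drop_tableau_def increasing_tableau_tab
    by (intro the_equality) (use uniq in blast)+
qed

section \<open>Runs and descent compositions of arrays\<close>

lemma segments_row:
  "srt W \<Longrightarrow> W \<noteq> [] \<Longrightarrow> segments w = [] \<or> \<not> last W < hd (hd (segments w)) \<Longrightarrow> segments (W @ w) = W # segments w"
proof (induction W)
  case (Cons x W)
  show ?case
  proof (cases W)
    case Nil then show ?thesis using Cons.prems by (auto split: list.split)
  next
    case W: (Cons y W')
    then have "segments (W @ w) = W # segments w" using Cons by auto
    then show ?thesis using Cons.prems W by simp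
  qed
qed simp

lemma segments_concat:
  "\<forall>W\<in>set Ws. srt W \<and> W \<noteq> [] \<Longrightarrow> sorted_wrt (>) (map hd Ws) \<Longrightarrow> segments (concat Ws) = Ws"
proof (induction Ws)
  case (Cons W Ws)
  then have IH: "segments (concat Ws) = Ws" by simp
  have "Ws = [] \<or> \<not> last W < hd (hd Ws)"
  proof (cases Ws)
    case (Cons V Vs)
    then have "hd V < hd W" using Cons.prems by simp
    moreover have "hd W \<le> last W" using Cons.prems by (intro srt_hd_le) auto
    ultimately show ?thesis using Cons by simp
  qed simp
  then show ?case using segments_row[of W "concat Ws"] IH Cons.prems by simp
qed simp

text \<open>Heads increase upward, so in the reading word the last letter of each row exceeds the
  first letter of the row below, and every row boundary is a descent.\<close>

lemma runs_arr: "arr P T \<Longrightarrow> runs (rrw T) = T"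
  using segments_concat[of "rev T"]
  by (simp add: runs_def row_reading_word_def arr_def rows_ok_def rev_map[symmetric] sorted_wrt_rev)

text \<open>With strictly increasing heads the minimum is always the head itself, so no run is
  shifted.\<close>

lemma run_positions_heads:
  "rows_ok T \<Longrightarrow> \<forall>R\<in>set T. R \<noteq> [] \<Longrightarrow> srt (heads T) \<Longrightarrow> run_positions T = map int (heads T)"
proof (induction T rule: run_positions.induct)
  case (2 R)
  have "Min (set R) = hd R" by (rule Min_eqI) (use 2 srt_hd_le in auto)
  then show ?case by simp
next
  case (3 R S Rs)
  have "Min (set R) = hd R" by (rule Min_eqI) (use 3 srt_hd_le in auto)
  then show ?case using 3 by (simp add: Let_def)
qed simp

definition row_length :: "nat list list \<Rightarrow> nat \<Rightarrow> nat" where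
  "row_length T r = (\<Sum>i<length T. if map int (heads T) ! i = int r then length (T ! i) else 0)"

lemma des_arr:
  assumes "arr P T" "0 \<notin> set (rrw T)"
  shows "des (rrw T) = Some (row_length T)"
proof -
  have p: "run_positions T = map int (heads T)"
    using assms by (intro run_positions_heads) (auto simp: arr_def)
  have "0 < hd (hd T)" if ne: "T \<noteq> []"
  proof -
    obtain R T' where T: "T = R # T'" using ne by (cases T) auto
    then have "R \<noteq> []" using assms(1) by (simp add: arr_def)
    then show ?thesis using T assms(2) by (cases R) auto
  qed
  then show ?thesis
    unfolding des_def Let_def runs_arr[OF assms(1)] p by (auto simp: row_length_def fun_eq_iff hd_map)
qed

lemma row_length_canon:
  assumes "redtab P" "0 \<notin> set (rrw P)" "canon P T"
  shows "c < row_length T r \<longleftrightarrow> r \<in> K c P"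
proof (cases "r \<in> set (heads T)")
  case True
  then obtain i where i: "i < length T" "hd (T ! i) = r" by (auto simp: in_set_conv_nth)
  have "distinct (heads T)" using assms(3) strict_sorted_iff by (auto simp: canon_def arr_def)
  then have "hd (T ! j) = r \<longleftrightarrow> j = i" if "j < length T" for j
    using that i by (metis length_map nth_eq_iff_index_eq nth_map)
  then have "row_length T r = (\<Sum>j<length T. if j = i then length (T ! j) else 0)"
    unfolding row_length_def by (intro sum.cong) auto
  then have "row_length T r = length (T ! i)" using i by simp
  then show ?thesis using assms(3) i nth_mem[OF i(1)] by (auto simp: canon_def)
next
  case False
  then have "hd (T ! i) \<noteq> r" if "i < length T" for i using nth_mem[OF that] by auto
  then have "row_length T r = 0" unfolding row_length_def by simp
  moreover have "heads T = heads P" using arr_heads[OF assms(1,2)] assms(3) by (simp add: canon_def)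
  then have "r \<notin> K c P" using False K_subset[of c P] by (metis subsetD)
  ultimately show ?thesis by simp
qed

section \<open>The weak recording tableau\<close>

text \<open>Diagrams number their columns from 1, \<open>K\<close> from 0.\<close>

definition cells :: "nat list list \<Rightarrow> (nat \<times> nat) set" where
  "cells P = {(r, c). 1 \<le> c \<and> r \<in> K (c - 1) P}"

lemma K_positive: "0 \<notin> set (rrw P) \<Longrightarrow> tab P \<Longrightarrow> r \<in> K c P \<Longrightarrow> 0 < r"
proof -
  assume a: "0 \<notin> set (rrw P)" "tab P" "r \<in> K c P"
  then obtain R where R: "R \<in> set P" "r = hd R" using K_subset by fastforce
  then have "r \<in> set R" using tab_nonempty[OF a(2)] by simp
  then have "r \<in> set (rrw P)" using R by (auto simp: row_reading_word_def)
  then show "0 < r" using a(1) by (metis gr0I)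
qed

lemma eg_prefix:
  assumes "red (w @ [x])" "0 \<notin> set (w @ [x])"
  shows "redtab (eg w)" "0 \<notin> set (rrw (eg w))" "red (rrw (eg w) @ [x])" "eg (w @ [x]) = tins (eg w) x"
proof -
  have r: "red w" using assms(1) by (rule red_appendD1)
  show "redtab (eg w)" by (rule redtab_eg[OF r])
  show "0 \<notin> set (rrw (eg w))" using eg_positive assms(2) by simp
  show "red (rrw (eg w) @ [x])" using ck_red[OF ck_app[OF eg_ckeq[OF r] ck_refl]] assms(1) by blast
  show "eg (w @ [x]) = tins (eg w) x" by (simp add: eg_append)
qed

lemma canon_lift: "redtab P \<Longrightarrow> 0 \<notin> set (rrw P) \<Longrightarrow> canon P (lift_tableau P)"
  using canon_exists lift_tableau_canon by metis

text \<open>Dropping undoes the lift of the preceding step, so weak insertion performs ordinary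
  insertion and only the last lift remains visible.\<close>

lemma weak_P_eg: "red w \<Longrightarrow> 0 \<notin> set w \<Longrightarrow> weak_P w = rrw (lift_tableau (eg w))"
proof (induction w rule: rev_induct)
  case Nil
  have "redtab []" "canon [] []" by (auto simp: redtab_def canon_def arr_def red_def)
  then have "lift_tableau [] = []" using lift_tableau_canon by simp
  then show ?case by (simp add: weak_P_def eg_def)
next
  case (snoc x w)
  note e = eg_prefix[OF snoc.prems]
  define T where "T = lift_tableau (eg w)"
  have "weak_P w = rrw T" using snoc red_appendD1 by (simp add: T_def)
  then have s: "weak_P (w @ [x]) = rrw (lift_tableau (eg_insert (drop_tableau (rrw T)) x))"
    by (simp add: weak_P_def)
  have a: "arr (eg w) T" using canon_lift[OF e(1,2)] by (simp add: T_def canon_def)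
  then have "drop_tableau (rrw T) = eg w"
    by (intro drop_tableau_class[OF e(1)]) (simp add: runs_arr[OF a] in_class_def arr_def)
  moreover have "eg_insert (eg w) x = eg (w @ [x])"
    using eg_insert_tins[OF eg_ok e(3)] e(4) by simp
  ultimately show ?case using s by simp
qed

lemma des_weak_P:
  assumes "red w" "0 \<notin> set w"
  shows "\<exists>a. des (weak_P w) = Some a \<and> (\<forall>c r. c < a r \<longleftrightarrow> r \<in> K c (eg w)) \<and> key_diagram a = cells (eg w)"
proof -
  have P: "redtab (eg w)" "0 \<notin> set (rrw (eg w))" using redtab_eg eg_positive assms by auto
  define T where "T = lift_tableau (eg w)"
  have T: "canon (eg w) T" using canon_lift[OF P] by (simp add: T_def)
  have "set (rrw T) = set (rrw (eg w))" using T ck_set by (auto simp: canon_def arr_def)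
  then have d: "des (weak_P w) = Some (row_length T)"
    using des_arr[of "eg w" T] T P weak_P_eg[OF assms] by (simp add: canon_def T_def)
  note K = row_length_canon[OF P T]
  have "key_diagram (row_length T) = cells (eg w)"
    using K K_positive[OF P(2) tab_eg] by (auto simp: key_diagram_def cells_def Suc_le_eq[symmetric] K[symmetric])
  then show ?thesis using d K by blast
qed

lemma des_diagram_weak_P: "red w \<Longrightarrow> 0 \<notin> set w \<Longrightarrow> des_diagram (weak_P w) = cells (eg w)"
  using des_weak_P[of w] by (auto simp: des_diagram_def)

lemma weak_P_adds:
  assumes "red (w @ [x])" "0 \<notin> set (w @ [x])"
  shows "adds_cell (eg w) (eg (w @ [x]))"
  using tins_adds_cell[OF tab_eg eg_prefix(3)[OF assms]] eg_prefix(4)[OF assms] assms(2) by auto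

lemma cells_step:
  assumes "adds_cell P P'"
  shows "\<exists>r c. (r, Suc c) \<notin> cells P \<and> cells P' = insert (r, Suc c) (cells P) \<and> (\<forall>s\<in>K c P - K (Suc c) P. r < s)"
proof -
  obtain c z where c: "z \<notin> K c P" "K c P' = insert z (K c P)" "\<forall>c'. c' \<noteq> c \<longrightarrow> K c' P' = K c' P"
    "\<forall>s\<in>K c P - K (Suc c) P. z < s" using assms unfolding adds_cell_def by blast
  have "cells P' = insert (z, Suc c) (cells P)"
  proof (intro set_eqI)
    fix p :: "nat \<times> nat"
    obtain r d where p: "p = (r, d)" by fastforce
    show "p \<in> cells P' \<longleftrightarrow> p \<in> insert (z, Suc c) (cells P)"
      using c(2,3) p by (cases "d - 1 = c") (auto simp: cells_def)
  qed
  then show ?thesis using c(1,4) by (auto simp: cells_def)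
qed

lemma filtration:
  assumes "E 0 = {}" "\<forall>k<n. g k \<notin> E k \<and> E (Suc k) = insert (g k) (E k)"
  shows "\<And>k. k \<le> n \<Longrightarrow> E k = g ` {..<k}" "inj_on g {..<n}"
    "\<And>k j. k < n \<Longrightarrow> j \<le> n \<Longrightarrow> g k \<in> E j \<longleftrightarrow> k < j"
proof -
  show E: "E k = g ` {..<k}" if "k \<le> n" for k using that
    by (induction k) (use assms in \<open>auto simp: lessThan_Suc\<close>)
  have "g i \<noteq> g j" if "i < j" "j < n" for i j
  proof -
    have "g i \<in> E j" using E[of j] that by auto
    then show ?thesis using assms(2) that(2) by auto
  qed
  then show inj: "inj_on g {..<n}" by (intro linorder_inj_onI) auto
  show "g k \<in> E j \<longleftrightarrow> k < j" if kj: "k < n" "j \<le> n" for k j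
  proof
    assume "g k \<in> E j"
    then obtain x where x: "g k = g x" "x < j" using E[OF kj(2)] by auto
    then have "k = x" using inj_onD[OF inj x(1)] kj by simp
    then show "k < j" using x(2) by simp
  qed (use E[OF kj(2)] in auto)
qed

lemma card_key_diagram:
  assumes "finite (key_diagram a)"
  shows "(\<Sum>r | 1 \<le> r \<and> a r \<noteq> 0. a r) = card (key_diagram a)"
proof -
  let ?R = "{r. 1 \<le> r \<and> a r \<noteq> 0}"
  have "?R \<subseteq> fst ` key_diagram a"
  proof
    fix r assume "r \<in> ?R"
    then have "(r, 1) \<in> key_diagram a" by (simp add: key_diagram_def)
    then show "r \<in> fst ` key_diagram a" by (rule image_eqI[rotated]) simp
  qed
  then have "finite ?R" using assms finite_surj by blast
  moreover have "key_diagram a = (SIGMA r:?R. {1..a r})" by (auto simp: key_diagram_def)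
  ultimately show ?thesis by simp
qed

theorem theorem5p9:
  fixes \<rho> :: "nat list"
  assumes "reduced_word \<rho>"
  shows "\<exists>a. des (weak_P \<rho>) = Some a \<and> standard_key_tableau a (weak_Q \<rho>)"
proof -
  define n where "n = length \<rho>"
  have red: "red (take k \<rho>)" for k
    using red_if_reduced[OF assms] red_appendD1[of "take k \<rho>" "drop k \<rho>"] by simp
  have pos: "0 \<notin> set (take k \<rho>)" for k
    using assms set_take_subset[of k \<rho>] by (force simp: reduced_word_def)
  define P where "P k = eg (take k \<rho>)" for k
  define E where "E k = cells (P k)" for k
  have diag: "des_diagram (weak_P (take k \<rho>)) = E k" for k
    using des_diagram_weak_P[OF red pos] by (simp add: E_def P_def)
  have "\<exists>r c. (r, Suc c) \<notin> E k \<and> E (Suc k) = insert (r, Suc c) (E k) \<and> (\<forall>s\<in>K c (P k) - K (Suc c) (P k). r < s)" if "k < n" for k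
  proof -
    have "take (Suc k) \<rho> = take k \<rho> @ [\<rho> ! k]" using that by (simp add: n_def take_Suc_conv_app_nth)
    then have "adds_cell (P k) (P (Suc k))" using weak_P_adds[of "take k \<rho>" "\<rho> ! k"] red[of "Suc k"] pos[of "Suc k"] by (simp add: P_def)
    then show ?thesis using cells_step by (simp add: E_def)
  qed
  then obtain R C where step: "\<And>k. k < n \<Longrightarrow> (R k, Suc (C k)) \<notin> E k \<and> E (Suc k) = insert (R k, Suc (C k)) (E k) \<and>
    (\<forall>s\<in>K (C k) (P k) - K (Suc (C k)) (P k). R k < s)" by metis
  define g where "g k = (R k, Suc (C k))" for k
  have "K c [] = {}" for c using K_subset[of c "[]"] by simp
  then have E0: "E 0 = {}" by (simp add: E_def P_def eg_def cells_def)
  have "g k \<notin> E k \<and> E (Suc k) = insert (g k) (E k)" if "k < n" for k using step[OF that] by (simp add: g_def)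
  then have st: "\<forall>k<n. g k \<notin> E k \<and> E (Suc k) = insert (g k) (E k)" by blast
  note F = filtration[of E n g, OF E0 st]
  \<comment> \<open>The letters are numbered from the right: the cell added by the letter at list
    position \<open>k\<close> receives \<open>n - k\<close>, and cells added earlier carry larger
    entries.\<close>
  have Q: "weak_Q \<rho> (g k) = n - k" if k: "k < n" for k
    unfolding weak_Q_def
  proof (rule the_equality)
    have d: "des_diagram (weak_insertion_word \<rho> i) = E (n + 1 - i)" for i
      using diag[of "n + 1 - i"] by (simp add: weak_insertion_word_def n_def)
    show "1 \<le> n - k \<and> n - k \<le> length \<rho> \<and>
      g k \<in> des_diagram (weak_insertion_word \<rho> (n - k)) - des_diagram (weak_insertion_word \<rho> (n - k + 1))"
      using k F(3)[OF k] by (simp add: d n_def[symmetric])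
    fix i assume i: "1 \<le> i \<and> i \<le> length \<rho> \<and>
      g k \<in> des_diagram (weak_insertion_word \<rho> i) - des_diagram (weak_insertion_word \<rho> (i + 1))"
    then have "k < n + 1 - i" "\<not> k < n - i" using F(3)[OF k, of "n + 1 - i"] F(3)[OF k, of "n - i"] by (auto simp: d n_def)
    then show "i = n - k" by simp
  qed
  obtain a where a: "des (weak_P \<rho>) = Some a" "key_diagram a = E n"
    using des_weak_P[OF red[of n] pos[of n]] by (auto simp: E_def P_def n_def)
  have En: "E n = g ` {..<n}" using F(1) by simp
  have nested: "(r, c) \<in> E k" if "(r, c') \<in> E k" "1 \<le> c" "c \<le> c'" for r c c' k
    using that K_anti[OF diff_le_mono[OF that(3), of 1], of "P k"] by (auto simp: E_def cells_def)
  have stage: "\<exists>k<n. x = g k \<and> weak_Q \<rho> x = n - k \<and> (\<forall>j\<le>n. x \<in> E j \<longleftrightarrow> k < j)" if "x \<in> E n" for x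
    using that En Q F(3) by auto
  have "standard_key_tableau a (weak_Q \<rho>)"
    unfolding standard_key_tableau_def a(2)
  proof (intro conjI allI impI)
    have "(\<Sum>r | 1 \<le> r \<and> a r \<noteq> 0. a r) = n"
      using card_key_diagram[of a] a(2) En card_image[OF F(2)] by simp
    moreover have "bij_betw (weak_Q \<rho>) (E n) {1..n}"
    proof (rule bij_betwI')
      show "weak_Q \<rho> x = weak_Q \<rho> y \<longleftrightarrow> x = y" if "x \<in> E n" "y \<in> E n" for x y
      proof -
        note sx = stage[OF that(1)] and sy = stage[OF that(2)]
        obtain k where k: "k < n" "x = g k" "weak_Q \<rho> x = n - k" using sx by blast
        obtain l where l: "l < n" "y = g l" "weak_Q \<rho> y = n - l" using sy by blast
        show ?thesis
        proof
          assume "weak_Q \<rho> x = weak_Q \<rho> y"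
          then have "k = l" using k(1,3) l(1,3) by simp
          then show "x = y" using k l by simp
        qed simp
      qed
      show "weak_Q \<rho> x \<in> {1..n}" if "x \<in> E n" for x using stage[OF that] by auto
      show "\<exists>x\<in>E n. i = weak_Q \<rho> x" if "i \<in> {1..n}" for i
        using that Q[of "n - i"] En by (intro bexI[of _ "g (n - i)"]) auto
    qed
    ultimately show "bij_betw (weak_Q \<rho>) (E n) {1..\<Sum>r | 1 \<le> r \<and> a r \<noteq> 0. a r}" by simp
  next
    fix r c c' assume rc: "(r, c) \<in> E n \<and> (r, c') \<in> E n \<and> c < c'"
    obtain k where k: "k < n" "(r, c) = g k" "weak_Q \<rho> (r, c) = n - k" "\<forall>j\<le>n. (r, c) \<in> E j \<longleftrightarrow> k < j"
      using stage rc by blast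
    obtain k' where k': "k' < n" "(r, c') = g k'" "weak_Q \<rho> (r, c') = n - k'" "\<forall>j\<le>n. (r, c') \<in> E j \<longleftrightarrow> k' < j"
      using stage rc by blast
    have "(r, c') \<in> E (Suc k')" using k' by simp
    then have "(r, c) \<in> E (Suc k')" using nested rc by (auto simp: E_def cells_def)
    then have "k < Suc k'" using k(4) k'(1) by simp
    moreover have "k \<noteq> k'"
      proof
        assume "k = k'"
        then have "(r, c) = (r, c')" using k(2) k'(2) by simp
        then show False using rc by simp
      qed
    ultimately show "weak_Q \<rho> (r, c') < weak_Q \<rho> (r, c)" using k k' by simp
  next
    fix r r' c assume h: "(r, c) \<in> E n \<and> (r', c) \<in> E n \<and> r' < r \<and> weak_Q \<rho> (r, c) < weak_Q \<rho> (r', c)"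
    obtain k where k: "k < n" "(r, c) = g k" "weak_Q \<rho> (r, c) = n - k" using stage h by blast
    obtain k' where k': "k' < n" "weak_Q \<rho> (r', c) = n - k'" "\<forall>j\<le>n. (r', c) \<in> E j \<longleftrightarrow> k' < j"
      using stage h by blast
    have "n - k < n - k'" using h k(3) k'(2) by simp
    then have "k' < k" by arith
    then have "(r', c) \<in> E k" using k'(3) k(1) by simp
    then have r': "r' \<in> K (C k) (P k)" using k(2) by (simp add: g_def E_def cells_def)
    \<comment> \<open>The condition on key tableaux: the new element \<open>R k\<close> lies below
      all elements of column \<open>C k\<close> that are missing from the next one. As
      \<open>r' < R k\<close>, row \<open>r'\<close> already has a cell in the next column, and that
      cell has a larger entry.\<close>
    have "r' \<in> K (Suc (C k)) (P k)"
    proof (rule ccontr)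
      assume "r' \<notin> K (Suc (C k)) (P k)"
      then have "R k < r'" using step[OF k(1)] r' by blast
      then show False using h k(2) by (simp add: g_def)
    qed
    then have m: "(r', Suc c) \<in> E k" using k(2) by (simp add: g_def E_def cells_def)
    then have mn: "(r', Suc c) \<in> E n" using F(1) k(1) by fastforce
    obtain l where l: "l < n" "weak_Q \<rho> (r', Suc c) = n - l" "\<forall>j\<le>n. (r', Suc c) \<in> E j \<longleftrightarrow> l < j"
      using stage[OF mn] by blast
    have "l < k" using l(3) m k(1) by simp
    then show "\<exists>c'>c. (r', c') \<in> E n \<and> weak_Q \<rho> (r, c) < weak_Q \<rho> (r', c')"
      using mn l k by (intro exI[of _ "Suc c"]) auto
  qed
  then show ?thesis using a(1) by blast
qed

end
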